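(* Let $\Phi$ be an irreducible crystallographic root system spanning $V=\mathbb{R}^\ell$, with positive system $\Phi^+$, Weyl arrangement $\mathcal{A}$ and Coxeter number $\mathrm{h}$. Let $\beta_1,\beta_2\in\Phi^+$ be such that $X=H_{\beta_1}\cap H_{\beta_2}$ is of type $A_1^2$, with $\Phi\cap\mathrm{span}\{\beta_1,\beta_2\}=\{\pm\beta_1,\pm\beta_2\}$. Then for each $i\in\{1,2\}$, $$|\mathcal{A}^{H_{\beta_i}}|-|\mathcal{A}^X|=\mathrm{h}/2+\mathcal{K}_{\beta_{3-i}}(\beta_i),$$ where $$\mathcal{K}_{\beta_{3-i}}(\beta_i)=\sum_{\Lambda\in\mathcal{M}_{\beta_{3-i}}(\beta_i)}\ \sum_{\delta\in\Lambda^+\setminus\{\beta_i\}}\left(\widehat{\beta_i},\widehat{\delta}\right)^2 .$$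
   Context: $V=\mathbb{R}^\ell$ carries the standard inner product $(\cdot,\cdot)$; root systems are reduced. For $\alpha\in\Phi$ put $H_\alpha=\{x\in V:(\alpha,x)=0\}$; the Weyl arrangement is $\mathcal{A}=\{H_\alpha:\alpha\in\Phi^+\}$. For an intersection $X$ of hyperplanes of $\mathcal{A}$, $\mathcal{A}^X=\{K\cap X:K\in\mathcal{A},\ X\not\subseteq K\}$. $X$ is of type $A_1^2$ if $\Phi\cap X^\perp$ is a root system of type $A_1\times A_1$. A subset $\Gamma\subseteq\Phi$ is a subsystem if it is a root system in $\mathrm{span}(\Gamma)$; its rank is $\dim\mathrm{span}(\Gamma)$. For $\beta\in\Phi$, $\beta^\perp=\{\alpha\in\Phi:(\alpha,\beta)=0\}$. For $i\in\{1,2\}$, $\mathcal{M}_{\beta_{3-i}}(\beta_i)$ is the set of all $\Lambda\subseteq\beta_{3-i}^\perp$ such that $\Lambda$ is an irreducible subsystem of rank $2$ with $\beta_i\in\Lambda$, and $\Phi\cap\mathrm{span}(\{\beta_{3-i}\}\cup\Lambda)$ is a reducible subsystem of rank $3$. $\Lambda^+=\Phi^+\cap\Lambda$. For $x\in V\setminus\{0\}$, $\widehat{x}=x/\sqrt{(x,x)}$ is the normalized unit vector. *)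

theory Defs
  imports "HOL-Analysis.Analysis"
begin

text \<open>Root systems in a Euclidean space\<close>

definition refl_along :: "'a::euclidean_space \<Rightarrow> 'a \<Rightarrow> 'a" where
  "refl_along \<alpha> x = x - (2 * (x \<bullet> \<alpha>) / (\<alpha> \<bullet> \<alpha>)) *\<^sub>R \<alpha>"

text \<open>The last conjunct says that the root system is reduced. The empty set is the root system of
  the zero space.\<close>

definition root_system_in :: "'a::euclidean_space set \<Rightarrow> 'a set \<Rightarrow> bool" where
  "root_system_in U \<Phi> \<longleftrightarrow>
     finite \<Phi> \<and> 0 \<notin> \<Phi> \<and> span \<Phi> = U \<and>
     (\<forall>\<alpha>\<in>\<Phi>. refl_along \<alpha> ` \<Phi> = \<Phi>) \<and>
     (\<forall>\<alpha>\<in>\<Phi>. \<Phi> \<inter> span {\<alpha>} = {\<alpha>, - \<alpha>})"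

definition crystallographic :: "'a::euclidean_space set \<Rightarrow> bool" where
  "crystallographic \<Phi> \<longleftrightarrow> (\<forall>\<alpha>\<in>\<Phi>. \<forall>\<beta>\<in>\<Phi>. 2 * (\<beta> \<bullet> \<alpha>) / (\<alpha> \<bullet> \<alpha>) \<in> \<int>)"

definition reducible :: "'a::euclidean_space set \<Rightarrow> bool" where
  "reducible \<Phi> \<longleftrightarrow>
     (\<exists>\<Phi>1 \<Phi>2. \<Phi>1 \<noteq> {} \<and> \<Phi>2 \<noteq> {} \<and> \<Phi> = \<Phi>1 \<union> \<Phi>2 \<and> (\<forall>\<alpha>\<in>\<Phi>1. \<forall>\<beta>\<in>\<Phi>2. \<alpha> \<bullet> \<beta> = 0))"

definition irreducible_roots :: "'a::euclidean_space set \<Rightarrow> bool" where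
  "irreducible_roots \<Phi> \<longleftrightarrow> \<Phi> \<noteq> {} \<and> \<not> reducible \<Phi>"

definition subsystem :: "'a::euclidean_space set \<Rightarrow> 'a set \<Rightarrow> bool" where
  "subsystem \<Gamma> \<Phi> \<longleftrightarrow> \<Gamma> \<subseteq> \<Phi> \<and> root_system_in (span \<Gamma>) \<Gamma>"

definition root_rank :: "'a::euclidean_space set \<Rightarrow> nat" where
  "root_rank \<Gamma> = dim (span \<Gamma>)"

text \<open>Bases, positive systems and the Coxeter number\<close>

definition root_base :: "'a::euclidean_space set \<Rightarrow> 'a set \<Rightarrow> bool" where
  "root_base \<Phi> \<Delta> \<longleftrightarrow>
     \<Delta> \<subseteq> \<Phi> \<and> independent \<Delta> \<and>
     (\<forall>\<beta>\<in>\<Phi>. \<exists>k :: 'a \<Rightarrow> nat.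
        \<beta> = (\<Sum>\<alpha>\<in>\<Delta>. real (k \<alpha>) *\<^sub>R \<alpha>) \<or> \<beta> = - (\<Sum>\<alpha>\<in>\<Delta>. real (k \<alpha>) *\<^sub>R \<alpha>))"

definition positive_system :: "'a::euclidean_space set \<Rightarrow> 'a set \<Rightarrow> bool" where
  "positive_system \<Phi> P \<longleftrightarrow>
     (\<exists>\<Delta>. root_base \<Phi> \<Delta> \<and>
        P = {\<beta>\<in>\<Phi>. \<exists>k :: 'a \<Rightarrow> nat. \<beta> = (\<Sum>\<alpha>\<in>\<Delta>. real (k \<alpha>) *\<^sub>R \<alpha>)})"

text \<open>A Coxeter element is a product of the simple reflections of some base, each occurring once,
  in an arbitrary order.\<close>

definition coxeter_elements :: "'a::euclidean_space set \<Rightarrow> ('a \<Rightarrow> 'a) set" where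
  "coxeter_elements \<Phi> =
     {foldr (\<lambda>\<alpha> f. refl_along \<alpha> \<circ> f) as id | as. distinct as \<and> root_base \<Phi> (set as)}"

definition map_order :: "('a \<Rightarrow> 'a) \<Rightarrow> nat" where
  "map_order f = (LEAST n. 0 < n \<and> f ^^ n = id)"

text \<open>The Coxeter number is the common order of all Coxeter elements. The description is proper for
  irreducible root systems because their Coxeter elements form one conjugacy class of the Weyl
  group.\<close>

definition coxeter_number :: "'a::euclidean_space set \<Rightarrow> nat" where
  "coxeter_number \<Phi> = (THE h. \<forall>c\<in>coxeter_elements \<Phi>. map_order c = h)"

text \<open>Arrangements and restrictions\<close>

definition root_hyperplane :: "'a::euclidean_space \<Rightarrow> 'a set" where
  "root_hyperplane \<alpha> = {x. \<alpha> \<bullet> x = 0}"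

definition weyl_arrangement :: "'a::euclidean_space set \<Rightarrow> 'a set set" where
  "weyl_arrangement P = root_hyperplane ` P"

definition restriction :: "'a set set \<Rightarrow> 'a set \<Rightarrow> 'a set set" where
  "restriction A X = {K \<inter> X | K. K \<in> A \<and> \<not> X \<subseteq> K}"

definition type_A1 :: "'a::euclidean_space set \<Rightarrow> bool" where
  "type_A1 \<Gamma> \<longleftrightarrow> (\<exists>\<alpha>. \<alpha> \<noteq> 0 \<and> \<Gamma> = {\<alpha>, - \<alpha>})"

definition type_A1_A1 :: "'a::euclidean_space set \<Rightarrow> bool" where
  "type_A1_A1 \<Gamma> \<longleftrightarrow>
     (\<exists>\<Gamma>1 \<Gamma>2. type_A1 \<Gamma>1 \<and> type_A1 \<Gamma>2 \<and> \<Gamma> = \<Gamma>1 \<union> \<Gamma>2 \<and> (\<forall>\<alpha>\<in>\<Gamma>1. \<forall>\<beta>\<in>\<Gamma>2. \<alpha> \<bullet> \<beta> = 0))"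

definition flat_of_type_A1_sq :: "'a::euclidean_space set \<Rightarrow> 'a set \<Rightarrow> bool" where
  "flat_of_type_A1_sq \<Phi> X \<longleftrightarrow> type_A1_A1 (\<Phi> \<inter> X\<^sup>\<bottom>)"

text \<open>The sets $\mathcal{M}_\gamma(\beta)$ and the numbers $\mathcal{K}_\gamma(\beta)$\<close>

definition root_perp :: "'a::euclidean_space set \<Rightarrow> 'a \<Rightarrow> 'a set" where
  "root_perp \<Phi> \<beta> = {\<alpha>\<in>\<Phi>. \<alpha> \<bullet> \<beta> = 0}"

definition M_set :: "'a::euclidean_space set \<Rightarrow> 'a \<Rightarrow> 'a \<Rightarrow> 'a set set" where
  "M_set \<Phi> \<gamma> \<beta> =
     {\<Lambda>. \<Lambda> \<subseteq> root_perp \<Phi> \<gamma> \<and>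
         subsystem \<Lambda> \<Phi> \<and> irreducible_roots \<Lambda> \<and> root_rank \<Lambda> = 2 \<and> \<beta> \<in> \<Lambda> \<and>
         subsystem (\<Phi> \<inter> span ({\<gamma>} \<union> \<Lambda>)) \<Phi> \<and>
         reducible (\<Phi> \<inter> span ({\<gamma>} \<union> \<Lambda>)) \<and>
         root_rank (\<Phi> \<inter> span ({\<gamma>} \<union> \<Lambda>)) = 3}"

text \<open>Here \<open>sgn x\<close> is the library's normalized vector $x / \sqrt{(x,x)}$.\<close>

definition K_number :: "'a::euclidean_space set \<Rightarrow> 'a set \<Rightarrow> 'a \<Rightarrow> 'a \<Rightarrow> real" where
  "K_number \<Phi> P \<gamma> \<beta> = (\<Sum>\<Lambda>\<in>M_set \<Phi> \<gamma> \<beta>. \<Sum>\<delta>\<in>(P \<inter> \<Lambda>) - {\<beta>}. (sgn \<beta> \<bullet> sgn \<delta>)\<^sup>2)"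

end

(* Schur's lemma gives sum_{a>0} cos^2(b,a) = n/l for every root b of an irreducible system of rank l
   with n positive roots, and the Coxeter plane of a bipartite Coxeter element gives 2n = h*l, so that
   the sum is h/2. Sorting the positive roots by the planes through b, and using that a rank 2 system
   with k positive roots has sum k/2, the restriction to H_b has n - h + 1 hyperplanes.
   Sorting them by the 3-dimensional flats W through both roots b, g of the A1 x A1 system expresses
   |A^X| as a sum over the W. Write k_W(b) for the sum of cos^2(b,a) over the positive roots a of W
   other than b, g. An irreducible W with m further positive roots has m - 1 = 3 k_W(b), a reducible one
   has m - 1 = 2 (k_W(b) + k_W(g)), and the sum of k_W(b) over the reducible W is K_g(b). The result is
   |A^{H_b}| - |A^X| = h/2 + 2 K_b(g) - K_g(b). The left side is symmetric in b and g, which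
   forces K_g(b) = K_b(g). *)

theory Submission
  imports Defs
begin

section \<open>Root systems and reflections\<close>

text \<open>\<open>coxeter_number\<close> is a definite description over all bases and all orderings
  of the simple reflections. For one base the noncommutation graph is a forest, so commutations and
  rotations bring every ordering into bipartite form. Between different bases it is 2n = h*l itself
  that makes the orders agree, since n and l depend only on \<open>\<Phi>\<close>. The Coxeter plane
  comes from a Perron vector of the Gram matrix of the base. Its positivity confines the positive
  roots to one sector of the plane, so that all roots lie on finitely many equally spaced rays and
  can be counted by rotation. The delicate point is that the sum of k_W(b) over the reducible W
  equals K_g(b). It requires each member \<open>\<Lambda>\<close> of \<open>M_set\<close> to be
  determined by W, although its definition does not demand that \<open>\<Lambda>\<close> contains
  all roots of its plane. The only possible exception is A2 inside G2. Integrality shows that a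
  plane of type G2 is orthogonal to every root outside it, so it does not occur in an irreducible
  system of rank at least 3.\<close>

lemma refl_along_linear: "linear (refl_along a)"
  unfolding refl_along_def
  by (rule linearI) (auto simp: algebra_simps inner_add_left add_divide_distrib)

lemma refl_along_inner: "refl_along a x \<bullet> refl_along a y = x \<bullet> y"
proof (cases "a = 0")
  case False
  then have "a \<bullet> a \<noteq> 0" by simp
  then show ?thesis
    unfolding refl_along_def
    by (simp add: inner_diff_left inner_diff_right inner_commute field_simps)
qed (simp add: refl_along_def)

lemma refl_along_involution [simp]: "refl_along a (refl_along a x) = x"
proof (cases "a = 0")
  case False
  then have "a \<bullet> a \<noteq> 0" by simp
  then show ?thesis
    by (simp add: refl_along_def inner_diff_left diff_divide_distrib)
qed (simp add: refl_along_def)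

lemma refl_along_o_self [simp]: "refl_along a \<circ> refl_along a = id"
  by (rule ext) simp

lemma bij_refl_along: "bij (refl_along a)"
  by (rule o_bij[of "refl_along a"]) auto

lemma refl_along_inner_left: "refl_along a x \<bullet> y = x \<bullet> refl_along a y"
  using refl_along_inner[of a x "refl_along a y"] by simp

lemma refl_along_self: "refl_along a a = - a"
  by (cases "a = 0") (auto simp: refl_along_def scaleR_2)

lemma refl_along_sgn: "refl_along a x = x - (2 * (x \<bullet> sgn a)) *\<^sub>R sgn a"
  by (cases "a = 0") (auto simp: refl_along_def sgn_div_norm power2_norm_eq_inner[symmetric]
      power2_eq_square field_simps)

lemma refl_along_mem_subspace:
  "subspace W \<Longrightarrow> a \<in> W \<Longrightarrow> x \<in> W \<Longrightarrow> refl_along a x \<in> W"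
  unfolding refl_along_def by (intro subspace_diff subspace_scale)

lemma refl_along_commute:
  "a \<bullet> b = 0 \<Longrightarrow> refl_along a \<circ> refl_along b = refl_along b \<circ> refl_along a"
  by (rule ext) (simp add: refl_along_def inner_diff_left inner_commute algebra_simps)

lemma refl_along_conj:
  assumes "linear f" and "\<And>x y. f x \<bullet> f y = x \<bullet> y"
  shows "refl_along (f a) (f x) = f (refl_along a x)"
  by (simp add: refl_along_def assms linear_diff linear_scale)

context
  fixes W \<Psi> :: "'a::euclidean_space set"
  assumes rs: "root_system_in W \<Psi>"
begin

lemma rs_finite: "finite \<Psi>" and rs_nonzero: "a \<in> \<Psi> \<Longrightarrow> a \<noteq> 0" and rs_span: "span \<Psi> = W"
  and rs_refl_image: "a \<in> \<Psi> \<Longrightarrow> refl_along a ` \<Psi> = \<Psi>"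
  and rs_line: "a \<in> \<Psi> \<Longrightarrow> \<Psi> \<inter> span {a} = {a, - a}"
  using rs unfolding root_system_in_def by auto

lemma rs_refl: "a \<in> \<Psi> \<Longrightarrow> b \<in> \<Psi> \<Longrightarrow> refl_along a b \<in> \<Psi>"
  using rs_refl_image by blast

lemma rs_minus: "a \<in> \<Psi> \<Longrightarrow> - a \<in> \<Psi>"
  using rs_line by blast

lemma rs_subspace: "subspace W"
  using rs_span subspace_span by metis

lemma rs_subset: "\<Psi> \<subseteq> W"
  using rs_span span_superset by metis

text \<open>Reflections in the roots of a subspace preserve that subspace. Taking the subspace to be
  a span of roots guarantees that the roots inside it span it again, so rank and dimension
  agree.\<close>

lemma rs_section:
  assumes "\<Gamma> \<subseteq> \<Psi>"
  shows "root_system_in (span \<Gamma>) (\<Psi> \<inter> span \<Gamma>)"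
proof -
  have "refl_along a ` (\<Psi> \<inter> span \<Gamma>) = \<Psi> \<inter> span \<Gamma>" if "a \<in> \<Psi> \<inter> span \<Gamma>" for a
  proof -
    have "refl_along a b \<in> \<Psi> \<inter> span \<Gamma>" if "b \<in> \<Psi> \<inter> span \<Gamma>" for b
      using that \<open>a \<in> \<Psi> \<inter> span \<Gamma>\<close> rs_refl refl_along_mem_subspace[OF subspace_span] by auto
    then show ?thesis
      by (metis (no_types, lifting) image_iff image_subsetI refl_along_involution subsetI subset_antisym)
  qed
  moreover have "span (\<Psi> \<inter> span \<Gamma>) = span \<Gamma>"
  proof (rule subset_antisym)
    show "span (\<Psi> \<inter> span \<Gamma>) \<subseteq> span \<Gamma>" by (rule span_minimal) auto
    show "span \<Gamma> \<subseteq> span (\<Psi> \<inter> span \<Gamma>)"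
      using assms span_superset[of \<Gamma>] by (intro span_mono) auto
  qed
  moreover have "\<Psi> \<inter> span \<Gamma> \<inter> span {a} = {a, - a}" if "a \<in> \<Psi> \<inter> span \<Gamma>" for a
    using rs_line[of a] that span_neg by auto
  ultimately show ?thesis
    unfolding root_system_in_def using rs_finite rs_nonzero by blast
qed

lemma rs_section_eq: "\<Gamma> \<subseteq> \<Psi> \<Longrightarrow> span (\<Psi> \<inter> span \<Gamma>) = span \<Gamma>"
  using rs_section unfolding root_system_in_def by blast

text \<open>Equality in Cauchy-Schwarz means collinearity, and reducedness leaves only a root and
  its negative on a line.\<close>

lemma rs_inner_sgn_less_1:
  assumes "a \<in> \<Psi>" "b \<in> \<Psi>" "b \<noteq> a" "b \<noteq> - a"
  shows "(sgn a \<bullet> sgn b)\<^sup>2 < 1"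
proof -
  have nz: "a \<noteq> 0" "b \<noteq> 0" using assms rs_nonzero by auto
  have "b \<notin> span {a}" using rs_line assms by auto
  then have "\<not> (\<exists>c. b = c *\<^sub>R a)" by (auto simp: span_singleton)
  then have "\<bar>a \<bullet> b\<bar> \<noteq> norm a * norm b"
    using nz norm_cauchy_schwarz_equal[of a b] collinear_lemma[of a b] by metis
  then have "\<bar>a \<bullet> b\<bar> < norm a * norm b"
    using Cauchy_Schwarz_ineq2[of a b] by linarith
  then have "\<bar>sgn a \<bullet> sgn b\<bar> < 1"
    using nz by (simp add: sgn_div_norm abs_mult field_simps)
  then show ?thesis by (simp add: abs_square_less_1)
qed

end

lemma sgn_inner_self: "x \<noteq> 0 \<Longrightarrow> sgn x \<bullet> sgn x = 1"
  by (simp add: norm_sgn flip: power2_norm_eq_inner)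

lemma sgn_inner_eq_0_iff [simp]: "sgn x \<bullet> y = 0 \<longleftrightarrow> x \<bullet> y = 0"
  by (auto simp: sgn_div_norm)

lemma inner_sgn_eq_0_iff [simp]: "x \<bullet> sgn y = 0 \<longleftrightarrow> x \<bullet> y = 0"
  by (auto simp: sgn_div_norm)

text \<open>The two Cartan integers multiply to four times the squared cosine, so squared cosines
  between roots are multiples of 1/4.\<close>

lemma crystallographic_inner_sgn:
  assumes "crystallographic \<Psi>" "a \<in> \<Psi>" "b \<in> \<Psi>" "0 \<notin> \<Psi>"
  obtains m n :: int where "2 * (b \<bullet> a) = m * (a \<bullet> a)" "2 * (b \<bullet> a) = n * (b \<bullet> b)"
    "4 * (sgn a \<bullet> sgn b)\<^sup>2 = real_of_int (m * n)"
proof -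
  have nz: "a \<noteq> 0" "b \<noteq> 0" using assms by auto
  obtain m n :: int where m: "2 * (b \<bullet> a) / (a \<bullet> a) = m" and n: "2 * (a \<bullet> b) / (b \<bullet> b) = n"
    using assms(1-3) unfolding crystallographic_def by (metis Ints_cases)
  have "real_of_int (m * n) = 4 * (a \<bullet> b)\<^sup>2 / ((a \<bullet> a) * (b \<bullet> b))"
    using m[symmetric] n[symmetric] by (simp add: inner_commute power2_eq_square)
  also have "\<dots> = 4 * (sgn a \<bullet> sgn b)\<^sup>2"
    by (simp add: sgn_div_norm power_divide power_mult_distrib power_inverse field_simps
        flip: power2_norm_eq_inner)
  finally show ?thesis using that[of m n] m n nz by (simp add: field_simps inner_commute)
qed

text \<open>Along the line \<open>t *\<^sub>R x + y\<close> the form is affine in \<open>t\<close>,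
  and an affine function bounded below is constant. This turns an extremal vector of a quadratic
  form on the unit sphere into an eigenvector, for the largest eigenvalue in Schur's argument and
  for the smallest one of the Gram matrix of a base.\<close>

lemma psd_kernel:
  fixes B :: "'a::real_vector \<Rightarrow> 'a \<Rightarrow> real"
  assumes lin: "\<And>y. linear (\<lambda>x. B x y)" and sym: "\<And>x y. B x y = B y x"
    and psd: "\<And>x. x \<in> W \<Longrightarrow> B x x \<ge> 0" and W: "subspace W"
    and x: "x \<in> W" "B x x = 0" and y: "y \<in> W"
  shows "B x y = 0"
proof -
  have q: "0 \<le> B y y + 2 * t * B x y" for t
  proof -
    have "t *\<^sub>R x + y \<in> W" using W x y by (simp add: subspace_add subspace_scale)
    then have "0 \<le> B (t *\<^sub>R x + y) (t *\<^sub>R x + y)" by (rule psd)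
    also have "\<dots> = t * B x (t *\<^sub>R x + y) + B y (t *\<^sub>R x + y)"
      by (simp only: linear_add[OF lin] linear_scale[OF lin] real_scaleR_def)
    also have "\<dots> = t * B (t *\<^sub>R x + y) x + B (t *\<^sub>R x + y) y"
      by (simp only: sym[of "t *\<^sub>R x + y"])
    also have "\<dots> = t * (t * B x x + B y x) + (t * B x y + B y y)"
      by (simp only: linear_add[OF lin] linear_scale[OF lin] real_scaleR_def)
    finally show ?thesis using x(2) by (simp add: algebra_simps sym[of y x])
  qed
  show ?thesis
  proof (rule ccontr)
    assume "B x y \<noteq> 0"
    \<comment> \<open>This choice of \<open>t\<close> makes the affine function equal to -1.\<close>
    then show False
      using q[of "- (B y y + 1) / (2 * B x y)"] by (simp add: field_simps)
  qed
qed

section \<open>The invariant quadratic form\<close>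

lemma orthonormal_sum_squares:
  fixes B :: "'a::euclidean_space set"
  assumes "pairwise orthogonal B" "\<And>b. b \<in> B \<Longrightarrow> norm b = 1" "v \<in> span B"
  shows "(\<Sum>b\<in>B. (b \<bullet> v)\<^sup>2) = v \<bullet> v"
proof -
  have fin: "finite B"
    using assms(1,2) pairwise_orthogonal_imp_finite by blast
  obtain c where v: "v = (\<Sum>b\<in>B. c b *\<^sub>R b)"
    using assms(3) by (auto simp: span_finite[OF fin])
  have c: "b \<bullet> v = c b" if "b \<in> B" for b
  proof -
    have "b \<bullet> v = (\<Sum>b'\<in>B. if b' = b then c b else 0)"
      unfolding v inner_sum_right
      using assms(1,2) that
      by (intro sum.cong) (auto simp: pairwise_def orthogonal_def simp flip: power2_norm_eq_inner)
    then show ?thesis using fin that by simp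
  qed
  have "v \<bullet> v = (\<Sum>b\<in>B. c b * (b \<bullet> v))"
    by (subst (1) v) (simp add: inner_sum_left)
  then show ?thesis using c by (simp add: power2_eq_square)
qed

text \<open>The quadratic form on the left is invariant under the reflections, so the eigenspace of its
  largest eigenvalue contains each root or is orthogonal to it; irreducibility makes it all of \<open>W\<close>,
  and the eigenvalue is found by taking traces.\<close>

theorem sum_inner_sgn_irreducible:
  fixes W \<Psi> :: "'a::euclidean_space set"
  assumes rs: "root_system_in W \<Psi>" and irr: "irreducible_roots \<Psi>" and "x \<in> W"
  shows "(\<Sum>a\<in>\<Psi>. (x \<bullet> sgn a)\<^sup>2) = real (card \<Psi>) / real (dim W) * (x \<bullet> x)"
proof -
  note fin = rs_finite[OF rs] and sub = rs_subspace[OF rs]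
  define q where "q = (\<lambda>x. \<Sum>a\<in>\<Psi>. (x \<bullet> sgn a)\<^sup>2)"
  obtain a0 where a0: "a0 \<in> \<Psi>" using irr unfolding irreducible_roots_def by blast
  have "sgn a0 \<in> W"
    using a0 rs_subset[OF rs] subspace_scale[OF sub] by (auto simp: sgn_div_norm)
  then have "sphere 0 1 \<inter> W \<noteq> {}"
    using rs_nonzero[OF rs a0] by (metis IntI empty_iff mem_sphere_0 norm_sgn)
  moreover have "compact (sphere 0 1 \<inter> W)"
    by (simp add: closed_subspace compact_Int_closed sub)
  moreover have "continuous_on (sphere 0 1 \<inter> W) q"
    unfolding q_def by (intro continuous_intros)
  ultimately obtain x0 where x0: "x0 \<in> sphere 0 1 \<inter> W"
    and max: "\<And>x. x \<in> sphere 0 1 \<inter> W \<Longrightarrow> q x \<le> q x0"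
    by (metis continuous_attains_sup)
  define \<mu> where "\<mu> = q x0"
  \<comment> \<open>\<open>B\<close> is the polar form of
    \<open>\<mu> * (x \<bullet> x) - q x\<close>, which is nonnegative on \<open>W\<close> because
    \<open>\<mu>\<close> is the maximum of \<open>q\<close> on the unit sphere. Its radical
    \<open>E\<close> is the eigenspace of \<open>\<mu>\<close>.\<close>
  define B where "B = (\<lambda>x y. \<mu> * (x \<bullet> y) - (\<Sum>a\<in>\<Psi>. (x \<bullet> sgn a) * (y \<bullet> sgn a)))"
  have B_self: "B x x = \<mu> * (x \<bullet> x) - q x" for x
    by (simp add: B_def q_def power2_eq_square)
  have B_lin: "linear (\<lambda>x. B x y)" for y
    unfolding B_def
    by (rule linearI) (auto simp: algebra_simps inner_add_left sum.distrib sum_distrib_left)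
  have B_sym: "B x y = B y x" for x y
    by (simp add: B_def inner_commute mult.commute)
  have B_psd: "B x x \<ge> 0" if "x \<in> W" for x
  proof (cases "x = 0")
    case False
    have "q x = (norm x)\<^sup>2 * q (sgn x)"
      using False by (simp add: q_def sgn_div_norm sum_distrib_left power_mult_distrib field_simps)
    moreover have "sgn x \<in> sphere 0 1 \<inter> W"
      using False that subspace_scale[OF sub] by (auto simp: norm_sgn, simp add: sgn_div_norm)
    then have "q (sgn x) \<le> \<mu>" using max \<mu>_def by blast
    ultimately show ?thesis
      by (simp add: B_self mult.commute mult_right_mono flip: power2_norm_eq_inner)
  qed (simp add: B_def)
  define E where "E = {x\<in>W. \<forall>y\<in>W. B x y = 0}"
  have B0: "B 0 y = 0" for y using linear_0[OF B_lin] .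
  have E_sub: "subspace E"
    unfolding E_def using sub B_lin
    by (auto simp: subspace_def linear_add[OF B_lin] linear_scale[OF B_lin] B0)
  have "x0 \<bullet> x0 = 1" using x0 by (simp flip: power2_norm_eq_inner)
  then have "B x0 x0 = 0" by (simp add: B_self \<mu>_def)
  then have x0E: "x0 \<in> E"
    unfolding E_def using psd_kernel[of B W x0] B_lin B_sym B_psd sub x0 by blast
  have E_refl: "refl_along a x \<in> E" if a: "a \<in> \<Psi>" and x: "x \<in> E" for a x
  proof -
    have W: "refl_along a y \<in> W" if "y \<in> W" for y
      using a that rs_subset[OF rs] refl_along_mem_subspace[OF sub] by blast
    have "B (refl_along a x) y = B x (refl_along a y)" for y
    proof -
      have eq: "refl_along a y \<bullet> sgn (refl_along a b) = y \<bullet> sgn b" for b y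
      proof -
        have "norm (refl_along a b) = norm b"
          by (simp add: norm_eq_sqrt_inner refl_along_inner)
        then show ?thesis by (simp add: sgn_div_norm refl_along_inner)
      qed
      have "(\<Sum>b\<in>\<Psi>. (refl_along a x \<bullet> sgn b) * (y \<bullet> sgn b)) =
          (\<Sum>b\<in>refl_along a ` \<Psi>. (refl_along a x \<bullet> sgn b) * (y \<bullet> sgn b))"
        using rs_refl_image[OF rs a] by simp
      also have "\<dots> = (\<Sum>b\<in>\<Psi>. (refl_along a x \<bullet> sgn (refl_along a b)) * (y \<bullet> sgn (refl_along a b)))"
        by (rule sum.reindex_cong[of "refl_along a"])
          (auto intro: inj_on_subset[OF bij_is_inj[OF bij_refl_along]])
      also have "\<dots> = (\<Sum>b\<in>\<Psi>. (x \<bullet> sgn b) * (refl_along a y \<bullet> sgn b))"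
        using eq eq[of "refl_along a y" for y] by simp
      finally show ?thesis by (simp add: B_def refl_along_inner_left)
    qed
    then show ?thesis using x W unfolding E_def by auto
  qed
  have dich: "a \<in> E \<or> (\<forall>x\<in>E. x \<bullet> a = 0)" if a: "a \<in> \<Psi>" for a
  proof (rule disjCI)
    assume "\<not> (\<forall>x\<in>E. x \<bullet> a = 0)"
    then obtain x where x: "x \<in> E" "x \<bullet> a \<noteq> 0" by blast
    define c where "c = 2 * (x \<bullet> a) / (a \<bullet> a)"
    have "c \<noteq> 0" using x rs_nonzero[OF rs a] by (simp add: c_def)
    \<comment> \<open>The reflection moves \<open>x\<close> only along \<open>a\<close>, so
      invariance of \<open>E\<close> puts \<open>a\<close> itself into \<open>E\<close> as soon as
      some vector of \<open>E\<close> is not orthogonal to it.\<close>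
    have "x - refl_along a x = c *\<^sub>R a" by (simp add: refl_along_def c_def)
    moreover have "x - refl_along a x \<in> E"
      using E_sub x E_refl[OF a] by (simp add: subspace_diff)
    ultimately have "(1 / c) *\<^sub>R (c *\<^sub>R a) \<in> E" using subspace_scale[OF E_sub] by metis
    then show "a \<in> E" using \<open>c \<noteq> 0\<close> by simp
  qed
  define \<Psi>1 where "\<Psi>1 = \<Psi> \<inter> E"
  define \<Psi>2 where "\<Psi>2 = {a\<in>\<Psi>. \<forall>x\<in>E. x \<bullet> a = 0}"
  have "\<Psi> = \<Psi>1 \<union> \<Psi>2" "\<forall>a\<in>\<Psi>1. \<forall>b\<in>\<Psi>2. a \<bullet> b = 0"
    using dich by (auto simp: \<Psi>1_def \<Psi>2_def)
  then have "\<Psi>1 = {} \<or> \<Psi>2 = {}"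
    using irr unfolding irreducible_roots_def reducible_def by blast
  moreover have "\<Psi>1 \<noteq> {}"
  proof
    assume "\<Psi>1 = {}"
    then have "\<forall>a\<in>\<Psi>. orthogonal x0 a" using x0E dich by (auto simp: \<Psi>1_def orthogonal_def)
    then have "orthogonal x0 x0"
      using orthogonal_to_span[of x0 \<Psi>] x0 rs_span[OF rs] by blast
    then show False using x0 by (auto simp: orthogonal_self)
  qed
  ultimately have "\<Psi> \<subseteq> E" using \<open>\<Psi> = \<Psi>1 \<union> \<Psi>2\<close> \<Psi>1_def by blast
  then have "W \<subseteq> E"
    using span_minimal[of \<Psi> E] E_sub rs_span[OF rs] by simp
  then have q: "q x = \<mu> * (x \<bullet> x)" if "x \<in> W" for x
    using that B_self[of x] by (auto simp: E_def)
  obtain D where D: "D \<subseteq> W" "pairwise orthogonal D" "\<And>b. b \<in> D \<Longrightarrow> norm b = 1"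
    "independent D" "card D = dim W" "span D = W"
    using orthonormal_basis_subspace[OF sub] by metis
  have "(\<Sum>b\<in>D. q b) = (\<Sum>a\<in>\<Psi>. \<Sum>b\<in>D. (b \<bullet> sgn a)\<^sup>2)"
    unfolding q_def by (rule sum.swap)
  also have "\<dots> = (\<Sum>a\<in>\<Psi>. 1)"
  proof (rule sum.cong)
    fix a assume a: "a \<in> \<Psi>"
    have "sgn a \<in> span D"
      using a D(6) rs_subset[OF rs] subspace_scale[OF sub] by (auto simp: sgn_div_norm)
    then show "(\<Sum>b\<in>D. (b \<bullet> sgn a)\<^sup>2) = 1"
      using orthonormal_sum_squares[OF D(2,3)] sgn_inner_self rs_nonzero[OF rs a] by simp
  qed simp
  also have "(\<Sum>b\<in>D. q b) = (\<Sum>b\<in>D. \<mu>)"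
    using D(1,3) q by (intro sum.cong) (auto simp flip: power2_norm_eq_inner)
  finally have "\<mu> * dim W = card \<Psi>" using D(5) by (simp add: mult.commute)
  moreover have "dim W \<noteq> 0"
    using x0 by (auto simp: dim_eq_0)
  ultimately have "\<mu> = card \<Psi> / dim W" by (simp add: field_simps)
  then show ?thesis using q[OF \<open>x \<in> W\<close>] by (simp add: q_def)
qed

section \<open>Orthogonal decompositions and reducible systems of small rank\<close>

text \<open>Orthogonal parts have spans that meet only in 0, so each part consists of all roots in
  its own span and is a section of \<open>\<Psi>\<close>.\<close>

lemma reducible_parts_root_system:
  fixes W \<Psi> :: "'a::euclidean_space set"
  assumes rs: "root_system_in W \<Psi>" and un: "\<Psi> = \<Psi>1 \<union> \<Psi>2"
    and orth: "\<forall>a\<in>\<Psi>1. \<forall>b\<in>\<Psi>2. a \<bullet> b = 0"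
  shows "\<Psi> \<inter> span \<Psi>1 = \<Psi>1" "root_system_in (span \<Psi>1) \<Psi>1"
    "dim W = dim \<Psi>1 + dim \<Psi>2" "\<Psi>1 \<inter> \<Psi>2 = {}"
proof -
  have disj: "span \<Psi>1 \<inter> span \<Psi>2 \<subseteq> {0}"
  proof
    fix x assume x: "x \<in> span \<Psi>1 \<inter> span \<Psi>2"
    have "orthogonal x b" if "b \<in> \<Psi>2" for b
    proof -
      have "orthogonal b x"
        using x that orth by (intro orthogonal_to_span[of x \<Psi>1]) (auto simp: orthogonal_def inner_commute)
      then show ?thesis by (simp add: orthogonal_commute)
    qed
    then have "orthogonal x x" using x orthogonal_to_span[of x \<Psi>2] by blast
    then show "x \<in> {0}" by (simp add: orthogonal_self)
  qed
  have nz: "0 \<notin> \<Psi>" using rs_nonzero[OF rs] by blast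
  show e: "\<Psi> \<inter> span \<Psi>1 = \<Psi>1"
    using disj un nz span_superset[of \<Psi>1] span_superset[of \<Psi>2] by blast
  show "root_system_in (span \<Psi>1) \<Psi>1"
    using rs_section[OF rs, of \<Psi>1] e un by simp
  show "\<Psi>1 \<inter> \<Psi>2 = {}"
    using disj un nz span_superset[of \<Psi>1] span_superset[of \<Psi>2] by blast
  have "dim {x + y |x y. x \<in> span \<Psi>1 \<and> y \<in> span \<Psi>2} + dim (span \<Psi>1 \<inter> span \<Psi>2)
      = dim (span \<Psi>1) + dim (span \<Psi>2)"
    by (rule dim_sums_Int) auto
  moreover have "{x + y |x y. x \<in> span \<Psi>1 \<and> y \<in> span \<Psi>2} = W"
    using rs_span[OF rs] un by (auto simp: span_Un)
  moreover have "dim (span \<Psi>1 \<inter> span \<Psi>2) = 0" using disj dim_eq_0 by blast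
  ultimately show "dim W = dim \<Psi>1 + dim \<Psi>2" by (simp add: dim_span)
qed

lemma rs_dim_1:
  assumes rs: "root_system_in W \<Psi>" and "a \<in> \<Psi>" "dim W \<le> 1"
  shows "\<Psi> = {a, - a}"
proof -
  have "W = span {a}"
  proof (rule sym, rule subspace_dim_equal)
    show "dim W \<le> dim (span {a})"
      using assms(3) rs_nonzero[OF rs assms(2)] by (simp add: dim_span dim_singleton)
    show "span {a} \<subseteq> W"
      by (rule span_minimal) (use rs_subspace[OF rs] rs_subset[OF rs] assms(2) in auto)
  qed (use rs_subspace[OF rs] in auto)
  then show ?thesis using rs_line[OF rs assms(2)] rs_subset[OF rs] by blast
qed

text \<open>In dimension at most 3 one of two orthogonal parts has rank at most 1 and is therefore a
  pair \<open>{d, - d}\<close>. The other part may itself be reducible.\<close>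

lemma reducible_rank_1_part:
  assumes rs: "root_system_in W \<Psi>" and "reducible \<Psi>" "dim W \<le> 3"
  obtains d \<Psi>2 where "\<Psi> = {d, - d} \<union> \<Psi>2" "\<Psi>2 \<noteq> {}" "\<forall>b\<in>\<Psi>2. d \<bullet> b = 0"
    "root_system_in (span \<Psi>2) \<Psi>2" "dim (span \<Psi>2) + 1 = dim W" "d \<notin> \<Psi>2" "- d \<notin> \<Psi>2" "d \<noteq> 0"
proof -
  note witness = that
  have key: thesis
    if "\<Psi> = A \<union> B" and orth: "\<forall>a\<in>A. \<forall>b\<in>B. a \<bullet> b = 0" and ne: "A \<noteq> {}" "B \<noteq> {}"
      and "dim A \<le> 1" for A B
  proof -
    have orth': "\<forall>a\<in>B. \<forall>b\<in>A. a \<bullet> b = 0" using orth inner_commute by metis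
    note pA = reducible_parts_root_system[OF rs \<open>\<Psi> = A \<union> B\<close> orth]
    have "\<Psi> = B \<union> A" using \<open>\<Psi> = A \<union> B\<close> by blast
    note pB = reducible_parts_root_system[OF rs this orth']
    obtain d where d: "d \<in> A" using ne by blast
    have A: "A = {d, - d}" using rs_dim_1[OF pA(2) d] \<open>dim A \<le> 1\<close> by (simp add: dim_span)
    have dnz: "d \<noteq> 0" using rs_nonzero[OF pA(2) d] .
    have "dim A = 1"
    proof -
      have "span A = span {d}"
        by (rule span_eq[THEN iffD2]) (auto simp: A span_base span_neg)
      then show ?thesis using dnz by (metis dim_singleton dim_span)
    qed
    then show thesis
      using witness[of d B] \<open>\<Psi> = A \<union> B\<close> A ne orth d pB pA dnz by (auto simp: dim_span)
  qed
  obtain A B where AB: "A \<noteq> {}" "B \<noteq> {}" "\<Psi> = A \<union> B" "\<forall>a\<in>A. \<forall>b\<in>B. a \<bullet> b = 0"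
    using assms(2) unfolding reducible_def by blast
  have "dim W = dim A + dim B" using reducible_parts_root_system(3)[OF rs AB(3,4)] .
  then have "dim A \<le> 1 \<or> dim B \<le> 1" using assms(3) by linarith
  then show thesis
    using key[of A B] key[of B A] AB by (metis inner_commute sup_commute)
qed

text \<open>The reducible case consists of two perpendicular lines, with squared cosines 1, 1, 0, 0.
  The mean 1/2 of the irreducible case persists, in contrast to reducible systems of rank 3 such as
  A1 x A2.\<close>

lemma sum_inner_sgn_rank_2:
  assumes rs: "root_system_in W \<Psi>" and dim: "dim W = 2" and b: "b \<in> \<Psi>"
  shows "(\<Sum>a\<in>\<Psi>. (sgn b \<bullet> sgn a)\<^sup>2) = real (card \<Psi>) / 2"
proof (cases "reducible \<Psi>")
  case False
  then have "irreducible_roots \<Psi>" using b by (auto simp: irreducible_roots_def)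
  moreover have "sgn b \<in> W"
    using b rs_subset[OF rs] subspace_scale[OF rs_subspace[OF rs]] by (auto simp: sgn_div_norm)
  ultimately show ?thesis
    using sum_inner_sgn_irreducible[OF rs] dim sgn_inner_self[OF rs_nonzero[OF rs b]] by simp
next
  case True
  obtain d \<Psi>2 where d: "\<Psi> = {d, - d} \<union> \<Psi>2" "\<Psi>2 \<noteq> {}" "\<forall>b\<in>\<Psi>2. d \<bullet> b = 0"
    "root_system_in (span \<Psi>2) \<Psi>2" "dim (span \<Psi>2) + 1 = dim W" "d \<notin> \<Psi>2" "- d \<notin> \<Psi>2" "d \<noteq> 0"
    using reducible_rank_1_part[OF rs True] dim by auto
  obtain e where e: "e \<in> \<Psi>2" using d by blast
  have E: "\<Psi>2 = {e, - e}" using rs_dim_1[OF d(4) e] d dim by simp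
  have nz: "e \<noteq> 0" "e \<noteq> - e" "d \<noteq> - d"
    using rs_nonzero[OF d(4) e] d(8) by (simp_all add: eq_neg_iff_add_eq_0 flip: scaleR_2)
  have o: "d \<bullet> e = 0" "e \<bullet> d = 0" using d(3) e by (auto simp: inner_commute)
  have \<Psi>: "\<Psi> = {d, - d, e, - e}" using d(1) E by blast
  have ne: "d \<noteq> e" "d \<noteq> - e" "- d \<noteq> e" using d(6,7) E by auto
  have "card \<Psi> = 4" using nz ne by (simp add: \<Psi>)
  moreover have "(\<Sum>a\<in>\<Psi>. f a) = f d + f (- d) + f e + f (- e)" for f :: "'a \<Rightarrow> real"
    using nz ne by (simp add: \<Psi> add.assoc)
  moreover consider "b = d" | "b = - d" | "b = e" | "b = - e" using b \<Psi> by blast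
  then have "(sgn b \<bullet> sgn d)\<^sup>2 + (sgn b \<bullet> sgn (- d))\<^sup>2 + (sgn b \<bullet> sgn e)\<^sup>2 + (sgn b \<bullet> sgn (- e))\<^sup>2 = 2"
    using o nz(1) d(8) by cases (simp_all add: sgn_minus sgn_inner_self)
  ultimately show ?thesis by simp
qed

section \<open>Irreducible subsystems of rank 2\<close>

lemma irreducible_roots_part:
  assumes "irreducible_roots \<Psi>" "\<Psi> = A \<union> B" "\<And>a b. a \<in> A \<Longrightarrow> b \<in> B \<Longrightarrow> a \<bullet> b = 0"
  shows "A = {} \<or> B = {}"
  using assms(1) unfolding irreducible_roots_def reducible_def
  by (metis assms(2,3))

lemma int_square_mod_3: "(m::int)\<^sup>2 mod 3 \<noteq> 2"
proof -
  have "m mod 3 = 0 \<or> m mod 3 = 1 \<or> m mod 3 = 2" by presburger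
  moreover have "m\<^sup>2 mod 3 = (m mod 3)\<^sup>2 mod 3" by (simp add: power_mod)
  ultimately show ?thesis by auto
qed

text \<open>A pair \<open>a\<close>, \<open>b\<close> as below spans a system of type \<open>G\<^sub>2\<close>. If \<open>c\<close> were a root neither in
  its plane nor orthogonal to it, with \<open>m\<close>, \<open>n\<close> its Cartan integers against \<open>a\<close>, \<open>b\<close>, and \<open>M\<close>, \<open>N\<close>
  the reversed ones, then comparing \<open>c\<close> with its projection to the plane bounds the positive integers
  \<open>m\<^sup>2 - 3mn + 3n\<^sup>2\<close> and \<open>3M\<^sup>2 - 3MN + N\<^sup>2\<close> so tightly that they both are \<open>1\<close>, which is impossible
  modulo 3.\<close>

lemma G2_plane_isolated:
  fixes \<Phi> :: "'a::euclidean_space set"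
  assumes cr: "crystallographic \<Phi>" and nz: "0 \<notin> \<Phi>"
    and roots: "a \<in> \<Phi>" "b \<in> \<Phi>" "c \<in> \<Phi>"
    and len: "b \<bullet> b = 3 * (a \<bullet> a)" and ab: "2 * (a \<bullet> b) = 3 * (a \<bullet> a)"
    and c: "c \<notin> span {a, b}"
  shows "c \<bullet> a = 0 \<and> c \<bullet> b = 0"
proof (rule ccontr)
  assume nonorth: "\<not> (c \<bullet> a = 0 \<and> c \<bullet> b = 0)"
  have int: "\<exists>k::int. 2 * (y \<bullet> x) / (x \<bullet> x) = k" if "x \<in> \<Phi>" "y \<in> \<Phi>" for x y
    using cr that unfolding crystallographic_def by (metis Ints_cases)
  obtain m :: int where m: "2 * (c \<bullet> a) / (a \<bullet> a) = m" using int[of a c] roots by blast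
  obtain n :: int where n: "2 * (c \<bullet> b) / (b \<bullet> b) = n" using int[of b c] roots by blast
  obtain M :: int where M: "2 * (a \<bullet> c) / (c \<bullet> c) = M" using int[of c a] roots by blast
  obtain N :: int where N: "2 * (b \<bullet> c) / (c \<bullet> c) = N" using int[of c b] roots by blast
  define s where "s = a \<bullet> a"
  define t where "t = c \<bullet> c / s"
  define g where "g = m\<^sup>2 - 3 * m * n + 3 * n\<^sup>2"
  define f where "f = 3 * M\<^sup>2 - 3 * M * N + N\<^sup>2"
  have "a \<noteq> 0" "c \<noteq> 0" using nz roots by auto
  then have s: "s > 0" and t: "t > 0" by (simp_all add: s_def t_def)
  have ca: "c \<bullet> a = m * s / 2" and cb: "c \<bullet> b = 3 * n * s / 2"
    using m n s len by (simp_all add: field_simps flip: s_def)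
  have cc: "c \<bullet> c = t * s" using s by (simp add: t_def)
  have mM: "m = t * M" and nN: "3 * n = t * N"
    using M[unfolded inner_commute[of a c] ca cc] N[unfolded inner_commute[of b c] cb cc] s t
    by (simp_all add: field_simps)
  \<comment> \<open>Solving the normal equations for the Gram matrix \<open>s\<close> times ((1,
    3/2), (3/2, 3)) of \<open>a\<close>, \<open>b\<close> gives these coefficients of the orthogonal
    projection \<open>p\<close> of \<open>c\<close> to the plane. Since
    \<open>p \<bullet> p = s * g\<close>, the number \<open>s * (t - g)\<close> below is the squared
    distance of \<open>c\<close> from the plane.\<close>
  define x y where "x = real_of_int (2 * m - 3 * n)" and "y = real_of_int (2 * n - m)"
  define p where "p = x *\<^sub>R a + y *\<^sub>R b"
  have "p \<in> span {a, b}"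
    unfolding p_def by (intro span_add span_scale span_base) auto
  then have "c - p \<noteq> 0" using c by auto
  then have "0 < (c - p) \<bullet> (c - p)" by simp
  also have "\<dots> = c \<bullet> c - 2 * (x * (c \<bullet> a) + y * (c \<bullet> b))
      + (x\<^sup>2 * (a \<bullet> a) + 2 * x * y * (a \<bullet> b) + y\<^sup>2 * (b \<bullet> b))"
    by (simp add: p_def inner_diff_left inner_diff_right inner_add_left inner_add_right
        inner_commute power2_eq_square algebra_simps)
  also have "\<dots> = s * (t - g)"
  proof -
    have e: "a \<bullet> b = 3 * s / 2" "b \<bullet> b = 3 * s" "a \<bullet> a = s" using ab len by (simp_all add: s_def)
    show ?thesis
      unfolding ca cb cc e x_def y_def g_def by (simp add: power2_eq_square field_simps)
  qed
  finally have gt: "g < t" using s by (metis diff_gt_0_iff_gt zero_less_mult_pos)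
  have "m \<noteq> 0 \<or> n \<noteq> 0" using nonorth ca cb by auto
  moreover have "4 * g = (2 * m - 3 * n)\<^sup>2 + 3 * n\<^sup>2"
    by (simp add: g_def power2_eq_square algebra_simps)
  ultimately have "4 * g > 0"
    by (cases "n = 0") (auto intro: add_nonneg_pos)
  then have g1: "g \<ge> 1" by simp
  have tf: "t * t * f = 3 * g"
  proof -
    have "t * t * f = 3 * (t * M)\<^sup>2 - 3 * (t * M) * (t * N) + (t * N)\<^sup>2"
      by (simp add: f_def power2_eq_square algebra_simps)
    also have "\<dots> = 3 * g"
      unfolding mM[symmetric] nN[symmetric] by (simp add: g_def power2_eq_square algebra_simps)
    finally show ?thesis .
  qed
  have f1: "f \<ge> 1"
  proof (rule ccontr)
    assume "\<not> f \<ge> 1"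
    then have "t * t * real_of_int f \<le> 0" using t by (simp add: mult_nonneg_nonpos)
    then show False using tf g1 by simp
  qed
  have t1: "t > 1" using gt g1 by linarith
  \<comment> \<open>The relations \<open>g < t\<close> and \<open>t * t * f = 3 * g\<close> squeeze
    both forms: \<open>t * f < 3\<close>, hence \<open>f < 3\<close>, and once \<open>f = 1\<close>
    also \<open>g < 3\<close>.\<close>
  have "t * (t * f) < t * 3" using gt tf by (simp add: mult.assoc)
  then have tf3: "t * f < 3" using t by simp
  have "1 * real_of_int f \<le> t * real_of_int f"
    using t1 f1 by (intro mult_right_mono) auto
  then have "real_of_int f < 3" using tf3 by linarith
  then have "f = 1 \<or> f = 2" using f1 by auto
  moreover have "f mod 3 = N\<^sup>2 mod 3"
  proof -
    have "f = N\<^sup>2 + 3 * (M\<^sup>2 - M * N)" by (simp add: f_def algebra_simps)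
    then show ?thesis by (simp only: mod_mult_self2)
  qed
  then have "f \<noteq> 2" using int_square_mod_3[of N] by auto
  ultimately have f: "f = 1" by blast
  have "g < 3" using gt tf3 f by simp
  moreover have gm: "g mod 3 = m\<^sup>2 mod 3"
  proof -
    have "g = m\<^sup>2 + 3 * (n\<^sup>2 - m * n)" by (simp add: g_def algebra_simps)
    then show ?thesis by (simp only: mod_mult_self2)
  qed
  then have "g \<noteq> 2" using int_square_mod_3[of m] by auto
  ultimately have g: "g = 1" using g1 by linarith
  \<comment> \<open>For \<open>f = g = 1\<close> the relation reads \<open>t * t = 3\<close>, so
    \<open>m = t * M\<close> makes \<open>m\<^sup>2\<close> divisible by 3, while
    \<open>g = 1\<close> makes it 1 modulo 3.\<close>
  have "real_of_int (m\<^sup>2) = t * t * real_of_int (M\<^sup>2)"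
    using mM by (simp add: power2_eq_square)
  also have "\<dots> = real_of_int (3 * M\<^sup>2)" using tf f g by simp
  finally have "m\<^sup>2 = 3 * M\<^sup>2" by (simp only: of_int_eq_iff)
  then have "m\<^sup>2 mod 3 = 0" by simp
  then show False using gm g by simp
qed

text \<open>Squared cosine 3/4 means Cartan integers with product 3. Listing the shorter root first
  and changing a sign if the angle is obtuse gives the configuration of
  \<open>G2_plane_isolated\<close>. The roots then split into those of the plane and those
  orthogonal to it, and irreducibility leaves only the plane.\<close>

lemma no_30_degrees:
  fixes W \<Phi> :: "'a::euclidean_space set"
  assumes rs: "root_system_in W \<Phi>" and cr: "crystallographic \<Phi>" and irr: "irreducible_roots \<Phi>"
    and ab: "a \<in> \<Phi>" "b \<in> \<Phi>" and angle: "(sgn a \<bullet> sgn b)\<^sup>2 = 3 / 4"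
  shows "dim W \<le> 2"
proof -
  have nz: "0 \<notin> \<Phi>" using rs_nonzero[OF rs] by blast
  obtain m n :: int where m: "2 * (b \<bullet> a) = m * (a \<bullet> a)" and n: "2 * (b \<bullet> a) = n * (b \<bullet> b)"
    and mn': "4 * (sgn a \<bullet> sgn b)\<^sup>2 = real_of_int (m * n)"
    using crystallographic_inner_sgn[OF cr ab nz] .
  have "real_of_int (m * n) = real_of_int 3" using mn' angle by simp
  then have mn: "m * n = 3" by (simp only: of_int_eq_iff)
  then have "m dvd 3" by (metis dvd_triv_left)
  then have "\<bar>m\<bar> \<le> 3" "m \<noteq> 0" using dvd_imp_le_int[of 3 m] by auto
  then have "m = 1 \<or> m = - 1 \<or> m = 2 \<or> m = -2 \<or> m = 3 \<or> m = - 3" by auto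
  then have "(m = 1 \<and> n = 3) \<or> (m = -1 \<and> n = -3) \<or> (m = 3 \<and> n = 1) \<or> (m = -3 \<and> n = -1)"
    using mn by (elim disjE) (simp_all, presburger+)
  moreover have "- a \<in> \<Phi>" using rs_minus[OF rs ab(1)] .
  ultimately obtain a' b' where a'b': "a' \<in> \<Phi>" "b' \<in> \<Phi>" "b' \<bullet> b' = 3 * (a' \<bullet> a')"
    "2 * (a' \<bullet> b') = 3 * (a' \<bullet> a')"
  proof (elim disjE conjE, goal_cases)
    case 1 then show ?case using m n ab by (intro 1(1)[of b a]) (simp_all add: inner_commute)
  next
    case 2 then show ?case using m n ab by (intro 2(1)[of b "- a"]) (simp_all add: inner_commute)
  next
    case 3 then show ?case using m n ab by (intro 3(1)[of a b]) (simp_all add: inner_commute)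
  next
    case 4 then show ?case using m n ab by (intro 4(1)[of "- a" b]) (simp_all add: inner_commute)
  qed
  define U where "U = span {a', b'}"
  define \<Phi>2 where "\<Phi>2 = {c\<in>\<Phi>. c \<bullet> a' = 0 \<and> c \<bullet> b' = 0}"
  have un: "\<Phi> = (\<Phi> \<inter> U) \<union> \<Phi>2"
    using G2_plane_isolated[OF cr nz a'b'(1,2) _ a'b'(3,4)] by (auto simp: U_def \<Phi>2_def)
  have "c \<bullet> d = 0" if "c \<in> \<Phi> \<inter> U" "d \<in> \<Phi>2" for c d
  proof -
    have "orthogonal d c"
      using that by (intro orthogonal_to_span[of c "{a', b'}"]) (auto simp: U_def \<Phi>2_def orthogonal_def)
    then show ?thesis by (simp add: orthogonal_def inner_commute)
  qed
  then have "\<Phi> \<inter> U = {} \<or> \<Phi>2 = {}" by (rule irreducible_roots_part[OF irr un])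
  moreover have "a' \<in> \<Phi> \<inter> U" using a'b' by (auto simp: U_def span_base)
  ultimately have "\<Phi>2 = {}" by blast
  then have "\<Phi> \<subseteq> U" using un by blast
  then have "W \<subseteq> span {a', b'}"
    using rs_span[OF rs] span_minimal[of \<Phi> U] by (simp add: U_def)
  then have "dim W \<le> card {a', b'}" by (intro dim_le_card) auto
  also have "\<dots> \<le> 2" by (simp add: card_insert_if)
  finally show ?thesis .
qed

text \<open>A root of the plane outside \<open>\<Lambda>\<close> has mean squared cosine \<open>1/2\<close> against \<open>\<Lambda>\<close>. Since the possible
  values are 0, 1/4, 1/2 and 3/4, either 3/4 occurs or \<open>\<Lambda>\<close> lies on two perpendicular lines.\<close>

lemma irreducible_rank_2_subsystem_full:
  fixes W \<Phi> :: "'a::euclidean_space set"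
  assumes rs: "root_system_in W \<Phi>" and cr: "crystallographic \<Phi>" and irr: "irreducible_roots \<Phi>"
    and dim: "dim W \<ge> 3"
    and sub: "subsystem \<Lambda> \<Phi>" and irr\<Lambda>: "irreducible_roots \<Lambda>" and rank: "root_rank \<Lambda> = 2"
  shows "\<Phi> \<inter> span \<Lambda> = \<Lambda>"
proof (rule ccontr)
  assume "\<Phi> \<inter> span \<Lambda> \<noteq> \<Lambda>"
  moreover have \<Lambda>: "\<Lambda> \<subseteq> \<Phi>" "root_system_in (span \<Lambda>) \<Lambda>" using sub by (auto simp: subsystem_def)
  ultimately obtain a where a: "a \<in> \<Phi>" "a \<in> span \<Lambda>" "a \<notin> \<Lambda>"
    using span_superset by blast
  have nz: "0 \<notin> \<Phi>" using rs_nonzero[OF rs] by blast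
  have fin: "finite \<Lambda>" using rs_finite[OF \<Lambda>(2)] .
  have half: "(sgn a \<bullet> sgn d)\<^sup>2 \<le> 1 / 2" if d: "d \<in> \<Lambda>" for d
  proof -
    have "d \<noteq> a" "d \<noteq> - a" using d a rs_minus[OF \<Lambda>(2) d] by auto
    then have lt: "(sgn a \<bullet> sgn d)\<^sup>2 < 1" using rs_inner_sgn_less_1[OF rs a(1)] d \<Lambda> by blast
    obtain k :: int where k: "4 * (sgn a \<bullet> sgn d)\<^sup>2 = real_of_int k"
      using crystallographic_inner_sgn[OF cr a(1) subsetD[OF \<Lambda>(1) d] nz] .
    have "(sgn a \<bullet> sgn d)\<^sup>2 \<noteq> 3 / 4"
      using no_30_degrees[OF rs cr irr a(1), of d] d \<Lambda> dim by auto
    then have "k \<noteq> 3" "k < 4" using k lt by auto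
    then have "real_of_int k \<le> 2" by linarith
    then show ?thesis using k by simp
  qed
  have sa: "sgn a \<in> span \<Lambda>" using a by (simp add: sgn_div_norm span_scale)
  have "sgn a \<bullet> sgn a = 1" using a nz by (intro sgn_inner_self) auto
  then have "(\<Sum>d\<in>\<Lambda>. (sgn a \<bullet> sgn d)\<^sup>2) = (\<Sum>d\<in>\<Lambda>. 1 / 2)"
    using sum_inner_sgn_irreducible[OF \<Lambda>(2) irr\<Lambda> sa] rank by (simp add: root_rank_def)
  then have "\<And>d. d \<in> \<Lambda> \<Longrightarrow> (sgn a \<bullet> sgn d)\<^sup>2 = 1 / 2"
    using sum_mono_inv[where f = "\<lambda>d. (sgn a \<bullet> sgn d)\<^sup>2" and g = "\<lambda>_. 1 / 2", OF _ half _ fin]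
    by blast
  then have const: "2 * (sgn a \<bullet> sgn d)\<^sup>2 = 1" if "d \<in> \<Lambda>" for d using that by fastforce
  obtain e where e: "e \<in> \<Lambda>" using irr\<Lambda> unfolding irreducible_roots_def by blast
  have "e \<noteq> 0" using e nz \<Lambda> by auto
  define e' where "e' = sgn e"
  \<comment> \<open>\<open>u\<close> is the mirror image of \<open>e'\<close> in the line of
    \<open>a\<close>. That line makes an angle of 45 degrees with the line of \<open>e'\<close>, so
    \<open>u\<close> is perpendicular to \<open>e'\<close>.\<close>
  define u where "u = (2 * (sgn a \<bullet> e')) *\<^sub>R sgn a - e'"
  have e1: "e' \<bullet> e' = 1" using \<open>e \<noteq> 0\<close> sgn_inner_self by (simp add: e'_def)
  have ae: "2 * (sgn a \<bullet> e')\<^sup>2 = 1" using const[OF e] by (simp add: e'_def)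
  have ue: "u \<bullet> e' = 0"
    using ae e1 by (simp add: u_def inner_diff_left power2_eq_square)
  have uu: "u \<bullet> u = 1"
    using ae e1 \<open>sgn a \<bullet> sgn a = 1\<close>
    by (simp add: u_def inner_diff_left inner_diff_right inner_commute power2_eq_square algebra_simps)
  have ne: "u \<noteq> e'" using ue e1 by auto
  have orth: "pairwise orthogonal {e', u}"
    using ue by (auto simp: pairwise_def orthogonal_def inner_commute)
  have norm1: "norm b = 1" if "b \<in> {e', u}" for b
    using that e1 uu by (auto simp: norm_eq_sqrt_inner)
  have "independent {e', u}"
    using pairwise_orthogonal_independent[OF orth] norm1 by fastforce
  moreover have "{e', u} \<subseteq> span \<Lambda>"
  proof -
    have "e' \<in> span \<Lambda>" using e by (simp add: e'_def sgn_div_norm span_base span_scale)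
    then show ?thesis using sa by (auto simp: u_def intro!: span_diff span_scale)
  qed
  moreover have "card {e', u} = dim (span \<Lambda>)"
    using ne rank by (simp add: root_rank_def)
  ultimately have sp: "span \<Lambda> \<subseteq> span {e', u}"
    using card_ge_dim_independent[of "{e', u}" "span \<Lambda>"] by simp
  define \<Lambda>2 where "\<Lambda>2 = {d\<in>\<Lambda>. e \<bullet> d = 0}"
  have dich: "d \<in> {e, - e} \<or> d \<in> \<Lambda>2" if d: "d \<in> \<Lambda>" for d
  proof (rule disjCI)
    assume "d \<notin> \<Lambda>2"
    then have ne: "e' \<bullet> sgn d \<noteq> 0" using d by (auto simp: \<Lambda>2_def e'_def)
    have "d \<noteq> 0" using d nz \<Lambda> by auto
    then have d1: "sgn d \<bullet> sgn d = 1" by (rule sgn_inner_self)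
    have "sgn d \<in> span {e', u}" 
      using subsetD[OF sp span_base[OF d]] by (simp add: sgn_div_norm span_scale)
    then have pars: "(e' \<bullet> sgn d)\<^sup>2 + (u \<bullet> sgn d)\<^sup>2 = 1"
      using orthonormal_sum_squares[OF orth norm1] d1 \<open>u \<noteq> e'\<close> by simp
    \<comment> \<open>The vector \<open>e' + u\<close> is a multiple of \<open>sgn a\<close> of
      squared length 2, so its squared inner product with \<open>sgn d\<close> is 1. The squared
      coordinates of \<open>sgn d\<close> also sum to 1, hence the mixed term vanishes and
      \<open>sgn d\<close> lies on one of the two axes.\<close>
    have "u \<bullet> sgn d = 2 * (sgn a \<bullet> e') * (sgn a \<bullet> sgn d) - e' \<bullet> sgn d"
      by (simp add: u_def inner_diff_left)
    then have "(e' \<bullet> sgn d + u \<bullet> sgn d)\<^sup>2 = (2 * (sgn a \<bullet> e')\<^sup>2) * (2 * (sgn a \<bullet> sgn d)\<^sup>2)"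
      by (simp add: power2_eq_square)
    also have "\<dots> = 1" using ae const[OF d] by simp
    finally have "(e' \<bullet> sgn d) * (u \<bullet> sgn d) = 0"
      using pars by (simp add: power2_sum)
    then have "u \<bullet> sgn d = 0" using ne mult_eq_0_iff by blast
    then have "(e' \<bullet> sgn d)\<^sup>2 = 1" using pars by (simp del: inner_sgn_eq_0_iff)
    then show "d \<in> {e, - e}"
      using rs_inner_sgn_less_1[OF \<Lambda>(2) e d] by (auto simp: e'_def)
  qed
  have me: "- e \<in> \<Lambda>" using rs_minus[OF \<Lambda>(2) e] .
  have "\<Lambda> = {e, - e} \<union> \<Lambda>2"
    using dich e me by (auto simp: \<Lambda>2_def)
  then have "{e, - e} = {} \<or> \<Lambda>2 = {}"
    by (rule irreducible_roots_part[OF irr\<Lambda>]) (auto simp: \<Lambda>2_def)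
  then have "\<Lambda>2 = {}" by simp
  then have "\<Lambda> \<subseteq> span {e}"
    using dich span_base[of e "{e}"] span_neg[OF span_base[of e "{e}"]] by auto
  then have "span \<Lambda> \<subseteq> span {e}" by (simp add: span_minimal)
  then have "dim (span \<Lambda>) \<le> card {e}" by (intro dim_le_card) auto
  then show False using rank by (simp add: root_rank_def)
qed

section \<open>Coxeter elements up to commutation and rotation\<close>

text \<open>With orthogonality as \<open>C\<close>, a \<open>swap\<close> exchanges commuting
  reflections of a product and \<open>rot\<close> conjugates the product by its first factor, so the
  order of the product is an invariant of this equivalence.\<close>

inductive cyc_eq :: "('a \<Rightarrow> 'a \<Rightarrow> bool) \<Rightarrow> 'a list \<Rightarrow> 'a list \<Rightarrow> bool" for C where
  same: "cyc_eq C xs xs"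
| symm: "cyc_eq C xs ys \<Longrightarrow> cyc_eq C ys xs"
| chain [trans]: "cyc_eq C xs ys \<Longrightarrow> cyc_eq C ys zs \<Longrightarrow> cyc_eq C xs zs"
| swap: "C a b \<Longrightarrow> cyc_eq C (p @ a # b # q) (p @ b # a # q)"
| rot: "cyc_eq C (a # xs) (xs @ [a])"

lemma cyc_eq_mset: "cyc_eq C xs ys \<Longrightarrow> mset xs = mset ys"
  by (induction rule: cyc_eq.induct) auto

lemma cyc_eq_move_left: "\<forall>x\<in>set p. C x v \<Longrightarrow> cyc_eq C (r @ p @ v # q) (r @ v # p @ q)"
proof (induction p arbitrary: r)
  case (Cons x p)
  have "cyc_eq C ((r @ [x]) @ p @ v # q) ((r @ [x]) @ v # p @ q)"
    by (rule Cons.IH) (use Cons.prems in auto)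
  also have "cyc_eq C ((r @ [x]) @ v # p @ q) (r @ v # x # p @ q)"
    using cyc_eq.swap[of C x v r "p @ q"] Cons.prems by simp
  finally show ?case by simp
qed (simp add: cyc_eq.same)

lemma cyc_eq_rotate: "cyc_eq C (p @ q) (q @ p)"
proof (induction p arbitrary: q)
  case (Cons x p)
  have "cyc_eq C (x # (p @ q)) ((p @ q) @ [x])" by (rule cyc_eq.rot)
  also have "cyc_eq C ((p @ q) @ [x]) ((q @ [x]) @ p)" using Cons.IH[of "q @ [x]"] by simp
  finally show ?case by simp
qed (simp add: cyc_eq.same)

definition insert_after :: "'a \<Rightarrow> 'a \<Rightarrow> 'a list \<Rightarrow> 'a list" where
  "insert_after u v xs = concat (map (\<lambda>x. if x = u then [u, v] else [x]) xs)"

lemma insert_after_append [simp]: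
  "insert_after u v (xs @ ys) = insert_after u v xs @ insert_after u v ys"
  "insert_after u v (x # xs) = (if x = u then [u, v] else [x]) @ insert_after u v xs"
  "insert_after u v [] = []"
  by (simp_all add: insert_after_def)

lemma insert_after_notin: "u \<notin> set xs \<Longrightarrow> insert_after u v xs = xs"
  by (induction xs) auto

text \<open>Everything except \<open>u\<close> commutes with \<open>v\<close>, so the block of
  \<open>u\<close> and \<open>v\<close> passes a neighbour of \<open>u\<close> by two swaps and
  travels around the end of the list by two rotations.\<close>

lemma cyc_eq_insert_after:
  assumes "cyc_eq C xs ys" "\<forall>x\<in>set xs. x \<noteq> u \<longrightarrow> C x v \<and> C v x"
  shows "cyc_eq C (insert_after u v xs) (insert_after u v ys)"
  using assms
proof (induction rule: cyc_eq.induct)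
  case (symm xs ys)
  have "set xs = set ys" using cyc_eq_mset[OF symm.hyps] by (metis set_mset_mset)
  then show ?case using symm cyc_eq.symm by blast
next
  case (chain xs ys zs)
  have "set xs = set ys" using cyc_eq_mset[OF chain.hyps(1)] by (metis set_mset_mset)
  with chain.prems have "\<forall>x\<in>set ys. x \<noteq> u \<longrightarrow> C x v \<and> C v x" by simp
  then show ?case using cyc_eq.chain[OF chain.IH(1)[OF chain.prems] chain.IH(2)] by blast
next
  case (swap a b p q)
  define p' q' where "p' = insert_after u v p" and "q' = insert_after u v q"
  consider "a = b" | "a \<noteq> u" "b \<noteq> u" | "a = u" "b \<noteq> u" | "a \<noteq> u" "b = u" by blast
  then show ?case
  proof cases
    case 3
    have "cyc_eq C ((p' @ [u]) @ v # b # q') ((p' @ [u]) @ b # v # q')"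
      by (rule cyc_eq.swap) (use swap 3 in auto)
    also have "cyc_eq C ((p' @ [u]) @ b # v # q') (p' @ b # u # v # q')"
      using cyc_eq.swap[of C u b p' "v # q'"] swap 3 by simp
    finally show ?thesis using 3 by (simp add: p'_def q'_def)
  next
    case 4
    have "cyc_eq C (p' @ a # u # v # q') (p' @ u # a # v # q')"
      by (rule cyc_eq.swap) (use swap 4 in auto)
    also have "cyc_eq C (p' @ u # a # v # q') ((p' @ [u]) @ v # a # q')"
      using cyc_eq.swap[of C a v "p' @ [u]" q'] swap 4 by simp
    finally show ?thesis using 4 by (simp add: p'_def q'_def)
  qed (use swap in \<open>auto intro: cyc_eq.swap cyc_eq.same\<close>)
next
  case (rot a xs)
  show ?case
    using cyc_eq_rotate[of C "if a = u then [u, v] else [a]" "insert_after u v xs"] by auto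
qed (simp add: cyc_eq.same)

text \<open>Removing a leaf \<open>v\<close> of the noncommutation graph, whose only neighbour is \<open>u\<close>, the list can be
  arranged so that \<open>v\<close> immediately follows \<open>u\<close>, and this block then moves like \<open>u\<close>.\<close>

lemma cyc_eq_bipartite:
  assumes sym: "\<And>a b. C a b \<Longrightarrow> C b a" and "distinct as"
    and leaf: "\<And>T. T \<subseteq> set as \<Longrightarrow> T \<noteq> {} \<Longrightarrow> \<exists>v\<in>T. \<exists>u. \<forall>x\<in>T - {v}. x \<noteq> u \<longrightarrow> C x v"
  shows "\<exists>xs ys. cyc_eq C as (xs @ ys) \<and> pairwise C (set xs) \<and> pairwise C (set ys)"
  using assms(2,3)
proof (induction "length as" arbitrary: as)
  case 0
  then have "cyc_eq C as ([] @ [])" by (simp add: cyc_eq.same)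
  then show ?case by (metis list.set(1) pairwise_empty)
next
  case (Suc n)
  then have "set as \<noteq> {}" by auto
  then obtain v u0 where v: "v \<in> set as" and u0: "\<forall>x\<in>set as - {v}. x \<noteq> u0 \<longrightarrow> C x v"
    using Suc.prems(2)[of "set as"] by blast
  obtain p q where pq: "as = p @ v # q" using v by (meson split_list)
  define as' where "as' = p @ q"
  have dist: "distinct as'" "v \<notin> set as'" and set': "set as' = set as - {v}"
    using Suc.prems(1) by (auto simp: pq as'_def)
  show ?case
  proof (cases "as' = []")
    case True
    then have "cyc_eq C as ([v] @ [])" by (simp add: pq as'_def cyc_eq.same)
    then show ?thesis by (metis empty_set list.simps(15) pairwise_empty pairwise_singleton)
  next
    case False
    \<comment> \<open>If \<open>u0\<close> does not occur in the remaining list, \<open>v\<close>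
      commutes with all of it and may be attached to any entry, here the first one.\<close>
    define u where "u = (if u0 \<in> set as' then u0 else hd as')"
    have u: "u \<in> set as'" using False by (auto simp: u_def)
    have Cv: "\<forall>x\<in>set as'. x \<noteq> u \<longrightarrow> C x v \<and> C v x"
    proof (intro ballI impI)
      fix x assume x: "x \<in> set as'" "x \<noteq> u"
      then have "x \<noteq> u0" by (auto simp: u_def)
      then have "C x v" using u0 x set' by auto
      then show "C x v \<and> C v x" using sym by blast
    qed
    \<comment> \<open>An earlier \<open>u\<close> is reached by moving \<open>v\<close> left. For a
      later one \<open>v\<close> is moved to the front, rotated to the end and then moved
      left.\<close>
    have to_ins: "cyc_eq C as (insert_after u v as')"
    proof (cases "u \<in> set p")
      case True
      then obtain p1 p2 where p: "p = p1 @ u # p2" by (meson split_list)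
      have "cyc_eq C ((p1 @ [u]) @ p2 @ v # q) ((p1 @ [u]) @ v # p2 @ q)"
        by (rule cyc_eq_move_left) (use Cv dist in \<open>auto simp: as'_def p\<close>)
      moreover have "insert_after u v as' = p1 @ u # v # p2 @ q"
        using dist by (simp add: as'_def p insert_after_notin)
      ultimately show ?thesis by (simp add: pq p)
    next
      case False
      then obtain q1 q2 where q: "q = q1 @ u # q2" using u by (auto simp: as'_def dest: split_list)
      have "cyc_eq C ([] @ p @ v # q) ([] @ v # p @ q)"
        by (rule cyc_eq_move_left) (use Cv False in \<open>auto simp: as'_def\<close>)
      also have "cyc_eq C ([] @ v # p @ q) ((p @ q1 @ [u]) @ q2 @ [v])"
        using cyc_eq.rot[of C v "p @ q"] by (simp add: q)
      also (cyc_eq.chain) have "cyc_eq C ((p @ q1 @ [u]) @ q2 @ v # []) ((p @ q1 @ [u]) @ v # q2 @ [])"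
        by (rule cyc_eq_move_left) (use Cv dist in \<open>auto simp: as'_def q\<close>)
      finally (cyc_eq.chain) have "cyc_eq C as (p @ q1 @ u # v # q2)" by (simp add: pq)
      moreover have "insert_after u v as' = p @ q1 @ u # v # q2"
        using dist by (simp add: as'_def q insert_after_notin)
      ultimately show ?thesis by simp
    qed
    have "n = length as'" using Suc.hyps(2) by (simp add: pq as'_def)
    moreover have "\<exists>v\<in>T. \<exists>u. \<forall>x\<in>T - {v}. x \<noteq> u \<longrightarrow> C x v" if "T \<subseteq> set as'" "T \<noteq> {}" for T
      using Suc.prems(2)[of T] that set' by blast
    ultimately obtain xs ys where xy: "cyc_eq C as' (xs @ ys)" "pairwise C (set xs)" "pairwise C (set ys)"
      using Suc.hyps(1)[of as'] dist by blast
    have m: "mset as' = mset (xs @ ys)" using cyc_eq_mset[OF xy(1)] .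
    then have sxy: "set as' = set xs \<union> set ys" and dxy: "distinct (xs @ ys)"
      using dist(1) by (metis set_append set_mset_mset, metis mset_eq_imp_distinct_iff)
    have ins: "cyc_eq C as (insert_after u v (xs @ ys))"
      using cyc_eq.chain[OF to_ins cyc_eq_insert_after[OF xy(1) Cv]] .
    \<comment> \<open>\<open>v\<close> joins the class opposite to that of \<open>u\<close>: from
      inside \<open>xs\<close> it slides right to the head of \<open>ys\<close>, and from inside
      \<open>ys\<close> it slides to the end and a rotation carries it to the front of
      \<open>xs\<close>.\<close>
    consider "u \<in> set xs" | "u \<in> set ys" using u sxy by auto
    then show ?thesis
    proof cases
      case 1
      then obtain r t where xs: "xs = r @ u # t" by (meson split_list)
      have t: "\<forall>x\<in>set t. C x v"
      proof
        fix x assume "x \<in> set t"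
        then have "x \<in> set as'" "x \<noteq> u" using sxy dxy by (auto simp: xs)
        then show "C x v" using Cv by blast
      qed
      have "insert_after u v (xs @ ys) = (r @ [u]) @ [v] @ t @ ys"
        using dxy by (simp add: xs insert_after_notin)
      also have "cyc_eq C \<dots> ((r @ [u]) @ t @ v # ys)"
        using cyc_eq.symm[OF cyc_eq_move_left[of t C v "r @ [u]" ys]] t by simp
      finally have "cyc_eq C as (xs @ v # ys)"
        using cyc_eq.chain[OF ins] by (simp add: xs)
      moreover have "pairwise C (set (v # ys))"
        using xy(3) Cv 1 dxy sxy by (auto simp: pairwise_insert)
      ultimately show ?thesis using xy(2) by blast
    next
      case 2
      then obtain r t where ys: "ys = r @ u # t" by (meson split_list)
      have t: "\<forall>x\<in>set t. C x v"
      proof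
        fix x assume "x \<in> set t"
        then have "x \<in> set as'" "x \<noteq> u" using sxy dxy by (auto simp: ys)
        then show "C x v" using Cv by blast
      qed
      have "insert_after u v (xs @ ys) = (xs @ r @ [u]) @ [v] @ t @ []"
        using dxy by (simp add: ys insert_after_notin)
      also have "cyc_eq C \<dots> ((xs @ r @ [u]) @ t @ v # [])"
        using cyc_eq.symm[OF cyc_eq_move_left[of t C v "xs @ r @ [u]" "[]"]] t by simp
      also have "cyc_eq C \<dots> (v # (xs @ r @ [u]) @ t)"
        using cyc_eq.symm[OF cyc_eq.rot[of C v "(xs @ r @ [u]) @ t"]] by simp
      finally have "cyc_eq C as ((v # xs) @ ys)"
        using cyc_eq.chain[OF ins] by (simp add: ys)
      moreover have "pairwise C (set (v # xs))"
        using xy(2) Cv 2 dxy sxy by (auto simp: pairwise_insert)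
      ultimately show ?thesis using xy(3) by blast
    qed
  qed
qed

lemma funpow_conj:
  assumes "f \<circ> f = id"
  shows "(f \<circ> g \<circ> f) ^^ n = f \<circ> g ^^ n \<circ> f"
proof (induction n)
  case (Suc n)
  have "(f \<circ> g \<circ> f) ^^ Suc n = (f \<circ> g \<circ> f) \<circ> (f \<circ> g ^^ n \<circ> f)"
    unfolding funpow.simps Suc.IH ..
  also have "\<dots> = f \<circ> g \<circ> (f \<circ> f) \<circ> g ^^ n \<circ> f" by (simp only: comp_assoc)
  also have "\<dots> = f \<circ> g ^^ Suc n \<circ> f"
    unfolding assms by (simp only: funpow.simps comp_id comp_assoc)
  finally show ?case .
qed (simp add: assms)

lemma map_order_conj:
  assumes "f \<circ> f = id"
  shows "map_order (f \<circ> g \<circ> f) = map_order g"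
proof -
  have "f \<circ> h \<circ> f = id \<longleftrightarrow> h = id" for h
  proof
    assume "f \<circ> h \<circ> f = id"
    then have "f \<circ> (f \<circ> h \<circ> f) \<circ> f = f \<circ> id \<circ> f" by simp
    moreover have "f \<circ> (f \<circ> h \<circ> f) \<circ> f = (f \<circ> f) \<circ> h \<circ> (f \<circ> f)" by (simp only: comp_assoc)
    ultimately show "h = id" using assms by simp
  qed (use assms in simp)
  then show ?thesis unfolding map_order_def funpow_conj[OF assms] by simp
qed

section \<open>Products of reflections along a list\<close>

definition refl_prod :: "'a::euclidean_space list \<Rightarrow> 'a \<Rightarrow> 'a" where
  "refl_prod as = foldr (\<lambda>\<alpha> f. refl_along \<alpha> \<circ> f) as id"

lemma refl_prod_simps [simp]:
  "refl_prod [] = id" "refl_prod (a # as) = refl_along a \<circ> refl_prod as"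
  "refl_prod (as @ bs) = refl_prod as \<circ> refl_prod bs"
proof -
  show "refl_prod (as @ bs) = refl_prod as \<circ> refl_prod bs"
    by (induction as) (simp_all add: refl_prod_def comp_assoc)
qed (simp_all add: refl_prod_def)

lemma refl_prod_linear: "linear (refl_prod as)"
proof (induction as)
  case (Cons a as)
  show ?case unfolding refl_prod_simps by (rule linear_compose[OF Cons refl_along_linear])
qed (simp only: refl_prod_simps linear_id)

lemma refl_prod_inner: "refl_prod as x \<bullet> refl_prod as y = x \<bullet> y"
  by (induction as) (simp_all add: refl_along_inner)

lemma refl_prod_bij: "bij (refl_prod as)"
proof (induction as)
  case (Cons a as)
  show ?case unfolding refl_prod_simps by (rule bij_comp[OF Cons bij_refl_along])
qed (simp only: refl_prod_simps bij_id)

lemma refl_prod_rs: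
  assumes "root_system_in W \<Psi>" "set as \<subseteq> \<Psi>" "x \<in> \<Psi>"
  shows "refl_prod as x \<in> \<Psi>"
  using assms by (induction as) (auto intro: rs_refl)

lemma refl_prod_image:
  assumes "root_system_in W \<Psi>" "set as \<subseteq> \<Psi>"
  shows "refl_prod as ` \<Psi> = \<Psi>"
  using assms(2)
proof (induction as)
  case (Cons a as)
  then show ?case using rs_refl_image[OF assms(1)] by (simp flip: image_image add: image_comp[symmetric])
qed simp

lemma funpow_refl_prod: "refl_prod as ^^ n = refl_prod (concat (replicate n as))"
  by (induction n) simp_all

lemma map_order_cyc_eq:
  "cyc_eq (\<lambda>a b. a \<bullet> b = 0) xs ys \<Longrightarrow> map_order (refl_prod xs) = map_order (refl_prod ys)"
proof (induction rule: cyc_eq.induct)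
  case (swap a b p q)
  have "refl_prod (p @ a # b # q) = refl_prod p \<circ> (refl_along a \<circ> refl_along b) \<circ> refl_prod q"
    by (simp add: comp_assoc)
  then show ?case using refl_along_commute[OF swap] by (simp add: comp_assoc)
next
  case (rot a xs)
  have "refl_prod (a # xs) = refl_along a \<circ> refl_prod (xs @ [a]) \<circ> refl_along a"
    by (simp add: comp_assoc)
  then show ?case by (simp only: map_order_conj refl_along_o_self)
qed auto

text \<open>Each reflection leaves the components along the other, orthogonal vectors unchanged, so
  the corrections add up.\<close>

lemma refl_prod_orthogonal:
  assumes "distinct as" "pairwise (\<lambda>a b. a \<bullet> b = 0) (set as)"
  shows "refl_prod as x = x - (\<Sum>a\<in>set as. (2 * (x \<bullet> sgn a)) *\<^sub>R sgn a)"
  using assms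
proof (induction as)
  case (Cons a as)
  have orth: "b \<bullet> sgn a = 0" if "b \<in> set as" for b
    using Cons.prems that by (auto simp: pairwise_insert)
  have "refl_prod as x \<bullet> sgn a = x \<bullet> sgn a"
    using Cons orth by (auto simp: pairwise_insert inner_diff_left inner_sum_left intro!: sum.neutral)
  moreover have "refl_prod (a # as) x = refl_prod as x - (2 * (refl_prod as x \<bullet> sgn a)) *\<^sub>R sgn a"
    by (simp add: refl_along_sgn)
  ultimately show ?case
    using Cons by (simp add: pairwise_insert del: refl_prod_simps)
qed simp

section \<open>Bases and positive roots\<close>

locale based_root_system =
  fixes \<Phi> \<Delta> :: "'a::euclidean_space set"
  assumes rs: "root_system_in UNIV \<Phi>" and cr: "crystallographic \<Phi>" and base: "root_base \<Phi> \<Delta>"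
begin

abbreviation coeff :: "'a \<Rightarrow> 'a \<Rightarrow> real" where
  "coeff x d \<equiv> representation \<Delta> x d"

text \<open>Signs of real coefficients are easier to follow through reflections than natural
  combinations. By \<open>pos_iff\<close> this is the set from
  \<open>positive_system\<close>.\<close>

definition pos :: "'a set" where
  "pos = {b\<in>\<Phi>. \<forall>d\<in>\<Delta>. 0 \<le> coeff b d}"

lemma base_subset: "\<Delta> \<subseteq> \<Phi>" and base_indep: "independent \<Delta>"
  using base unfolding root_base_def by auto

lemma base_finite: "finite \<Delta>"
  using base_subset rs_finite[OF rs] finite_subset by blast

lemma base_nonzero: "d \<in> \<Delta> \<Longrightarrow> d \<noteq> 0"
  using base_subset rs_nonzero[OF rs] by blast

lemma nat_combination:
  assumes "b \<in> \<Phi>"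
  obtains k :: "'a \<Rightarrow> nat" where "b = (\<Sum>d\<in>\<Delta>. real (k d) *\<^sub>R d) \<or> b = - (\<Sum>d\<in>\<Delta>. real (k d) *\<^sub>R d)"
  using base assms unfolding root_base_def by meson

lemma base_span: "span \<Delta> = UNIV"
proof -
  have "\<Phi> \<subseteq> span \<Delta>"
  proof
    fix b assume "b \<in> \<Phi>"
    then obtain k :: "'a \<Rightarrow> nat"
      where "b = (\<Sum>d\<in>\<Delta>. real (k d) *\<^sub>R d) \<or> b = - (\<Sum>d\<in>\<Delta>. real (k d) *\<^sub>R d)"
      using nat_combination by blast
    moreover have "(\<Sum>d\<in>\<Delta>. real (k d) *\<^sub>R d) \<in> span \<Delta>"
      by (intro span_sum span_scale span_base)
    ultimately show "b \<in> span \<Delta>" using span_neg by auto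
  qed
  then show ?thesis using rs_span[OF rs] span_minimal[of \<Phi> "span \<Delta>"] by auto
qed

lemma base_card: "card \<Delta> = DIM('a)"
  using base_indep base_span by (metis dim_UNIV dim_eq_card_independent dim_span)

lemma coeff_sum: "(\<Sum>d\<in>\<Delta>. coeff x d *\<^sub>R d) = x"
  using sum_representation_eq[OF base_indep _ base_finite] base_span by blast

lemma coeff_linear: "linear (\<lambda>x. coeff x d)"
  by (rule linearI) (simp_all add: representation_add[OF base_indep] representation_scale[OF base_indep] base_span)

lemma coeff_base: "d \<in> \<Delta> \<Longrightarrow> coeff d e = (if e = d then 1 else 0)"
  using representation_basis[OF base_indep] by simp

lemma coeff_combination: "d \<in> \<Delta> \<Longrightarrow> coeff (\<Sum>e\<in>\<Delta>. k e *\<^sub>R e) d = k d"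
proof -
  assume d: "d \<in> \<Delta>"
  have "coeff (\<Sum>e\<in>\<Delta>. k e *\<^sub>R e) d = (\<Sum>e\<in>\<Delta>. if e = d then k e else 0)"
    by (simp add: linear_sum[OF coeff_linear] linear_scale[OF coeff_linear] coeff_base)
      (rule sum.cong, auto simp: coeff_base)
  then show ?thesis using base_finite d by simp
qed

lemma coeff_eqI: "(\<And>d. d \<in> \<Delta> \<Longrightarrow> coeff x d = coeff y d) \<Longrightarrow> x = y"
  using coeff_sum[of x] coeff_sum[of y] by (metis (no_types, lifting) sum.cong)

lemma pos_iff: "b \<in> pos \<longleftrightarrow> b \<in> \<Phi> \<and> (\<exists>k :: 'a \<Rightarrow> nat. b = (\<Sum>d\<in>\<Delta>. real (k d) *\<^sub>R d))"
proof
  assume b: "b \<in> pos"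
  then obtain k :: "'a \<Rightarrow> nat"
    where k: "b = (\<Sum>d\<in>\<Delta>. real (k d) *\<^sub>R d) \<or> b = - (\<Sum>d\<in>\<Delta>. real (k d) *\<^sub>R d)"
    using nat_combination by (auto simp: pos_def)
  moreover have "b = 0" if "b = - (\<Sum>d\<in>\<Delta>. real (k d) *\<^sub>R d)"
  proof (rule coeff_eqI)
    fix d assume d: "d \<in> \<Delta>"
    have "coeff b d = - real (k d)"
      using d that by (simp add: linear_neg[OF coeff_linear] coeff_combination)
    then show "coeff b d = coeff 0 d"
      using b d by (force simp: pos_def linear_0[OF coeff_linear])
  qed
  ultimately show "b \<in> \<Phi> \<and> (\<exists>k :: 'a \<Rightarrow> nat. b = (\<Sum>d\<in>\<Delta>. real (k d) *\<^sub>R d))"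
    using b rs_nonzero[OF rs] unfolding pos_def by blast
qed (auto simp: pos_def coeff_combination)

lemma pos_subset: "pos \<subseteq> \<Phi>"
  by (auto simp: pos_def)

lemma pos_or_neg:
  assumes "b \<in> \<Phi>"
  shows "b \<in> pos \<or> - b \<in> pos"
proof -
  obtain k :: "'a \<Rightarrow> nat"
    where "b = (\<Sum>d\<in>\<Delta>. real (k d) *\<^sub>R d) \<or> - b = (\<Sum>d\<in>\<Delta>. real (k d) *\<^sub>R d)"
    using nat_combination[OF assms] by (metis minus_equation_iff)
  then show ?thesis using assms rs_minus[OF rs] by (auto simp: pos_iff)
qed

lemma pos_not_neg: "b \<in> pos \<Longrightarrow> - b \<notin> pos"
proof
  assume b: "b \<in> pos" "- b \<in> pos"
  have "b = 0"
  proof (rule coeff_eqI)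
    fix d assume "d \<in> \<Delta>"
    then have "0 \<le> coeff b d" "0 \<le> coeff (- b) d" using b by (auto simp: pos_def)
    then show "coeff b d = coeff 0 d"
      by (simp add: linear_neg[OF coeff_linear] linear_0[OF coeff_linear])
  qed
  then show False using b(1) rs_nonzero[OF rs] by (auto simp: pos_def)
qed

lemma base_pos: "\<Delta> \<subseteq> pos"
  using base_subset by (auto simp: pos_def coeff_base)

lemma pos_coeff_pos: "b \<in> \<Phi> \<Longrightarrow> d \<in> \<Delta> \<Longrightarrow> 0 < coeff b d \<Longrightarrow> b \<in> pos"
  using pos_or_neg[of b] by (auto simp: pos_def linear_neg[OF coeff_linear])

lemma coeff_refl:
  "d \<in> \<Delta> \<Longrightarrow> coeff (refl_along d x) e = coeff x e - (if e = d then 2 * (x \<bullet> d) / (d \<bullet> d) else 0)"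
  by (simp add: refl_along_def linear_diff[OF coeff_linear] linear_scale[OF coeff_linear] coeff_base)

lemma pos_support_singleton:
  assumes b: "b \<in> pos" and d: "d \<in> \<Delta>" and supp: "\<And>e. e \<in> \<Delta> \<Longrightarrow> e \<noteq> d \<Longrightarrow> coeff b e = 0"
  shows "b = d"
proof -
  have "b = coeff b d *\<^sub>R d"
    by (rule coeff_eqI) (use supp d in \<open>auto simp: linear_scale[OF coeff_linear] coeff_base\<close>)
  then have "b \<in> span {d}" using span_scale[OF span_base[of d "{d}"]] by (metis singletonI)
  then have "b = d \<or> b = - d" using rs_line[OF rs, of d] base_subset d b pos_subset by blast
  then show ?thesis using pos_not_neg b d base_pos by auto
qed

text \<open>The reflection changes only the coefficient at \<open>d\<close>. A positive root other
  than \<open>d\<close> has a positive coefficient elsewhere, which survives, and one positive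
  coefficient decides the sign of a root.\<close>

lemma simple_refl_pos:
  assumes d: "d \<in> \<Delta>" and b: "b \<in> pos" "b \<noteq> d"
  shows "refl_along d b \<in> pos"
proof -
  obtain e where e: "e \<in> \<Delta>" "e \<noteq> d" "coeff b e \<noteq> 0"
    using pos_support_singleton[OF b(1) d] b(2) by blast
  then have "0 < coeff b e" using b by (force simp: pos_def)
  then have "0 < coeff (refl_along d b) e" using e d by (simp add: coeff_refl)
  moreover have "refl_along d b \<in> \<Phi>" using rs_refl[OF rs] d b base_subset pos_subset by blast
  ultimately show ?thesis using pos_coeff_pos e by blast
qed

text \<open>The root \<open>refl_along d e\<close> is positive, and its coefficient at
  \<open>d\<close> is a negative multiple of \<open>d \<bullet> e\<close>.\<close>

lemma base_obtuse:
  assumes "d \<in> \<Delta>" "e \<in> \<Delta>" "d \<noteq> e"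
  shows "d \<bullet> e \<le> 0"
proof (rule ccontr)
  assume "\<not> d \<bullet> e \<le> 0"
  moreover have "refl_along d e \<in> pos" using simple_refl_pos assms base_pos by blast
  then have "0 \<le> coeff (refl_along d e) d" using assms by (simp add: pos_def)
  then have "2 * (e \<bullet> d) / (d \<bullet> d) \<le> 0" using assms by (simp add: coeff_refl coeff_base)
  ultimately show False
    using base_nonzero[OF assms(1)] by (simp add: divide_le_0_iff inner_commute flip: not_less)
qed

lemma sgn_base_obtuse: "d \<in> \<Delta> \<Longrightarrow> e \<in> \<Delta> \<Longrightarrow> d \<noteq> e \<Longrightarrow> sgn d \<bullet> sgn e \<le> 0"
  using base_obtuse by (simp add: sgn_div_norm mult_nonneg_nonpos)

text \<open>Four times the squared cosine is a positive integer, so the cosine has absolute value at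
  least 1/2, and its sign is known from \<open>sgn_base_obtuse\<close>.\<close>

lemma sgn_base_adjacent:
  assumes "d \<in> \<Delta>" "e \<in> \<Delta>" "d \<noteq> e" "d \<bullet> e \<noteq> 0"
  shows "sgn d \<bullet> sgn e \<le> - 1 / 2"
proof -
  have "0 \<notin> \<Phi>" using rs_nonzero[OF rs] by blast
  then obtain m n :: int where mn: "4 * (sgn d \<bullet> sgn e)\<^sup>2 = real_of_int (m * n)"
    using crystallographic_inner_sgn[OF cr, of d e] assms base_subset by blast
  define k where "k = m * n"
  have k: "4 * (sgn d \<bullet> sgn e)\<^sup>2 = real_of_int k" using mn k_def by simp
  have "0 < (sgn d \<bullet> sgn e)\<^sup>2" using assms by simp
  then have "0 < real_of_int k" using k by linarith
  then have "k \<ge> 1" by linarith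
  then have "(1 / 2)\<^sup>2 \<le> (- (sgn d \<bullet> sgn e))\<^sup>2" using k by (simp add: power_divide)
  then have "1 / 2 \<le> - (sgn d \<bullet> sgn e)"
    by (rule power2_le_imp_le) (use sgn_base_obtuse[OF assms(1-3)] in simp)
  then show ?thesis by simp
qed

text \<open>Otherwise the sum of the unit vectors along \<open>T\<close> has nonpositive square norm.\<close>

lemma base_leaf:
  assumes "T \<subseteq> \<Delta>" "T \<noteq> {}"
  shows "\<exists>v\<in>T. \<exists>u. \<forall>x\<in>T - {v}. x \<noteq> u \<longrightarrow> x \<bullet> v = 0"
proof (rule ccontr)
  assume no: "\<not> ?thesis"
  have fin: "finite T" using assms(1) base_finite finite_subset by blast
  have le: "(\<Sum>e\<in>T. sgn d \<bullet> sgn e) \<le> 0" if d: "d \<in> T" for d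
  proof -
    \<comment> \<open>The two neighbours \<open>x\<close> and \<open>y\<close> contribute at most
      -1/2 each, which cancels the 1 from \<open>d\<close> itself. All other terms are
      nonpositive.\<close>
    obtain x where x: "x \<in> T - {d}" "x \<bullet> d \<noteq> 0" using no d by blast
    obtain y where y: "y \<in> T - {d}" "y \<noteq> x" "y \<bullet> d \<noteq> 0" using no d by blast
    have T: "T = {d, x, y} \<union> (T - {d, x, y})" using d x y by blast
    have "(\<Sum>e\<in>T - {d, x, y}. sgn d \<bullet> sgn e) \<le> 0"
      by (rule sum_nonpos) (use d assms sgn_base_obtuse in blast)
    moreover have "(\<Sum>e\<in>{d, x, y}. sgn d \<bullet> sgn e) = 1 + sgn d \<bullet> sgn x + sgn d \<bullet> sgn y"
      using x y d base_nonzero assms by (auto simp: sgn_inner_self subset_iff)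
    moreover have "sgn d \<bullet> sgn x \<le> - 1 / 2" "sgn d \<bullet> sgn y \<le> - 1 / 2"
      using sgn_base_adjacent[of d x] sgn_base_adjacent[of d y] d x y assms
      by (auto simp: inner_commute[of d])
    moreover have "(\<Sum>e\<in>T. sgn d \<bullet> sgn e) =
        (\<Sum>e\<in>{d, x, y}. sgn d \<bullet> sgn e) + (\<Sum>e\<in>T - {d, x, y}. sgn d \<bullet> sgn e)"
      by (subst T, rule sum.union_disjoint) (use fin in auto)
    ultimately show ?thesis by linarith
  qed
  define z where "z = (\<Sum>d\<in>T. sgn d)"
  have "z \<bullet> z = (\<Sum>d\<in>T. \<Sum>e\<in>T. sgn d \<bullet> sgn e)"
    unfolding z_def inner_sum_left by (simp add: inner_sum_right)
  also have "\<dots> \<le> 0" by (rule sum_nonpos) (rule le)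
  finally have "z = 0" by (metis inner_gt_zero_iff not_less)
  obtain d where d: "d \<in> T" using assms by blast
  have "z = (\<Sum>e\<in>\<Delta>. (if e \<in> T then inverse (norm e) else 0) *\<^sub>R e)"
    unfolding z_def using assms(1) base_finite
    by (intro sum.mono_neutral_cong_left) (auto simp: sgn_div_norm)
  then have "coeff z d = inverse (norm d)" using d assms coeff_combination[of d "\<lambda>e. if e \<in> T then inverse (norm e) else 0"] by auto
  then show False using \<open>z = 0\<close> d assms base_nonzero by (auto simp: linear_0[OF coeff_linear])
qed

text \<open>Induction on the height: a positive root is not orthogonal to some simple root in its support,
  and reflecting in it lowers the height.\<close>

lemma root_in_component:
  assumes un: "\<Delta> = A \<union> B" and orth: "\<And>a b. a \<in> A \<Longrightarrow> b \<in> B \<Longrightarrow> a \<bullet> b = 0"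
    and b: "b \<in> pos"
  shows "b \<in> span A \<or> b \<in> span B"
proof -
  have "\<exists>k :: 'a \<Rightarrow> nat. b = (\<Sum>d\<in>\<Delta>. real (k d) *\<^sub>R d)" using b pos_iff by blast
  then obtain k :: "'a \<Rightarrow> nat" where "b = (\<Sum>d\<in>\<Delta>. real (k d) *\<^sub>R d)" by blast
  then show ?thesis using b
  proof (induction "\<Sum>d\<in>\<Delta>. k d" arbitrary: b k rule: less_induct)
    case less
    have "0 < b \<bullet> b" using less.prems rs_nonzero[OF rs] pos_subset by auto
    also have "b \<bullet> b = (\<Sum>d\<in>\<Delta>. real (k d) * (b \<bullet> d))"
      by (subst (2) less.prems(1)) (simp add: inner_sum_right)
    finally obtain d where d: "d \<in> \<Delta>" "0 < real (k d) * (b \<bullet> d)"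
      by (meson not_le sum_nonpos)
    then have bd: "0 < b \<bullet> d" by (auto simp: zero_less_mult_iff)
    show ?case
    proof (cases "b = d")
      case True
      then show ?thesis using d un span_base by blast
    next
      case False
      define b' where "b' = refl_along d b"
      have b': "b' \<in> pos" using simple_refl_pos d less.prems False b'_def by blast
      then obtain k' :: "'a \<Rightarrow> nat" where k': "b' = (\<Sum>d\<in>\<Delta>. real (k' d) *\<^sub>R d)"
        using pos_iff by blast
      have c: "real (k' e) = real (k e) - (if e = d then 2 * (b \<bullet> d) / (d \<bullet> d) else 0)" if "e \<in> \<Delta>" for e
        using coeff_refl[OF d(1), of b e] coeff_combination[OF that, of "\<lambda>e. real (k' e)"]
          coeff_combination[OF that, of "\<lambda>e. real (k e)"] k' less.prems(1) b'_def by simp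
      have pos: "0 < 2 * (b \<bullet> d) / (d \<bullet> d)" using bd base_nonzero[OF d(1)] by simp
      have "k' e \<le> k e" if "e \<in> \<Delta>" for e
        using c[OF that] pos by (auto split: if_splits)
      moreover have "k' d < k d" using c[OF d(1)] pos by simp
      ultimately have "(\<Sum>d\<in>\<Delta>. k' d) < (\<Sum>d\<in>\<Delta>. k d)"
        using d(1) base_finite by (intro sum_strict_mono_ex1) auto
      then have IH: "b' \<in> span A \<or> b' \<in> span B" using less.hyps k' b' by blast
      have rb: "refl_along d b' = b" by (simp add: b'_def)
      have "refl_along d b' \<in> span S" if "b' \<in> span S" "d \<in> S" for S
        using refl_along_mem_subspace[OF subspace_span span_base] that by blast
      \<comment> \<open>Since \<open>b'\<close> and \<open>d\<close> are not orthogonal,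
        \<open>d\<close> belongs to the component in whose span \<open>b'\<close> lies, and
        reflecting back stays in that span.\<close>
      moreover have "b' \<bullet> d \<noteq> 0"
        using bd refl_along_inner_left[of d b d] by (simp add: b'_def refl_along_self)
      then have "\<not> orthogonal d b'" by (simp add: orthogonal_def inner_commute)
      then have "\<not> (b' \<in> span A \<and> d \<in> B)" "\<not> (b' \<in> span B \<and> d \<in> A)"
        using orthogonal_to_span[of b' A d] orthogonal_to_span[of b' B d] orth
        unfolding orthogonal_def by (metis inner_commute)+
      ultimately show ?thesis using IH d(1) un rb by (metis Un_iff)
    qed
  qed
qed

text \<open>Every root lies in the span of one of the two orthogonal parts, so a splitting of the
  base would split \<open>\<Phi>\<close>.\<close>

lemma base_connected:
  assumes irr: "irreducible_roots \<Phi>"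
    and un: "\<Delta> = A \<union> B" and orth: "\<And>a b. a \<in> A \<Longrightarrow> b \<in> B \<Longrightarrow> a \<bullet> b = 0"
  shows "A = {} \<or> B = {}"
proof -
  have "\<Phi> = (\<Phi> \<inter> span A) \<union> (\<Phi> \<inter> span B)"
    using root_in_component[OF un orth] pos_or_neg span_neg by fastforce
  moreover have "a \<bullet> b = 0" if "a \<in> span A" "b \<in> span B" for a b
  proof -
    have "orthogonal x b" if "x \<in> A" for x
      using orthogonal_to_span[OF \<open>b \<in> span B\<close>] orth that by (simp add: orthogonal_def)
    then have "orthogonal b a"
      using orthogonal_to_span[OF \<open>a \<in> span A\<close>] orthogonal_commute by metis
    then show ?thesis by (metis inner_commute orthogonal_def)
  qed
  ultimately have "\<Phi> \<inter> span A = {} \<or> \<Phi> \<inter> span B = {}"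
    using irreducible_roots_part[OF irr] by blast
  moreover have "A \<subseteq> \<Phi> \<inter> span A" "B \<subseteq> \<Phi> \<inter> span B"
    using un base_subset span_superset by auto
  ultimately show ?thesis by blast
qed

section \<open>Products of simple reflections acting on positive roots\<close>

text \<open>Apply the factors to \<open>d\<close> from the right. When the image first turns
  negative, the responsible factor \<open>e\<close> must have met the root \<open>e\<close>, the
  only positive root that its reflection makes negative.\<close>

lemma refl_prod_first_descent:
  assumes "set as \<subseteq> \<Delta>" "d \<in> pos" "refl_prod as d \<notin> pos"
  shows "\<exists>p e q. as = p @ e # q \<and> refl_prod q d = e"
  using assms
proof (induction as)
  case (Cons a as)
  show ?case
  proof (cases "refl_prod as d \<in> pos")
    case True
    then have "refl_prod as d = a"
      using simple_refl_pos[of a "refl_prod as d"] Cons.prems by auto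
    then show ?thesis by (metis append_Nil)
  next
    case False
    then obtain p e q where "as = p @ e # q \<and> refl_prod q d = e"
      using Cons by auto
    then show ?thesis by (metis append_Cons)
  qed
qed auto

text \<open>This is the deletion argument. The last factor sends \<open>d\<close> to
  \<open>- d\<close>, so the product of the others must make \<open>d\<close> negative. At the
  descent, \<open>e\<close> followed through \<open>q\<close> is conjugate to \<open>d\<close>, so
  both factors cancel and a product shorter by two remains.\<close>

lemma refl_prod_pos_imp_id:
  assumes "set as \<subseteq> \<Delta>" "\<And>b. b \<in> pos \<Longrightarrow> refl_prod as b \<in> pos"
  shows "refl_prod as = id"
  using assms
proof (induction "length as" arbitrary: as rule: less_induct)
  case less
  show ?case
  proof (cases as rule: rev_cases)
    case (snoc bs d)
    have d: "d \<in> \<Delta>" and bs: "set bs \<subseteq> \<Delta>" using less.prems(1) snoc by auto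
    have "refl_prod as d = - refl_prod bs d"
      using linear_neg[OF refl_prod_linear] by (simp add: snoc refl_along_self)
    moreover have "refl_prod as d \<in> pos" using less.prems(2) d base_pos by blast
    ultimately have "refl_prod bs d \<notin> pos" using pos_not_neg by auto
    then obtain p e q where bsq: "bs = p @ e # q" and e: "refl_prod q d = e"
      using refl_prod_first_descent[OF bs] d base_pos by blast
    have "refl_along e \<circ> refl_prod q = refl_prod q \<circ> refl_along d"
      using refl_along_conj[OF refl_prod_linear refl_prod_inner, where a = d] e by (intro ext) auto
    then have "refl_along e \<circ> refl_prod q \<circ> refl_along d = refl_prod q \<circ> (refl_along d \<circ> refl_along d)"
      by (simp only: comp_assoc)
    also have "\<dots> = refl_prod q" unfolding refl_along_o_self by (rule comp_id)
    finally have "refl_along e \<circ> refl_prod q \<circ> refl_along d = refl_prod q" .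
    then have "refl_prod p \<circ> (refl_along e \<circ> refl_prod q \<circ> refl_along d) = refl_prod p \<circ> refl_prod q"
      by (rule arg_cong)
    then have eq: "refl_prod as = refl_prod (p @ q)"
      unfolding snoc bsq refl_prod_simps comp_id by (simp only: comp_assoc)
    have "refl_prod (p @ q) = id"
    proof (rule less.hyps)
      show "refl_prod (p @ q) b \<in> pos" if "b \<in> pos" for b
        using less.prems(2)[OF that] unfolding eq .
    qed (use less.prems(1) snoc bsq in auto)
    then show ?thesis using eq by simp
  qed simp
qed

text \<open>Perron's argument for the Gram matrix of the normalized base, which is positive definite
  with nonpositive entries off the diagonal. Passing to absolute values of the coordinates cannot
  increase the form, so a minimizer on the unit sphere may be taken nonnegative. It is an
  eigenvector, and connectedness of the base excludes zero coordinates.\<close>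

lemma base_perron_vector:
  assumes irr: "irreducible_roots \<Phi>"
  obtains x \<mu> where "\<And>d. d \<in> \<Delta> \<Longrightarrow> 0 < x d" "0 < \<mu>"
    "\<And>d. d \<in> \<Delta> \<Longrightarrow> (\<Sum>e\<in>\<Delta>. x e *\<^sub>R sgn e) \<bullet> sgn d = \<mu> * x d"
proof -
  \<comment> \<open>The base has as many elements as the space has dimensions, so the space itself
    serves as coordinate space. \<open>L\<close> sends its standard basis to the normalized simple
    roots, and \<open>L x \<bullet> L x\<close> is the Gram form.\<close>
  obtain \<delta> :: "'a \<Rightarrow> 'a" where \<delta>: "bij_betw \<delta> Basis \<Delta>"
    using finite_same_card_bij[OF finite_Basis base_finite] base_card by auto
  have \<delta>_base: "\<delta> b \<in> \<Delta>" if "b \<in> Basis" for b using \<delta> that bij_betwE by blast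
  have \<delta>_inj: "\<delta> b = \<delta> b' \<Longrightarrow> b = b'" if "b \<in> Basis" "b' \<in> Basis" for b b'
    using \<delta> that by (auto simp: bij_betw_def inj_on_def)
  define L where "L = (\<lambda>x. \<Sum>b\<in>Basis. (x \<bullet> b) *\<^sub>R sgn (\<delta> b))"
  have L_lin: "linear L"
    unfolding L_def by (rule linearI)
      (simp_all add: inner_add_left scaleR_add_left sum.distrib scaleR_sum_right)
  have L_inj: "x = 0" if "L x = 0" for x
  proof (rule euclidean_eqI)
    fix b :: 'a assume b: "b \<in> Basis"
    have "L x = (\<Sum>d\<in>\<Delta>. ((x \<bullet> inv_into Basis \<delta> d) / norm d) *\<^sub>R d)"
      unfolding L_def using \<delta>
      by (subst sum.reindex_bij_betw[OF \<delta>, symmetric])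
        (auto simp: bij_betw_def sgn_div_norm divide_inverse intro!: sum.cong)
    then have "coeff (L x) (\<delta> b) = (x \<bullet> b) / norm (\<delta> b)"
      using coeff_combination[OF \<delta>_base[OF b]] \<delta> b by (simp add: bij_betw_def)
    then show "x \<bullet> b = 0 \<bullet> b"
      using that base_nonzero[OF \<delta>_base[OF b]] by (simp add: linear_0[OF coeff_linear])
  qed
  have "continuous_on (sphere 0 1) (\<lambda>x. L x \<bullet> L x)"
    unfolding L_def by (intro continuous_intros)
  moreover have "sphere (0 :: 'a) 1 \<noteq> {}" by simp
  ultimately obtain x0 where x0: "norm x0 = 1"
    and min: "\<And>x. norm x = 1 \<Longrightarrow> L x0 \<bullet> L x0 \<le> L x \<bullet> L x"
    using continuous_attains_inf[of "sphere 0 1" "\<lambda>x. L x \<bullet> L x"] compact_sphere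
    by (metis mem_sphere_0)
  have L_inner: "L x \<bullet> L x = (\<Sum>b\<in>Basis. \<Sum>b'\<in>Basis. (x \<bullet> b) * (x \<bullet> b') * (sgn (\<delta> b) \<bullet> sgn (\<delta> b')))" for x
    unfolding L_def inner_sum_left by (simp add: inner_sum_right mult.assoc mult.left_commute sum_distrib_left)
  define y where "y = (\<Sum>b\<in>Basis. \<bar>x0 \<bullet> b\<bar> *\<^sub>R b)"
  have yb: "y \<bullet> b = \<bar>x0 \<bullet> b\<bar>" if "b \<in> Basis" for b
    using that by (simp add: y_def)
  have "y \<bullet> y = x0 \<bullet> x0"
    by (subst (1 2) euclidean_inner) (simp add: yb)
  then have y1: "norm y = 1" using x0 by (simp add: norm_eq_sqrt_inner)
  define \<mu> where "\<mu> = L y \<bullet> L y"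
  have "L y \<bullet> L y \<le> L x0 \<bullet> L x0"
    unfolding L_inner
  proof (intro sum_mono)
    fix b b' :: 'a assume b: "b \<in> Basis" "b' \<in> Basis"
    show "(y \<bullet> b) * (y \<bullet> b') * (sgn (\<delta> b) \<bullet> sgn (\<delta> b'))
        \<le> (x0 \<bullet> b) * (x0 \<bullet> b') * (sgn (\<delta> b) \<bullet> sgn (\<delta> b'))"
    proof (cases "b = b'")
      case False
      then have "sgn (\<delta> b) \<bullet> sgn (\<delta> b') \<le> 0"
        using sgn_base_obtuse \<delta>_base \<delta>_inj b by blast
      then show ?thesis
        using b by (intro mult_right_mono_neg) (simp_all add: yb flip: abs_mult)
    qed (use b in \<open>simp add: yb flip: abs_mult\<close>)
  qed
  then have min': "\<mu> \<le> L x \<bullet> L x" if "norm x = 1" for x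
    using min[OF that] by (simp add: \<mu>_def)
  have "y \<noteq> 0" using y1 by auto
  then have \<mu>: "0 < \<mu>" using L_inj by (auto simp: \<mu>_def)
  define B where "B = (\<lambda>u v. L u \<bullet> L v - \<mu> * (u \<bullet> v))"
  have "B y b = 0" for b
  proof (rule psd_kernel[of B UNIV])
    show "linear (\<lambda>x. B x z)" for z
      unfolding B_def using L_lin
      by (intro linearI) (simp_all add: linear_add linear_scale inner_add_left algebra_simps)
    show "B u v = B v u" for u v by (simp add: B_def inner_commute)
    show "0 \<le> B u u" for u
    proof (cases "u = 0")
      case False
      have "L u = norm u *\<^sub>R L (sgn u)"
        using False linear_scale[OF L_lin, of "norm u" "sgn u"] by (simp add: sgn_div_norm)
      then have "L u \<bullet> L u = (u \<bullet> u) * (L (sgn u) \<bullet> L (sgn u))"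
        by (simp add: power2_norm_eq_inner[symmetric] power2_eq_square)
      moreover have "\<mu> \<le> L (sgn u) \<bullet> L (sgn u)" using min' False by (simp add: norm_sgn)
      ultimately show ?thesis
        by (simp add: B_def mult.commute[of \<mu>] mult_left_mono)
    qed (simp add: B_def linear_0[OF L_lin])
    show "B y y = 0" using y1 by (simp add: B_def \<mu>_def norm_eq_1)
  qed auto
  then have eig: "L y \<bullet> L b = \<mu> * (y \<bullet> b)" for b by (simp add: B_def)
  have Lb: "L b = sgn (\<delta> b)" if "b \<in> Basis" for b
  proof -
    have "L b = (\<Sum>b'\<in>Basis. if b' = b then sgn (\<delta> b) else 0)"
      unfolding L_def using that by (intro sum.cong) (auto simp: inner_Basis)
    then show ?thesis using that by simp
  qed
  define x where "x = (\<lambda>d. y \<bullet> inv_into Basis \<delta> d)"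
  have inv: "inv_into Basis \<delta> d \<in> Basis" "\<delta> (inv_into Basis \<delta> d) = d" if "d \<in> \<Delta>" for d
    using that \<delta> by (metis bij_betw_def inv_into_into, metis bij_betw_def f_inv_into_f)
  have Ly: "L y = (\<Sum>e\<in>\<Delta>. x e *\<^sub>R sgn e)"
    unfolding L_def x_def using \<delta>
    by (subst sum.reindex_bij_betw[OF \<delta>, symmetric]) (auto simp: bij_betw_def intro!: sum.cong)
  have x_eig: "(\<Sum>e\<in>\<Delta>. x e *\<^sub>R sgn e) \<bullet> sgn d = \<mu> * x d" if "d \<in> \<Delta>" for d
    using eig[of "inv_into Basis \<delta> d"] inv[OF that] Lb by (simp add: Ly x_def)
  have x_nonneg: "0 \<le> x d" if "d \<in> \<Delta>" for d
    using yb[OF inv(1)[OF that]] by (simp add: x_def)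
  \<comment> \<open>At a simple root with coordinate zero the eigenvalue equation is a vanishing sum
    of nonpositive terms, so that root is orthogonal to all simple roots with positive
    coordinate.\<close>
  define A where "A = {d\<in>\<Delta>. x d = 0}"
  define A' where "A' = {d\<in>\<Delta>. x d > 0}"
  have "\<Delta> = A \<union> A'" using x_nonneg by (force simp: A_def A'_def)
  moreover have "a \<bullet> b = 0" if a: "a \<in> A" and b: "b \<in> A'" for a b
  proof -
    have "(\<Sum>e\<in>\<Delta>. x e * (sgn e \<bullet> sgn a)) = 0"
      using x_eig[of a] a by (simp add: A_def inner_sum_left)
    moreover have "x e * (sgn e \<bullet> sgn a) \<le> 0" if "e \<in> \<Delta>" for e
    proof (cases "e = a")
      case False
      then show ?thesis
        using x_nonneg[OF that] sgn_base_obtuse[OF that, of a] a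
        by (simp add: A_def mult_nonneg_nonpos)
    qed (use a in \<open>simp add: A_def\<close>)
    ultimately have "- (x b * (sgn b \<bullet> sgn a)) = 0"
      using sum_nonneg_eq_0_iff[of \<Delta> "\<lambda>e. - (x e * (sgn e \<bullet> sgn a))"] base_finite b
      by (auto simp: A'_def sum_negf)
    then show ?thesis using b by (simp add: A'_def inner_commute)
  qed
  ultimately have "A = {} \<or> A' = {}" by (rule base_connected[OF irr])
  moreover have "A' \<noteq> {}"
  proof
    assume "A' = {}"
    then have "x d = 0" if "d \<in> \<Delta>" for d using x_nonneg[OF that] that by (force simp: A'_def)
    then have "L y = 0" unfolding Ly by simp
    then show False using \<mu> by (simp add: \<mu>_def)
  qed
  ultimately have "0 < x d" if "d \<in> \<Delta>" for d
    using that x_nonneg[OF that] by (force simp: A_def)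
  then show thesis using that x_eig \<mu> by blast
qed

lemma sum_orthogonal:
  fixes x :: "'a \<Rightarrow> real"
  assumes "pairwise (\<lambda>a b. a \<bullet> b = 0) S" "S \<subseteq> \<Delta>" "d \<in> S"
  shows "(\<Sum>e\<in>S. x e *\<^sub>R sgn e) \<bullet> sgn d = x d"
proof -
  have "(\<Sum>e\<in>S. x e *\<^sub>R sgn e) \<bullet> sgn d = (\<Sum>e\<in>S. if e = d then x d else 0)"
    unfolding inner_sum_left using assms base_nonzero
    by (intro sum.cong) (auto simp: pairwise_def sgn_inner_self)
  then show ?thesis using assms base_finite finite_subset by (simp add: finite_subset[of S \<Delta>])
qed

text \<open>On an orthogonal set of simple roots the reflection in \<open>d\<close> merely negates
  the coefficient at \<open>d\<close>. If that coefficient was positive, the image is not a positive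
  root, which leaves only \<open>b = d\<close>.\<close>

lemma pos_orthogonal_support:
  assumes b: "b \<in> pos" and S: "S \<subseteq> \<Delta>" "pairwise (\<lambda>a b. a \<bullet> b = 0) S"
    and supp: "\<And>d. d \<in> \<Delta> - S \<Longrightarrow> coeff b d = 0"
  shows "b \<in> S"
proof -
  have "\<exists>d\<in>\<Delta>. coeff b d \<noteq> 0"
  proof (rule ccontr)
    assume "\<not> ?thesis"
    then have "b = 0" by (intro coeff_eqI) (simp add: linear_0[OF coeff_linear])
    then show False using b rs_nonzero[OF rs] pos_subset by auto
  qed
  then obtain d where d: "d \<in> \<Delta>" "d \<in> S" "0 < coeff b d"
    using b supp by (force simp: pos_def)
  have "b = d"
  proof (rule ccontr)
    assume "b \<noteq> d"
    then have "refl_along d b \<in> pos" using simple_refl_pos d b by blast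
    then have "0 \<le> coeff b d - 2 * (b \<bullet> d) / (d \<bullet> d)"
      using d coeff_refl[OF d(1), of b d] by (force simp: pos_def)
    moreover have "b \<bullet> d = (\<Sum>e\<in>\<Delta>. if e = d then coeff b d * (d \<bullet> d) else 0)"
    proof -
      have "b \<bullet> d = (\<Sum>e\<in>\<Delta>. coeff b e * (e \<bullet> d))"
        by (subst (1) coeff_sum[of b, symmetric]) (simp add: inner_sum_left)
      also have "\<dots> = (\<Sum>e\<in>\<Delta>. if e = d then coeff b d * (d \<bullet> d) else 0)"
        using S d supp by (intro sum.cong) (auto simp: pairwise_def)
      finally show ?thesis .
    qed
    then have "b \<bullet> d = coeff b d * (d \<bullet> d)" using d base_finite by simp
    ultimately show False using d base_nonzero[OF d(1)] by simp
  qed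
  then show ?thesis using d by simp
qed

end

section \<open>The Coxeter plane\<close>

text \<open>Here \<open>x\<close> is a positive eigenvector of the Gram matrix of the normalized simple roots, split
  along the two colour classes. Its halves \<open>b1\<close>, \<open>b2\<close> span the Coxeter plane.\<close>

locale bipartite_base = based_root_system +
  fixes as1 as2 :: "'a::euclidean_space list" and x :: "'a \<Rightarrow> real" and \<kappa> :: real
  assumes dist: "distinct (as1 @ as2)" and un: "set as1 \<union> set as2 = \<Delta>" and base_nonempty: "\<Delta> \<noteq> {}"
    and orth1: "pairwise (\<lambda>a b. a \<bullet> b = 0) (set as1)"
    and orth2: "pairwise (\<lambda>a b. a \<bullet> b = 0) (set as2)"
    and xpos: "\<And>d. d \<in> \<Delta> \<Longrightarrow> 0 < x d" and lam: "0 < \<kappa>" "\<kappa> < 1"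
    and eig1: "\<And>d. d \<in> set as1 \<Longrightarrow> (\<Sum>e\<in>set as2. x e *\<^sub>R sgn e) \<bullet> sgn d = - \<kappa> * x d"
    and eig2: "\<And>d. d \<in> set as2 \<Longrightarrow> (\<Sum>e\<in>set as1. x e *\<^sub>R sgn e) \<bullet> sgn d = - \<kappa> * x d"
begin

definition b1 where "b1 = (\<Sum>e\<in>set as1. x e *\<^sub>R sgn e)"
definition b2 where "b2 = (\<Sum>e\<in>set as2. x e *\<^sub>R sgn e)"
text \<open>The angle turns out to be pi divided by the order of \<open>cox\<close>.\<close>

definition \<theta> where "\<theta> = arccos \<kappa>"
definition cox where "cox = refl_prod (as1 @ as2)"

text \<open>\<open>plane y\<close> is the projection of \<open>y\<close> to the Coxeter plane in suitable coordinates.\<close>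

definition plane :: "'a \<Rightarrow> complex" where
  "plane y = Complex (sin \<theta> * (y \<bullet> b2)) (- (y \<bullet> b1 + \<kappa> * (y \<bullet> b2)))"

text \<open>The vector \<open>b1 + \<kappa> *\<^sub>R b2\<close> is orthogonal to \<open>as2\<close>
  and has positive inner products with \<open>as1\<close>, so \<open>coord1\<close> is a positively
  weighted sum of the coefficients along \<open>as1\<close>. \<open>coord2\<close> plays the same
  role for \<open>as2\<close>.\<close>

definition coord1 where "coord1 y = y \<bullet> b1 + \<kappa> * (y \<bullet> b2)"
definition coord2 where "coord2 y = y \<bullet> b2 + \<kappa> * (y \<bullet> b1)"

lemma cos_theta: "cos \<theta> = \<kappa>"
  unfolding \<theta>_def using lam by (intro cos_arccos) auto

lemma theta_bounds: "0 < \<theta>" "\<theta> < pi / 2"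
proof -
  show "0 < \<theta>" "\<theta> < pi / 2"
    using lam arccos_less_arccos[of \<kappa> 1] arccos_less_arccos[of 0 \<kappa>]
    by (simp_all add: \<theta>_def arccos_0)
qed

lemma sin_theta: "0 < sin \<theta>" "sin \<theta> * sin \<theta> = 1 - \<kappa> * \<kappa>"
  using theta_bounds sin_squared_eq[of \<theta>] cos_theta
  by (auto intro: sin_gt_zero simp: power2_eq_square)

lemma sin_theta_mult: "sin \<theta> * (sin \<theta> * z) = z - \<kappa> * (\<kappa> * z)"
  using sin_theta(2) by (metis left_diff_distrib mult.assoc mult_1)

lemma lam_sq: "0 < 1 - \<kappa> * \<kappa>"
  using sin_theta by (metis mult_pos_pos)

lemma as_base: "set as1 \<subseteq> \<Delta>" "set as2 \<subseteq> \<Delta>" "set as1 \<inter> set as2 = {}"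
  using un dist by auto

lemma as_roots: "set as1 \<subseteq> \<Phi>" "set as2 \<subseteq> \<Phi>"
  using as_base base_subset by auto

lemma b_sgn:
  "d \<in> set as1 \<Longrightarrow> b1 \<bullet> sgn d = x d" "d \<in> set as2 \<Longrightarrow> b1 \<bullet> sgn d = - \<kappa> * x d"
  "d \<in> set as1 \<Longrightarrow> b2 \<bullet> sgn d = - \<kappa> * x d" "d \<in> set as2 \<Longrightarrow> b2 \<bullet> sgn d = x d"
  using sum_orthogonal[OF orth1, of _ x] sum_orthogonal[OF orth2, of _ x] eig1 eig2 as_base
  by (simp_all add: b1_def b2_def)

lemma refl1:
  "refl_prod as1 y \<bullet> b1 = - (y \<bullet> b1)" "refl_prod as1 y \<bullet> b2 = y \<bullet> b2 + 2 * \<kappa> * (y \<bullet> b1)"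
proof -
  have r: "refl_prod as1 y = y - (\<Sum>a\<in>set as1. (2 * (y \<bullet> sgn a)) *\<^sub>R sgn a)"
    using refl_prod_orthogonal[OF _ orth1] dist by simp
  have yb: "y \<bullet> b1 = (\<Sum>a\<in>set as1. x a * (y \<bullet> sgn a))"
    by (simp add: b1_def inner_sum_right)
  have "refl_prod as1 y \<bullet> b1 = y \<bullet> b1 - (\<Sum>a\<in>set as1. 2 * (y \<bullet> sgn a) * (b1 \<bullet> sgn a))"
    by (simp add: r inner_diff_left inner_sum_left inner_commute[of b1])
  also have "(\<Sum>a\<in>set as1. 2 * (y \<bullet> sgn a) * (b1 \<bullet> sgn a)) = 2 * (y \<bullet> b1)"
    unfolding yb sum_distrib_left by (intro sum.cong) (simp_all add: b_sgn)
  finally show "refl_prod as1 y \<bullet> b1 = - (y \<bullet> b1)" by simp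
  have "refl_prod as1 y \<bullet> b2 = y \<bullet> b2 - (\<Sum>a\<in>set as1. 2 * (y \<bullet> sgn a) * (b2 \<bullet> sgn a))"
    by (simp add: r inner_diff_left inner_sum_left inner_commute[of b2])
  also have "(\<Sum>a\<in>set as1. 2 * (y \<bullet> sgn a) * (b2 \<bullet> sgn a)) = - (2 * \<kappa> * (y \<bullet> b1))"
    unfolding yb sum_distrib_left sum_negf[symmetric] by (intro sum.cong) (simp_all add: b_sgn)
  finally show "refl_prod as1 y \<bullet> b2 = y \<bullet> b2 + 2 * \<kappa> * (y \<bullet> b1)" by simp
qed

lemma refl2:
  "refl_prod as2 y \<bullet> b2 = - (y \<bullet> b2)" "refl_prod as2 y \<bullet> b1 = y \<bullet> b1 + 2 * \<kappa> * (y \<bullet> b2)"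
proof -
  have r: "refl_prod as2 y = y - (\<Sum>a\<in>set as2. (2 * (y \<bullet> sgn a)) *\<^sub>R sgn a)"
    using refl_prod_orthogonal[OF _ orth2] dist by simp
  have yb: "y \<bullet> b2 = (\<Sum>a\<in>set as2. x a * (y \<bullet> sgn a))"
    by (simp add: b2_def inner_sum_right)
  have "refl_prod as2 y \<bullet> b2 = y \<bullet> b2 - (\<Sum>a\<in>set as2. 2 * (y \<bullet> sgn a) * (b2 \<bullet> sgn a))"
    by (simp add: r inner_diff_left inner_sum_left inner_commute[of b2])
  also have "(\<Sum>a\<in>set as2. 2 * (y \<bullet> sgn a) * (b2 \<bullet> sgn a)) = 2 * (y \<bullet> b2)"
    unfolding yb sum_distrib_left by (intro sum.cong) (simp_all add: b_sgn)
  finally show "refl_prod as2 y \<bullet> b2 = - (y \<bullet> b2)" by simp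
  have "refl_prod as2 y \<bullet> b1 = y \<bullet> b1 - (\<Sum>a\<in>set as2. 2 * (y \<bullet> sgn a) * (b1 \<bullet> sgn a))"
    by (simp add: r inner_diff_left inner_sum_left inner_commute[of b1])
  also have "(\<Sum>a\<in>set as2. 2 * (y \<bullet> sgn a) * (b1 \<bullet> sgn a)) = - (2 * \<kappa> * (y \<bullet> b2))"
    unfolding yb sum_distrib_left sum_negf[symmetric] by (intro sum.cong) (simp_all add: b_sgn)
  finally show "refl_prod as2 y \<bullet> b1 = y \<bullet> b1 + 2 * \<kappa> * (y \<bullet> b2)" by simp
qed

text \<open>The two halves of \<open>cox\<close> act on the plane as reflections in lines that meet
  at the angle \<open>\<theta>\<close>, so \<open>cox\<close> acts as the rotation by twice that
  angle.\<close>

lemma plane_refl2: "plane (refl_prod as2 y) = - cnj (plane y)"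
  by (simp add: plane_def complex_eq_iff refl2 algebra_simps)

lemma plane_refl1: "plane (refl_prod as1 y) = - (cis (2 * \<theta>) * cnj (plane y))"
proof -
  have "cis (2 * \<theta>) = Complex (2 * \<kappa> * \<kappa> - 1) (2 * sin \<theta> * \<kappa>)"
    using sin_theta(2) by (simp add: complex_eq_iff cos_double sin_double cos_theta power2_eq_square)
  then show ?thesis
    by (simp only:) (simp add: plane_def complex_eq_iff refl1 sin_theta_mult algebra_simps)
qed

lemma plane_cox: "plane (cox y) = cis (2 * \<theta>) * plane y"
  by (simp add: cox_def plane_refl1 plane_refl2)

lemma plane_cox_pow: "plane ((cox ^^ k) y) = cis (2 * real k * \<theta>) * plane y"
proof (induction k)
  case (Suc k)
  have "plane ((cox ^^ Suc k) y) = cis (2 * \<theta>) * cis (2 * real k * \<theta>) * plane y"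
    by (simp add: plane_cox Suc)
  then show ?case by (simp add: cis_mult algebra_simps)
qed simp

lemma plane_minus: "plane (- y) = - plane y"
  by (simp add: plane_def complex_eq_iff)

lemma plane_polar:
  assumes "plane y = complex_of_real r * cis \<psi>"
  shows "coord1 y = - (r * sin \<psi>)" "coord2 y = r * sin (\<theta> - \<psi>)"
proof -
  have re: "sin \<theta> * (y \<bullet> b2) = r * cos \<psi>" and im: "y \<bullet> b1 + \<kappa> * (y \<bullet> b2) = - (r * sin \<psi>)"
    using assms by (simp_all add: plane_def complex_eq_iff)
  show "coord1 y = - (r * sin \<psi>)" using im by (simp add: coord1_def)
  have "r * sin (\<theta> - \<psi>) = sin \<theta> * (r * cos \<psi>) - \<kappa> * (r * sin \<psi>)"
    by (simp add: sin_diff cos_theta algebra_simps)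
  also have "\<dots> = sin \<theta> * sin \<theta> * (y \<bullet> b2) + \<kappa> * (y \<bullet> b1 + \<kappa> * (y \<bullet> b2))"
    unfolding re[symmetric] im by simp
  also have "\<dots> = coord2 y" unfolding sin_theta(2) by (simp add: coord2_def algebra_simps)
  finally show "coord2 y = r * sin (\<theta> - \<psi>)" by simp
qed

lemma inner_coeffs: "y \<bullet> w = (\<Sum>d\<in>\<Delta>. coeff y d * (norm d * (w \<bullet> sgn d)))"
proof -
  have "d \<bullet> w = norm d * (w \<bullet> sgn d)" if "d \<in> \<Delta>" for d
    using base_nonzero[OF that] by (simp add: sgn_div_norm inner_commute)
  then show ?thesis
    by (subst (1) coeff_sum[of y, symmetric]) (simp add: inner_sum_left)
qed

lemma coord1_sum: "coord1 y = (\<Sum>d\<in>set as1. coeff y d * (norm d * x d * (1 - \<kappa> * \<kappa>)))"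
proof -
  have "coord1 y = y \<bullet> (b1 + \<kappa> *\<^sub>R b2)" by (simp add: coord1_def inner_add_right)
  also have "\<dots> = (\<Sum>d\<in>\<Delta>. coeff y d * (norm d * ((b1 + \<kappa> *\<^sub>R b2) \<bullet> sgn d)))"
    by (rule inner_coeffs)
  also have "\<dots> = (\<Sum>d\<in>set as1. coeff y d * (norm d * x d * (1 - \<kappa> * \<kappa>)))"
    using base_finite as_base un
    by (intro sum.mono_neutral_cong_right) (auto simp: inner_add_left b_sgn algebra_simps)
  finally show ?thesis .
qed

lemma coord2_sum: "coord2 y = (\<Sum>d\<in>set as2. coeff y d * (norm d * x d * (1 - \<kappa> * \<kappa>)))"
proof -
  have "coord2 y = y \<bullet> (b2 + \<kappa> *\<^sub>R b1)" by (simp add: coord2_def inner_add_right)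
  also have "\<dots> = (\<Sum>d\<in>\<Delta>. coeff y d * (norm d * ((b2 + \<kappa> *\<^sub>R b1) \<bullet> sgn d)))"
    by (rule inner_coeffs)
  also have "\<dots> = (\<Sum>d\<in>set as2. coeff y d * (norm d * x d * (1 - \<kappa> * \<kappa>)))"
    using base_finite as_base un
    by (intro sum.mono_neutral_cong_right) (auto simp: inner_add_left b_sgn algebra_simps)
  finally show ?thesis .
qed

section \<open>Positive roots in the Coxeter plane\<close>

lemma weight_pos: "d \<in> \<Delta> \<Longrightarrow> 0 < norm d * x d * (1 - \<kappa> * \<kappa>)"
  using xpos base_nonzero lam_sq by simp

lemma coord_nonneg:
  assumes "b \<in> pos"
  shows "0 \<le> coord1 b" "0 \<le> coord2 b"
proof -
  have "0 \<le> coeff b d * (norm d * x d * (1 - \<kappa> * \<kappa>))" if "d \<in> \<Delta>" for d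
    using assms that weight_pos[OF that] by (simp add: pos_def)
  then show "0 \<le> coord1 b" "0 \<le> coord2 b"
    unfolding coord1_sum coord2_sum using as_base by (auto intro!: sum_nonneg)
qed

text \<open>A coordinate of a positive root is a sum of nonnegative terms with positive weights. If
  it vanishes, the support lies in one orthogonal colour class and the root is simple.\<close>

lemma coord_eq_0_support:
  assumes b: "b \<in> pos"
  shows "coord1 b = 0 \<Longrightarrow> b \<in> set as2" "coord2 b = 0 \<Longrightarrow> b \<in> set as1"
proof -
  have nn: "0 \<le> coeff b d * (norm d * x d * (1 - \<kappa> * \<kappa>))" if "d \<in> \<Delta>" for d
    using assms that weight_pos[OF that] by (simp add: pos_def)
  have c: "coeff b d = 0"
    if "(\<Sum>d\<in>S. coeff b d * (norm d * x d * (1 - \<kappa> * \<kappa>))) = 0" "S \<subseteq> \<Delta>" "d \<in> S" for S d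
  proof -
    have "coeff b d * (norm d * x d * (1 - \<kappa> * \<kappa>)) = 0"
      using that nn base_finite finite_subset[of S \<Delta>]
        sum_nonneg_eq_0_iff[of S "\<lambda>d. coeff b d * (norm d * x d * (1 - \<kappa> * \<kappa>))"] by blast
    moreover have "norm d * x d * (1 - \<kappa> * \<kappa>) \<noteq> 0" using weight_pos[of d] that by auto
    ultimately show ?thesis by (metis mult_eq_0_iff)
  qed
  show "b \<in> set as2" if "coord1 b = 0"
    using c[OF that[unfolded coord1_sum] as_base(1)] un
    by (intro pos_orthogonal_support[OF b as_base(2) orth2]) auto
  show "b \<in> set as1" if "coord2 b = 0"
    using c[OF that[unfolded coord2_sum] as_base(2)] un
    by (intro pos_orthogonal_support[OF b as_base(1) orth1]) auto
qed

lemma coord_add_pos: "b \<in> pos \<Longrightarrow> 0 < coord1 b + coord2 b"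
  using coord_nonneg[of b] coord_eq_0_support[of b] as_base by fastforce

lemma coord_minus: "coord1 (- y) = - coord1 y" "coord2 (- y) = - coord2 y"
  by (simp_all add: coord1_def coord2_def)

text \<open>The coordinates sum to a positive number on positive roots and to a negative one on
  their negatives. As they are functions of \<open>plane b\<close>, the sign of a root is visible in
  the Coxeter plane, which lets \<open>cox_order\<close> treat a power of \<open>cox\<close> that is
  trivial there.\<close>

lemma pos_iff_coord: "b \<in> \<Phi> \<Longrightarrow> b \<in> pos \<longleftrightarrow> 0 < coord1 b + coord2 b"
  using coord_add_pos[of b] coord_add_pos[of "- b"] pos_or_neg[of b] coord_minus[of b] by auto

lemma root_plane_nonzero: "b \<in> \<Phi> \<Longrightarrow> plane b \<noteq> 0"
proof
  assume b: "b \<in> \<Phi>" "plane b = 0"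
  then have "plane b = complex_of_real 0 * cis 0" by simp
  then have "coord1 b = 0" "coord2 b = 0" using plane_polar by fastforce+
  then show False
    using coord_add_pos[of b] coord_add_pos[of "- b"] pos_or_neg[OF b(1)] coord_minus[of b] by auto
qed

text \<open>By \<open>plane_polar\<close> the positive roots project to angles from
  \<open>\<theta> - pi\<close> to 0 and the negative ones to the opposite sector, so the angles
  strictly between 0 and \<open>\<theta>\<close> stay free.\<close>

lemma no_root_in_gap:
  assumes b: "b \<in> \<Phi>" "plane b = complex_of_real r * cis \<psi>" "0 < r" and \<psi>: "0 < \<psi>" "\<psi> < \<theta>"
  shows False
proof -
  have "0 < sin \<psi>" "0 < sin (\<theta> - \<psi>)"
    using \<psi> theta_bounds by (auto intro!: sin_gt_zero)
  then have "coord1 b < 0" "0 < coord2 b" using plane_polar[OF b(2)] b(3) by simp_all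
  then show False
    using coord_nonneg[of b] coord_nonneg[of "- b"] pos_or_neg[OF b(1)] coord_minus[of b] by auto
qed

lemma refl2_involution: "refl_prod as2 (refl_prod as2 y) = y"
proof -
  have r: "refl_prod as2 y = y - (\<Sum>a\<in>set as2. (2 * (y \<bullet> sgn a)) *\<^sub>R sgn a)" for y
    using refl_prod_orthogonal[OF _ orth2] dist by simp
  have "refl_prod as2 y \<bullet> sgn a = - (y \<bullet> sgn a)" if a: "a \<in> set as2" for a
  proof -
    have "(\<Sum>b\<in>set as2. 2 * (y \<bullet> sgn b) * (sgn b \<bullet> sgn a))
        = (\<Sum>b\<in>set as2. if b = a then 2 * (y \<bullet> sgn a) else 0)"
      using a orth2 base_nonzero as_base
      by (intro sum.cong) (auto simp: pairwise_def sgn_inner_self)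
    then show ?thesis using a by (simp add: r inner_diff_left inner_sum_left)
  qed
  then show ?thesis
    unfolding r[of "refl_prod as2 y"] by (simp add: r[of y] sum_negf)
qed

lemma as2_nonempty: "set as2 \<noteq> {}"
proof
  assume e: "set as2 = {}"
  then obtain d where "d \<in> set as1" using un base_nonempty by (metis Un_empty_right ex_in_conv)
  then show False using eig1[of d] e xpos[of d] lam as_base by auto
qed

text \<open>These are the roots on the rays at the angles 0 and \<open>- \<theta>\<close>. The
  half-open sector from \<open>- \<theta>\<close> to \<open>\<theta>\<close> is a fundamental domain
  for the rotation by \<open>2 * \<theta>\<close>, and \<open>root_in_sector\<close> shows that it
  contains no other roots.\<close>

definition orbit_reps where "orbit_reps = set as2 \<union> refl_prod as2 ` set as1"

lemma orbit_reps_subset: "orbit_reps \<subseteq> \<Phi>"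
  using as_roots refl_prod_rs[OF rs as_roots(2)] by (auto simp: orbit_reps_def)

lemma plane_as2:
  assumes "d \<in> set as2"
  shows "\<exists>r>0. plane d = complex_of_real r * cis 0"
proof -
  have d: "d \<in> \<Delta>" using assms as_base by blast
  have "coord1 d = 0"
    unfolding coord1_sum using assms as_base d by (intro sum.neutral) (auto simp: coeff_base)
  moreover from this have "0 < coord2 d" using coord_add_pos[of d] d base_pos by auto
  ultimately have f1: "d \<bullet> b1 = - \<kappa> * (d \<bullet> b2)" and "0 < d \<bullet> b2 + \<kappa> * (d \<bullet> b1)"
    by (simp_all add: coord1_def coord2_def)
  then have "0 < (1 - \<kappa> * \<kappa>) * (d \<bullet> b2)" by (simp add: algebra_simps)
  then have "0 < d \<bullet> b2" using lam_sq by (simp add: zero_less_mult_iff)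
  then show ?thesis
    using f1 sin_theta(1) by (intro exI[of _ "sin \<theta> * (d \<bullet> b2)"]) (simp add: plane_def complex_eq_iff)
qed

lemma plane_refl_as1:
  assumes "d \<in> set as1"
  shows "\<exists>r>0. plane (refl_prod as2 d) = complex_of_real r * cis (- \<theta>)"
proof -
  have d: "d \<in> \<Delta>" using assms as_base by blast
  have "coord2 d = 0"
    unfolding coord2_sum using assms as_base d by (intro sum.neutral) (auto simp: coeff_base)
  moreover from this have "0 < coord1 d" using coord_add_pos[of d] d base_pos by auto
  ultimately have f2: "d \<bullet> b2 = - \<kappa> * (d \<bullet> b1)" and "0 < d \<bullet> b1 + \<kappa> * (d \<bullet> b2)"
    by (simp_all add: coord1_def coord2_def)
  then have "0 < (1 - \<kappa> * \<kappa>) * (d \<bullet> b1)" by (simp add: algebra_simps)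
  then have "0 < d \<bullet> b1" using lam_sq by (simp add: zero_less_mult_iff)
  moreover have "plane (refl_prod as2 d) = complex_of_real (sin \<theta> * (d \<bullet> b1)) * cis (- \<theta>)"
    unfolding plane_refl2
    by (simp add: plane_def complex_eq_iff f2 cos_theta sin_theta_mult algebra_simps)
  ultimately show ?thesis using sin_theta(1) by (intro exI[of _ "sin \<theta> * (d \<bullet> b1)"]) simp
qed

text \<open>The negative of \<open>refl_prod as2\<close> acts on the plane as complex conjugation,
  so the empty sector has an empty mirror image. On the two remaining rays a vanishing coordinate,
  of \<open>b\<close> or of its image under \<open>refl_prod as2\<close>, identifies a simple
  root.\<close>

lemma root_in_sector:
  assumes b: "b \<in> \<Phi>" "plane b = complex_of_real r * cis \<psi>" "0 < r" and \<psi>: "- \<theta> \<le> \<psi>" "\<psi> < \<theta>"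
  shows "(\<psi> = 0 \<or> \<psi> = - \<theta>) \<and> b \<in> orbit_reps"
proof -
  have b': "refl_prod as2 b \<in> \<Phi>" using refl_prod_rs[OF rs] b as_base base_subset by blast
  have pb': "plane (- refl_prod as2 b) = complex_of_real r * cis (- \<psi>)"
    by (simp add: plane_minus plane_refl2 b(2) cis_cnj)
  have "\<not> 0 < \<psi>" using no_root_in_gap[OF b] \<psi> by blast
  moreover have "\<not> (0 < - \<psi> \<and> - \<psi> < \<theta>)"
    using no_root_in_gap[OF rs_minus[OF rs b'] pb' b(3)] by blast
  ultimately have "\<psi> = 0 \<or> \<psi> = - \<theta>" using \<psi> by linarith
  moreover have "b \<in> orbit_reps" if "\<psi> = 0"
  proof -
    have c: "coord1 b = 0" "0 < coord2 b"
      using plane_polar[OF b(2)] that b(3) sin_theta(1) by simp_all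
    then have "b \<in> pos" using pos_iff_coord[OF b(1)] by simp
    then show ?thesis using coord_eq_0_support c by (auto simp: orbit_reps_def)
  qed
  moreover have "b \<in> orbit_reps" if "\<psi> = - \<theta>"
  proof -
    have "coord1 (- refl_prod as2 b) < 0" "coord2 (- refl_prod as2 b) = 0"
      using plane_polar[OF pb'] that b(3) sin_theta(1) by simp_all
    then have c: "0 < coord1 (refl_prod as2 b)" "coord2 (refl_prod as2 b) = 0"
      by (simp_all add: coord_minus)
    then have "refl_prod as2 b \<in> pos" using pos_iff_coord[OF b'] by simp
    then have "refl_prod as2 b \<in> set as1" using coord_eq_0_support c by blast
    then show ?thesis using refl2_involution[of b] by (metis UnI2 image_eqI orbit_reps_def)
  qed
  ultimately show ?thesis by blast
qed

lemma cox_bij: "bij cox"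
  unfolding cox_def by (rule refl_prod_bij)

lemma cox_image: "cox ` \<Phi> = \<Phi>"
  unfolding cox_def by (rule refl_prod_image[OF rs]) (use as_roots in simp)

lemma cox_pow_image: "(cox ^^ k) ` \<Phi> = \<Phi>"
proof (induction k)
  case (Suc k)
  have "(cox ^^ Suc k) ` \<Phi> = cox ` (cox ^^ k) ` \<Phi>" by (simp add: image_comp)
  then show ?case using Suc cox_image by simp
qed simp

text \<open>Rotate back until the angle lies between \<open>- \<theta>\<close> and
  \<open>\<theta>\<close>. Keeping \<open>\<phi>\<close> as a real number, not modulo
  \<open>2 * pi\<close>, lets the conclusion also say that it is an integral multiple of
  \<open>\<theta>\<close>.\<close>

lemma root_reduction:
  assumes b: "b \<in> \<Phi>" "plane b = complex_of_real r * cis \<phi>" "0 < r" and \<phi>: "0 \<le> \<phi>"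
  shows "\<exists>k a. a \<in> orbit_reps \<and> (cox ^^ k) a = b \<and> (\<phi> = 2 * real k * \<theta> \<or> \<phi> = (2 * real k - 1) * \<theta>)"
proof -
  define k where "k = nat \<lfloor>(\<phi> + \<theta>) / (2 * \<theta>)\<rfloor>"
  have th: "0 < \<theta>" by (rule theta_bounds)
  have "0 \<le> (\<phi> + \<theta>) / (2 * \<theta>)" using \<phi> th by simp
  then have "real k \<le> (\<phi> + \<theta>) / (2 * \<theta>)" "(\<phi> + \<theta>) / (2 * \<theta>) < real k + 1"
    unfolding k_def by (simp_all add: of_nat_nat)
  then have k: "- \<theta> \<le> \<phi> - 2 * real k * \<theta>" "\<phi> - 2 * real k * \<theta> < \<theta>"
    using th by (simp_all add: field_simps)
  obtain a where a: "a \<in> \<Phi>" "(cox ^^ k) a = b" using b(1) cox_pow_image[of k] by (metis imageE)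
  have "cis (2 * real k * \<theta>) * plane a = complex_of_real r * cis \<phi>"
    using plane_cox_pow[of k a] a(2) b(2) by simp
  then have "cis (- (2 * real k * \<theta>)) * (cis (2 * real k * \<theta>) * plane a)
      = cis (- (2 * real k * \<theta>)) * (complex_of_real r * cis \<phi>)" by simp
  then have "plane a = complex_of_real r * cis (\<phi> - 2 * real k * \<theta>)"
    by (simp add: mult.assoc[symmetric] cis_mult)
  from root_in_sector[OF a(1) this b(3) k] show ?thesis
    using a(2) by (intro exI[of _ k] exI[of _ a]) (auto simp: algebra_simps)
qed

text \<open>A root of \<open>as2\<close> has angle 0, so its negative has angle pi, and
  \<open>root_reduction\<close> applies to that angle.\<close>

lemma theta_pi: obtains m :: nat where "0 < m" "real m * \<theta> = pi"
proof -
  obtain d where d: "d \<in> set as2" using as2_nonempty by (meson ex_in_conv)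
  obtain r where r: "0 < r" "plane d = complex_of_real r * cis 0" using plane_as2[OF d] by blast
  have "plane (- d) = complex_of_real r * cis pi" by (simp add: plane_minus r)
  moreover have "- d \<in> \<Phi>" using rs_minus[OF rs] d as_base base_subset by blast
  ultimately obtain k where "pi = 2 * real k * \<theta> \<or> pi = (2 * real k - 1) * \<theta>"
    using root_reduction[of "- d" r pi] r(1) pi_ge_zero by blast
  then have k: "pi = real_of_int (2 * int k) * \<theta> \<or> pi = real_of_int (2 * int k - 1) * \<theta>" by simp
  then obtain n :: int where n: "pi = real_of_int n * \<theta>" by blast
  then have "0 < real_of_int n * \<theta>" using pi_gt_zero by simp
  then have "0 < n" using theta_bounds(1) by (simp add: zero_less_mult_iff)
  then show thesis using that[of "nat n"] n by simp
qed

lemma cis_eq_imp: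
  assumes "cis s = cis t"
  obtains j :: int where "s - t = 2 * pi * real_of_int j"
proof -
  have "cis (s - t) = 1" using assms by (simp flip: cis_divide)
  then have "cos (s - t) = 1" by (simp add: complex_eq_iff)
  then show thesis using that by (auto simp: cos_one_2pi_int mult.commute mult.left_commute)
qed

lemma polar_cis_eq:
  assumes "complex_of_real r * cis s = complex_of_real r' * cis t" "0 < r" "0 < r'"
  shows "cis s = cis t"
proof -
  have "norm (complex_of_real r * cis s) = norm (complex_of_real r' * cis t)" using assms by simp
  then have "r = r'" using assms(2,3) by (simp add: norm_mult)
  then show ?thesis using assms by simp
qed

lemma orbit_reps_polar:
  assumes "a \<in> orbit_reps"
  obtains r and e :: int where "0 < r" "e = 0 \<or> e = 1" "plane a = complex_of_real r * cis (- (real_of_int e * \<theta>))"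
proof -
  have "(\<exists>r>0. plane a = complex_of_real r * cis 0) \<or> (\<exists>r>0. plane a = complex_of_real r * cis (- \<theta>))"
    using assms plane_as2 plane_refl_as1 by (auto simp: orbit_reps_def)
  then show thesis using that[of _ 0] that[of _ 1] by auto
qed

lemma orbit_reps_card: "card orbit_reps = card \<Delta>"
proof -
  have "set as2 \<inter> refl_prod as2 ` set as1 = {}"
  proof (rule ccontr)
    assume "\<not> ?thesis"
    then obtain d where d: "refl_prod as2 d \<in> set as2" "d \<in> set as1" by blast
    obtain r where r: "0 < r" "plane (refl_prod as2 d) = complex_of_real r * cis 0"
      using plane_as2[OF d(1)] by blast
    obtain r' where r': "0 < r'" "plane (refl_prod as2 d) = complex_of_real r' * cis (- \<theta>)"
      using plane_refl_as1[OF d(2)] by blast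
    have "cis 0 = cis (- \<theta>)" using polar_cis_eq r r' by metis
    then show False using sin_theta(1) by (simp add: complex_eq_iff)
  qed
  then have "card orbit_reps = card (set as2) + card (refl_prod as2 ` set as1)"
    unfolding orbit_reps_def by (intro card_Un_disjoint) auto
  also have "card (refl_prod as2 ` set as1) = card (set as1)"
    by (rule card_image) (rule inj_on_subset[OF bij_is_inj[OF refl_prod_bij]], simp)
  also have "card (set as2) + card (set as1) = card \<Delta>"
    using as_base un card_Un_disjoint[of "set as1" "set as2"] by simp
  finally show ?thesis .
qed

text \<open>The order is the \<open>m\<close> with \<open>m * \<theta> = pi\<close>: the power
  \<open>cox ^^ m\<close> is trivial on the plane, hence preserves the positive roots, hence is the
  identity. The powers below \<open>m\<close> carry the representatives, as many as there are simple
  roots, over all of \<open>\<Phi>\<close> without repetition.\<close>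

theorem cox_order: "map_order cox * DIM('a) = card \<Phi>"
proof -
  obtain m :: nat where m: "0 < m" "real m * \<theta> = pi" by (rule theta_pi)
  have th: "0 < \<theta>" by (rule theta_bounds)
  have multiple: "n = int m * j" if "real_of_int n * \<theta> = pi * real_of_int j" for n j
  proof -
    have "real_of_int n * \<theta> = real_of_int (int m * j) * \<theta>"
      using that m(2)[symmetric] by (simp add: mult.commute mult.left_commute)
    then show ?thesis using th by (simp only: mult_cancel_right of_int_eq_iff) simp
  qed
  have "cis (2 * real m * \<theta>) = 1" using m(2) by (simp add: mult.assoc)
  then have "plane ((cox ^^ m) y) = plane y" for y by (simp add: plane_cox_pow)
  moreover have "coord1 y = - Im (plane y)" "sin \<theta> * coord2 y = (1 - \<kappa> * \<kappa>) * Re (plane y) - sin \<theta> * \<kappa> * Im (plane y)" for y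
    by (simp_all add: plane_def coord1_def coord2_def algebra_simps)
  ultimately have coords: "coord1 ((cox ^^ m) y) = coord1 y" "coord2 ((cox ^^ m) y) = coord2 y" for y
    using sin_theta(1) by (metis, metis mult_left_cancel less_irrefl)
  have cm: "cox ^^ m = id"
    unfolding cox_def funpow_refl_prod
  proof (rule refl_prod_pos_imp_id)
    show "set (concat (replicate m (as1 @ as2))) \<subseteq> \<Delta>" using as_base by auto
    fix b assume b: "b \<in> pos"
    have "(cox ^^ m) b \<in> \<Phi>" using cox_pow_image b pos_subset by blast
    then have "(cox ^^ m) b \<in> pos" using b coords pos_iff_coord pos_subset by auto
    then show "refl_prod (concat (replicate m (as1 @ as2))) b \<in> pos"
      unfolding cox_def funpow_refl_prod .
  qed
  have "map_order cox = m"
    unfolding map_order_def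
  proof (rule Least_equality)
    fix n assume n: "0 < n \<and> cox ^^ n = id"
    obtain d where d: "d \<in> set as2" using as2_nonempty by (meson ex_in_conv)
    then have "plane d \<noteq> 0" using root_plane_nonzero as_base base_subset by blast
    then have "cis (2 * real n * \<theta>) = cis 0" using n plane_cox_pow[of n d] by simp
    then obtain j :: int where "2 * real n * \<theta> - 0 = 2 * pi * real_of_int j" by (rule cis_eq_imp)
    then have j: "int n = int m * j" using multiple[of "int n" j] by simp
    then have "0 < j" using n m by (metis of_nat_0_less_iff zero_less_mult_pos)
    then have "int m * 1 \<le> int m * j" by (intro mult_left_mono) auto
    then show "m \<le> n" using j by simp
  qed (use m cm in auto)
  moreover have "bij_betw (\<lambda>(k, a). (cox ^^ k) a) ({..<m} \<times> orbit_reps) \<Phi>"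
    unfolding bij_betw_def
  proof
    show "inj_on (\<lambda>(k, a). (cox ^^ k) a) ({..<m} \<times> orbit_reps)"
    proof (rule inj_onI, clarsimp)
      fix k a k' a'
      assume k: "k < m" "k' < m" and a: "a \<in> orbit_reps" "a' \<in> orbit_reps"
        and eq: "(cox ^^ k) a = (cox ^^ k') a'"
      obtain r and e :: int where e: "0 < r" "e = 0 \<or> e = 1"
        "plane a = complex_of_real r * cis (- (real_of_int e * \<theta>))"
        using orbit_reps_polar[OF a(1)] .
      obtain r' and e' :: int where e': "0 < r'" "e' = 0 \<or> e' = 1"
        "plane a' = complex_of_real r' * cis (- (real_of_int e' * \<theta>))"
        using orbit_reps_polar[OF a(2)] .
      have "complex_of_real r * cis (2 * real k * \<theta> - real_of_int e * \<theta>) =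
          complex_of_real r' * cis (2 * real k' * \<theta> - real_of_int e' * \<theta>)"
        using arg_cong[OF eq, of plane] unfolding plane_cox_pow e(3) e'(3)
        by (simp add: mult.left_commute cis_mult)
      then have "cis (2 * real k * \<theta> - real_of_int e * \<theta>) = cis (2 * real k' * \<theta> - real_of_int e' * \<theta>)"
        using polar_cis_eq e(1) e'(1) by blast
      then obtain j :: int where
        "(2 * real k * \<theta> - real_of_int e * \<theta>) - (2 * real k' * \<theta> - real_of_int e' * \<theta>) = 2 * pi * real_of_int j"
        by (rule cis_eq_imp)
      then have "real_of_int (2 * int k - e - 2 * int k' + e') * \<theta> = pi * real_of_int (2 * j)"
        by (simp add: algebra_simps)
      then have j: "2 * int k - e - 2 * int k' + e' = int m * (2 * j)" by (rule multiple)
      \<comment> \<open>\<open>e\<close> and \<open>e'\<close> tell on which of the two rays the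
        representatives lie. A full turn is an even multiple of \<open>\<theta>\<close>, so both
        have the same parity and the rays coincide.\<close>
      then have "e' - e = 2 * (int m * j - int k + int k')" by (simp add: algebra_simps)
      then have "even (e' - e)" by simp
      then have "e = e'" using e(2) e'(2) by auto
      then have kj: "int k - int k' = int m * j" using j by simp
      then have "\<bar>int m * j\<bar> < int m" using k by linarith
      then have "\<bar>j\<bar> < 1" using m by (simp add: abs_mult)
      then have "k = k'" using kj by simp
      moreover have "inj (cox ^^ k)" using cox_bij by (simp add: bij_is_inj bij_fn inj_fn)
      ultimately show "k = k' \<and> a = a'" using eq by (simp add: inj_eq)
    qed
    show "(\<lambda>(k, a). (cox ^^ k) a) ` ({..<m} \<times> orbit_reps) = \<Phi>"
    proof
      show "(\<lambda>(k, a). (cox ^^ k) a) ` ({..<m} \<times> orbit_reps) \<subseteq> \<Phi>"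
      proof clarsimp
        fix k a assume "a \<in> orbit_reps"
        then have "(cox ^^ k) a \<in> (cox ^^ k) ` \<Phi>" using orbit_reps_subset by blast
        then show "(cox ^^ k) a \<in> \<Phi>" unfolding cox_pow_image .
      qed
      show "\<Phi> \<subseteq> (\<lambda>(k, a). (cox ^^ k) a) ` ({..<m} \<times> orbit_reps)"
      proof
        fix b assume b: "b \<in> \<Phi>"
        have "plane b = complex_of_real (norm (plane b)) * cis (Arg2pi (plane b))"
          using Arg2pi_eq[of "plane b"] by (simp add: cis_conv_exp)
        moreover have "0 < norm (plane b)" using root_plane_nonzero[OF b] by simp
        ultimately obtain k a where ka: "a \<in> orbit_reps" "(cox ^^ k) a = b"
          using root_reduction[OF b, of "norm (plane b)" "Arg2pi (plane b)"] Arg2pi_ge_0 by blast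
        have "cox ^^ k = (cox ^^ m) ^^ (k div m) \<circ> cox ^^ (k mod m)"
          by (simp only: funpow_mult funpow_add[symmetric] mult_div_mod_eq)
        then have "(cox ^^ (k mod m)) a = b" using ka(2) cm by (simp add: id_funpow)
        then show "b \<in> (\<lambda>(k, a). (cox ^^ k) a) ` ({..<m} \<times> orbit_reps)"
          using ka(1) m by (intro image_eqI[of _ _ "(k mod m, a)"]) auto
      qed
    qed
  qed
  then have "card \<Phi> = m * card orbit_reps"
    using bij_betw_same_card by (fastforce simp: card_cartesian_product)
  ultimately show ?thesis using orbit_reps_card base_card by simp
qed

end

section \<open>From the Coxeter plane to the Coxeter number\<close>

context based_root_system
begin

lemma coxeter_element_order:
  assumes irr: "irreducible_roots \<Phi>" and dim: "2 \<le> DIM('a)"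
    and as: "distinct as" "set as = \<Delta>"
  shows "map_order (refl_prod as) * DIM('a) = card \<Phi>"
proof -
  have "\<exists>xs ys. cyc_eq (\<lambda>a b. a \<bullet> b = 0) as (xs @ ys) \<and> pairwise (\<lambda>a b. a \<bullet> b = 0) (set xs)
      \<and> pairwise (\<lambda>a b. a \<bullet> b = 0) (set ys)"
  proof (rule cyc_eq_bipartite)
    show "b \<bullet> a = 0" if "a \<bullet> b = 0" for a b :: 'a using that by (simp add: inner_commute)
    show "\<exists>v\<in>T. \<exists>u. \<forall>x\<in>T - {v}. x \<noteq> u \<longrightarrow> x \<bullet> v = 0" if "T \<subseteq> set as" "T \<noteq> {}" for T
      by (rule base_leaf) (use that as in auto)
  qed (rule as)
  then obtain xs ys where xy: "cyc_eq (\<lambda>a b. a \<bullet> b = 0) as (xs @ ys)"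
    and orth1: "pairwise (\<lambda>a b. a \<bullet> b = 0) (set xs)"
    and orth2: "pairwise (\<lambda>a b. a \<bullet> b = 0) (set ys)"
    by blast
  have m: "mset as = mset (xs @ ys)" using cyc_eq_mset[OF xy] .
  then have dist: "distinct (xs @ ys)" using as(1) mset_eq_imp_distinct_iff by blast
  have un: "set xs \<union> set ys = \<Delta>" using m as(2) by (metis set_append set_mset_mset)
  have disj: "set xs \<inter> set ys = {}" using dist by simp
  obtain x \<mu> where x: "\<And>d. d \<in> \<Delta> \<Longrightarrow> 0 < x d" and \<mu>: "0 < \<mu>"
    and eig: "\<And>d. d \<in> \<Delta> \<Longrightarrow> (\<Sum>e\<in>\<Delta>. x e *\<^sub>R sgn e) \<bullet> sgn d = \<mu> * x d"
    by (rule base_perron_vector[OF irr]) blast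
  \<comment> \<open>Within a class the Gram matrix is the identity, so the eigenvalue equation
    becomes \<open>eig1\<close> and \<open>eig2\<close>. Here \<open>\<kappa> < 1\<close> restates
    \<open>0 < \<mu>\<close>, and \<open>0 < \<kappa>\<close> holds because a connected base with
    two nonempty classes has nonorthogonal members in different classes.\<close>
  define \<kappa> where "\<kappa> = 1 - \<mu>"
  have ne: "S \<noteq> {}" if S: "T \<union> S = \<Delta>" and T: "pairwise (\<lambda>a b. a \<bullet> b = 0) T" for S T
  proof
    assume "S = {}"
    then have \<Delta>: "T = \<Delta>" using S by simp
    have "card \<Delta> \<noteq> 0" using dim base_card by simp
    then obtain d where d: "d \<in> \<Delta>" by fastforce
    have "\<Delta> = {d} \<union> (\<Delta> - {d})" using d by blast
    then have "{d} = {} \<or> \<Delta> - {d} = {}"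
      by (rule base_connected[OF irr]) (use T d in \<open>auto simp: \<Delta> pairwise_def\<close>)
    then have "\<Delta> = {d}" using d by auto
    then have "card \<Delta> = 1" by simp
    then show False using dim base_card by simp
  qed
  have ne1: "set xs \<noteq> {}" by (rule ne[OF _ orth2]) (use un in blast)
  have ne2: "set ys \<noteq> {}" using ne[OF un orth1] .
  have split: "(\<Sum>e\<in>set xs. x e *\<^sub>R sgn e) \<bullet> sgn d + (\<Sum>e\<in>set ys. x e *\<^sub>R sgn e) \<bullet> sgn d = \<mu> * x d"
    if "d \<in> \<Delta>" for d
    using eig[OF that] sum.union_disjoint[of "set xs" "set ys" "\<lambda>e. x e *\<^sub>R sgn e"] disj
    by (simp add: un inner_add_left)
  have eig1: "(\<Sum>e\<in>set ys. x e *\<^sub>R sgn e) \<bullet> sgn d = - \<kappa> * x d" if "d \<in> set xs" for d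
    using split[of d] sum_orthogonal[OF orth1, of d x] that un by (auto simp: \<kappa>_def algebra_simps)
  have eig2: "(\<Sum>e\<in>set xs. x e *\<^sub>R sgn e) \<bullet> sgn d = - \<kappa> * x d" if "d \<in> set ys" for d
    using split[of d] sum_orthogonal[OF orth2, of d x] that un by (auto simp: \<kappa>_def algebra_simps)
  have nonpos: "x e * (sgn e \<bullet> sgn d) \<le> 0" if "d \<in> set xs" "e \<in> set ys" for d e
  proof -
    have "d \<in> \<Delta>" "e \<in> \<Delta>" "e \<noteq> d" using that un disj by auto
    then show ?thesis
      using sgn_base_obtuse x by (simp add: mult_nonneg_nonpos less_imp_le)
  qed
  have "0 \<le> \<kappa>"
  proof -
    obtain d where d: "d \<in> set xs" using ne1 by (meson ex_in_conv)
    have "(\<Sum>e\<in>set ys. x e *\<^sub>R sgn e) \<bullet> sgn d \<le> 0"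
      unfolding inner_sum_left using nonpos[OF d] by (intro sum_nonpos) simp
    then have "0 \<le> \<kappa> * x d" using eig1[OF d] by simp
    then show ?thesis using x[of d] d un by (auto simp: zero_le_mult_iff)
  qed
  moreover have "\<kappa> \<noteq> 0"
  proof
    assume \<kappa>: "\<kappa> = 0"
    have "d \<bullet> e = 0" if d: "d \<in> set xs" and e: "e \<in> set ys" for d e
    proof -
      have "(\<Sum>e\<in>set ys. - (x e * (sgn e \<bullet> sgn d))) = 0"
        using eig1[OF d] \<kappa> by (simp add: inner_sum_left sum_negf)
      then have "- (x e * (sgn e \<bullet> sgn d)) = 0"
        using sum_nonneg_eq_0_iff[of "set ys" "\<lambda>e. - (x e * (sgn e \<bullet> sgn d))"] nonpos[OF d] e by auto
      then show ?thesis using x[of e] e un by (auto simp: inner_commute)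
    qed
    then show False using base_connected[OF irr un[symmetric]] ne1 ne2 by blast
  qed
  ultimately have \<kappa>: "0 < \<kappa>" "\<kappa> < 1" using \<mu> by (auto simp: \<kappa>_def)
  interpret bipartite_base \<Phi> \<Delta> xs ys x \<kappa>
    by unfold_locales (use dist un ne1 orth1 orth2 x \<kappa> eig1 eig2 in auto)
  show ?thesis using cox_order map_order_cyc_eq[OF xy] by (simp add: cox_def del: refl_prod_simps)
qed

end

text \<open>The given base makes \<open>coxeter_elements\<close> nonempty and the equation for the
  order fixes the common value, so the definite description in \<open>coxeter_number\<close> is
  proper.\<close>

theorem coxeter_number_card:
  fixes \<Phi> :: "'a::euclidean_space set"
  assumes rs: "root_system_in UNIV \<Phi>" and cr: "crystallographic \<Phi>" and irr: "irreducible_roots \<Phi>"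
    and base: "root_base \<Phi> \<Delta>" and dim: "2 \<le> DIM('a)"
  shows "coxeter_number \<Phi> * DIM('a) = card \<Phi>"
proof -
  have order: "map_order c * DIM('a) = card \<Phi>" if c: "c \<in> coxeter_elements \<Phi>" for c
  proof -
    obtain as where as: "c = refl_prod as" "distinct as" "root_base \<Phi> (set as)"
      using c unfolding coxeter_elements_def refl_prod_def by blast
    interpret based_root_system \<Phi> "set as" by unfold_locales (use rs cr as in auto)
    show ?thesis using coxeter_element_order[OF irr dim as(2)] as(1) by simp
  qed
  interpret based_root_system \<Phi> \<Delta> by unfold_locales (use rs cr base in auto)
  obtain as where "set as = \<Delta>" "distinct as" using finite_distinct_list[OF base_finite] by blast
  then have c: "refl_prod as \<in> coxeter_elements \<Phi>"
    using base unfolding coxeter_elements_def refl_prod_def by blast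
  have "coxeter_number \<Phi> = map_order (refl_prod as)"
    unfolding coxeter_number_def
  proof (rule the_equality)
    show "\<forall>c\<in>coxeter_elements \<Phi>. map_order c = map_order (refl_prod as)"
    proof
      fix c' assume "c' \<in> coxeter_elements \<Phi>"
      then have "map_order c' * DIM('a) = map_order (refl_prod as) * DIM('a)"
        using order c by simp
      then show "map_order c' = map_order (refl_prod as)" using dim by simp
    qed
  next
    show "h = map_order (refl_prod as)" if "\<forall>c\<in>coxeter_elements \<Phi>. map_order c = h" for h
      using bspec[OF that c] by simp
  qed
  then show ?thesis using order[OF c] by simp
qed

section \<open>Counting flats\<close>

lemma orthogonal_comp_insert: "(insert a S)\<^sup>\<bottom> = root_hyperplane a \<inter> S\<^sup>\<bottom>"
  by (auto simp: orthogonal_comp_def orthogonal_def root_hyperplane_def)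

lemma orthogonal_comp_span: "(span S)\<^sup>\<bottom> = S\<^sup>\<bottom>"
proof
  show "(span S)\<^sup>\<bottom> \<subseteq> S\<^sup>\<bottom>" by (rule orthogonal_comp_anti_mono) (rule span_superset)
  show "S\<^sup>\<bottom> \<subseteq> (span S)\<^sup>\<bottom>"
  proof
    fix x assume x: "x \<in> S\<^sup>\<bottom>"
    have "orthogonal x y" if "y \<in> span S" for y
      by (rule orthogonal_to_span[OF that]) (use x in \<open>auto simp: orthogonal_comp_def orthogonal_commute\<close>)
    then show "x \<in> (span S)\<^sup>\<bottom>" by (auto simp: orthogonal_comp_def orthogonal_commute)
  qed
qed

lemma span_insert_span: "span (insert a (span S)) = span (insert a S)"
proof -
  have "span S \<subseteq> span (insert a S)" by (intro span_mono) auto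
  then show ?thesis by (auto simp: span_eq span_base)
qed

text \<open>With \<open>X\<close> the orthogonal complement of \<open>S\<close>, complementation
  turns the members \<open>K \<inter> X\<close> of the restriction into the subspaces generated by
  \<open>S\<close> and one further root, whose roots form root systems when \<open>S\<close> is
  spanned by roots.\<close>

definition flats_over :: "'a::euclidean_space set \<Rightarrow> 'a set \<Rightarrow> 'a set set" where
  "flats_over P S = (\<lambda>a. span (insert a S)) ` (P - S)"

lemma card_restriction:
  fixes P S :: "'a::euclidean_space set"
  assumes S: "subspace S"
  shows "card (restriction (weyl_arrangement P) (S\<^sup>\<bottom>)) = card (flats_over P S)"
proof -
  have sub: "S\<^sup>\<bottom> \<subseteq> root_hyperplane a \<longleftrightarrow> a \<in> S" for a
  proof -
    have "S\<^sup>\<bottom> \<subseteq> root_hyperplane a \<longleftrightarrow> a \<in> S\<^sup>\<bottom>\<^sup>\<bottom>"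
      by (auto simp: orthogonal_comp_def orthogonal_def root_hyperplane_def inner_commute)
    then show ?thesis using orthogonal_comp_self[OF S] by simp
  qed
  have "restriction (weyl_arrangement P) (S\<^sup>\<bottom>) = (\<lambda>a. root_hyperplane a \<inter> S\<^sup>\<bottom>) ` (P - S)"
  proof (rule set_eqI)
    fix K
    have "K \<in> restriction (weyl_arrangement P) (S\<^sup>\<bottom>) \<longleftrightarrow>
        (\<exists>a\<in>P. K = root_hyperplane a \<inter> S\<^sup>\<bottom> \<and> \<not> S\<^sup>\<bottom> \<subseteq> root_hyperplane a)"
      unfolding restriction_def weyl_arrangement_def by blast
    also have "\<dots> \<longleftrightarrow> (\<exists>a\<in>P. K = root_hyperplane a \<inter> S\<^sup>\<bottom> \<and> a \<notin> S)"
      by (simp only: sub)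
    also have "\<dots> \<longleftrightarrow> K \<in> (\<lambda>a. root_hyperplane a \<inter> S\<^sup>\<bottom>) ` (P - S)" by blast
    finally show "K \<in> restriction (weyl_arrangement P) (S\<^sup>\<bottom>) \<longleftrightarrow>
        K \<in> (\<lambda>a. root_hyperplane a \<inter> S\<^sup>\<bottom>) ` (P - S)" .
  qed
  also have "\<dots> = (\<lambda>W. W\<^sup>\<bottom>) ` flats_over P S"
    unfolding flats_over_def image_image orthogonal_comp_span orthogonal_comp_insert ..
  finally have e: "restriction (weyl_arrangement P) (S\<^sup>\<bottom>) = (\<lambda>W. W\<^sup>\<bottom>) ` flats_over P S" .
  have "inj_on (\<lambda>W. W\<^sup>\<bottom>) (flats_over P S)"
  proof (rule inj_onI)
    fix V W assume "V \<in> flats_over P S" "W \<in> flats_over P S" and eq: "V\<^sup>\<bottom> = W\<^sup>\<bottom>"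
    then have "subspace V" "subspace W" by (auto simp: flats_over_def)
    then show "V = W" using eq orthogonal_comp_self by metis
  qed
  then show ?thesis unfolding e by (rule card_image)
qed

text \<open>By exchange, any vector of a flat outside \<open>S\<close> generates the flat over
  \<open>S\<close>, so the flats partition the members of \<open>P\<close> outside
  \<open>S\<close>.\<close>

lemma sum_flats_over:
  fixes P S :: "'a::euclidean_space set" and f :: "'a \<Rightarrow> real"
  assumes S: "subspace S" and P: "finite P"
  shows "(\<Sum>a\<in>P - S. f a) = (\<Sum>W\<in>flats_over P S. \<Sum>a\<in>P \<inter> W - S. f a)"
proof -
  have spS: "span S = S" using S by simp
  have "(\<Sum>a\<in>P - S. f a) =
      (\<Sum>W\<in>flats_over P S. \<Sum>a\<in>{a\<in>P - S. span (insert a S) = W}. f a)"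
    unfolding flats_over_def by (rule sum.image_gen) (use P in simp)
  also have "\<dots> = (\<Sum>W\<in>flats_over P S. \<Sum>a\<in>P \<inter> W - S. f a)"
  proof (rule sum.cong)
    fix W assume "W \<in> flats_over P S"
    then obtain b where b: "b \<in> P" "b \<notin> S" "W = span (insert b S)" by (auto simp: flats_over_def)
    have "span (insert a S) = W" if a: "a \<in> W" "a \<notin> S" for a
    proof -
      have "b \<in> span (insert a S)"
        using in_span_insert[of a b S] a b(3) spS by simp
      then show ?thesis
        using a(1) span_superset[of "insert a S"] span_superset[of "insert b S"] unfolding b(3)
        by (simp add: span_eq)
    qed
    moreover have "a \<in> span (insert a S)" for a by (simp add: span_base)
    ultimately have "{a\<in>P - S. span (insert a S) = W} = P \<inter> W - S" by auto
    then show "(\<Sum>a\<in>{a\<in>P - S. span (insert a S) = W}. f a) = (\<Sum>a\<in>P \<inter> W - S. f a)" by simp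
  qed simp
  finally show ?thesis .
qed

definition cos2 :: "'a::euclidean_space \<Rightarrow> 'a \<Rightarrow> real" where
  "cos2 b a = (sgn b \<bullet> sgn a)\<^sup>2"

lemma cos2_minus [simp]: "cos2 b (- a) = cos2 b a"
  by (simp add: cos2_def sgn_minus)

lemma cos2_self: "b \<noteq> 0 \<Longrightarrow> cos2 b b = 1"
  by (simp add: cos2_def sgn_inner_self)

lemma cos2_orthogonal: "b \<bullet> a = 0 \<Longrightarrow> cos2 b a = 0"
  by (simp add: cos2_def)

section \<open>Planes through one root\<close>

context based_root_system
begin

lemma pos_finite: "finite pos"
  using rs_finite[OF rs] pos_subset finite_subset by blast

lemma sum_section:
  fixes f :: "'a \<Rightarrow> real"
  assumes U: "\<And>a. a \<in> U \<Longrightarrow> - a \<in> U" and f: "\<And>a. f (- a) = f a"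
  shows "(\<Sum>a\<in>\<Phi> \<inter> U. f a) = 2 * (\<Sum>a\<in>pos \<inter> U. f a)"
proof -
  have "\<Phi> \<inter> U = (pos \<inter> U) \<union> uminus ` (pos \<inter> U)"
  proof
    show "\<Phi> \<inter> U \<subseteq> (pos \<inter> U) \<union> uminus ` (pos \<inter> U)"
    proof
      fix a assume a: "a \<in> \<Phi> \<inter> U"
      then consider "a \<in> pos \<inter> U" | "- a \<in> pos \<inter> U" using pos_or_neg U by blast
      then show "a \<in> (pos \<inter> U) \<union> uminus ` (pos \<inter> U)"
        by cases (auto intro: image_eqI[of a uminus "- a"])
    qed
    show "(pos \<inter> U) \<union> uminus ` (pos \<inter> U) \<subseteq> \<Phi> \<inter> U"
      using pos_subset U rs_minus[OF rs] by auto
  qed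
  moreover have "(pos \<inter> U) \<inter> uminus ` (pos \<inter> U) = {}" using pos_not_neg by fastforce
  ultimately have "(\<Sum>a\<in>\<Phi> \<inter> U. f a) = (\<Sum>a\<in>pos \<inter> U. f a) + (\<Sum>a\<in>uminus ` (pos \<inter> U). f a)"
    using pos_finite by (simp add: sum.union_disjoint)
  also have "(\<Sum>a\<in>uminus ` (pos \<inter> U). f a) = (\<Sum>a\<in>pos \<inter> U. f a)"
    by (subst sum.reindex) (auto simp: f inj_on_def)
  finally show ?thesis by simp
qed

lemma card_section:
  "(\<And>a. a \<in> U \<Longrightarrow> - a \<in> U) \<Longrightarrow> real (card (\<Phi> \<inter> U)) = 2 * real (card (pos \<inter> U))"
  using sum_section[of U "\<lambda>_. 1"] by simp

lemma sum_cos2_pos: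
  assumes irr: "irreducible_roots \<Phi>" and dim: "2 \<le> DIM('a)" and b: "b \<in> \<Phi>"
  shows "(\<Sum>a\<in>pos. cos2 b a) = real (coxeter_number \<Phi>) / 2"
proof -
  have nz: "b \<noteq> 0" using b rs_nonzero[OF rs] by blast
  have "2 * (\<Sum>a\<in>pos. cos2 b a) = (\<Sum>a\<in>\<Phi>. cos2 b a)"
    using sum_section[of UNIV "cos2 b"] by simp
  also have "\<dots> = real (card \<Phi>) / real DIM('a)"
    using sum_inner_sgn_irreducible[OF rs irr, of "sgn b"] sgn_inner_self[OF nz] by (simp add: cos2_def)
  also have "\<dots> = real (coxeter_number \<Phi>)"
  proof -
    have "real (card \<Phi>) = real (coxeter_number \<Phi>) * real DIM('a)"
      using coxeter_number_card[OF rs cr irr base dim] by (simp flip: of_nat_mult)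
    then show ?thesis by simp
  qed
  finally show ?thesis by simp
qed

lemma card_restriction_hyperplane:
  assumes irr: "irreducible_roots \<Phi>" and dim: "2 \<le> DIM('a)" and b: "b \<in> pos"
  shows "real (card (flats_over pos (span {b}))) = real (card pos) + 1 - real (coxeter_number \<Phi>)"
proof -
  define S where "S = span {b}"
  have bn: "b \<in> \<Phi>" "b \<noteq> 0" using b pos_subset rs_nonzero[OF rs] by auto
  have \<Phi>S: "\<Phi> \<inter> S = {b, - b}" using rs_line[OF rs bn(1)] by (simp add: S_def)
  then have PS: "pos \<inter> S = {b}" using b pos_not_neg[OF b] pos_subset by blast
  \<comment> \<open>The weight \<open>1 - 2 * cos2 b a\<close> is chosen so that every plane counts
    once: over all positive roots of the plane it sums to 0, and removing \<open>b\<close>, whose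
    weight is -1, leaves 1.\<close>
  have one: "(\<Sum>a\<in>pos \<inter> W - S. 1 - 2 * cos2 b a) = 1" if W: "W \<in> flats_over pos S" for W
  proof -
    obtain c where c: "c \<in> pos" "c \<notin> S" "W = span (insert c S)" using W by (auto simp: flats_over_def)
    have Weq: "W = span {c, b}" by (simp add: c(3) S_def span_insert_span)
    have c\<Phi>: "{c, b} \<subseteq> \<Phi>" using c bn pos_subset by auto
    have "independent {c, b}"
      using bn c(2) by (simp add: independent_insert S_def)
    moreover have "c \<noteq> b" using c(2) by (auto simp: S_def span_base)
    ultimately have dimW: "dim W = 2" by (simp add: Weq dim_eq_card_independent)
    have rsW: "root_system_in W (\<Phi> \<inter> W)" using rs_section[OF rs c\<Phi>] by (simp add: Weq)
    have bW: "b \<in> W" by (simp add: Weq span_base)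
    have neg: "- a \<in> W" if "a \<in> W" for a using that by (simp add: Weq span_neg)
    have "(\<Sum>a\<in>\<Phi> \<inter> W. cos2 b a) = real (card (\<Phi> \<inter> W)) / 2"
      using sum_inner_sgn_rank_2[OF rsW dimW, of b] bn bW by (simp add: cos2_def)
    then have s: "2 * (\<Sum>a\<in>pos \<inter> W. cos2 b a) = real (card (pos \<inter> W))"
      using sum_section[OF neg, where f = "cos2 b"] card_section[OF neg] by simp
    have "pos \<inter> W - S = pos \<inter> W - {b}" using PS by blast
    then have "(\<Sum>a\<in>pos \<inter> W - S. 1 - 2 * cos2 b a)
        = (\<Sum>a\<in>pos \<inter> W. 1 - 2 * cos2 b a) - (1 - 2 * cos2 b b)"
      using b bW pos_finite by (simp add: sum_diff1)
    also have "\<dots> = 1"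
      using s cos2_self[OF bn(2)] by (simp add: sum_subtractf sum_distrib_left)
    finally show ?thesis .
  qed
  have "real (card (flats_over pos S)) = (\<Sum>W\<in>flats_over pos S. \<Sum>a\<in>pos \<inter> W - S. 1 - 2 * cos2 b a)"
    using one by simp
  also have "\<dots> = (\<Sum>a\<in>pos - S. 1 - 2 * cos2 b a)"
    by (rule sum_flats_over[symmetric]) (simp_all add: S_def pos_finite)
  also have "pos - S = pos - {b}" using PS by blast
  also have "(\<Sum>a\<in>pos - {b}. 1 - 2 * cos2 b a) = (\<Sum>a\<in>pos. 1 - 2 * cos2 b a) - (1 - 2 * cos2 b b)"
    using b pos_finite by (simp add: sum_diff1)
  also have "\<dots> = real (card pos) + 1 - real (coxeter_number \<Phi>)"
    using sum_cos2_pos[OF irr dim bn(1)] cos2_self[OF bn(2)]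
    by (simp add: sum_subtractf flip: sum_distrib_left)
  finally show ?thesis by (simp add: S_def)
qed

end

section \<open>Three-dimensional flats through an orthogonal pair of roots\<close>

locale orthogonal_pair = based_root_system +
  fixes b g :: "'a::euclidean_space"
  assumes irr: "irreducible_roots \<Phi>" and b: "b \<in> pos" and g: "g \<in> pos"
    and bg: "b \<bullet> g = 0" and plane_roots: "\<Phi> \<inter> span {b, g} = {b, - b, g, - g}"
begin

lemma swapped: "orthogonal_pair \<Phi> \<Delta> g b"
proof unfold_locales
  show "\<Phi> \<inter> span {g, b} = {g, - g, b, - b}"
    using plane_roots by (simp add: insert_commute)
qed (use irr b g bg in \<open>auto simp: inner_commute\<close>)

abbreviation S where "S \<equiv> span {b, g}"
abbreviation F where "F \<equiv> flats_over pos S"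

definition kflat :: "'a \<Rightarrow> 'a set \<Rightarrow> real" where
  "kflat c W = (\<Sum>a\<in>pos \<inter> W - S. cos2 c a)"

lemma bg_roots: "b \<in> \<Phi>" "g \<in> \<Phi>" "b \<noteq> 0" "g \<noteq> 0" "b \<noteq> g" "b \<noteq> - g" "g \<noteq> - b"
proof -
  show "b \<in> \<Phi>" "g \<in> \<Phi>" using b g pos_subset by auto
  then show nz: "b \<noteq> 0" "g \<noteq> 0" using rs_nonzero[OF rs] by auto
  show "b \<noteq> g" "b \<noteq> - g" "g \<noteq> - b" using nz bg by auto
qed

lemma bg_independent: "independent {b, g}"
proof -
  have "pairwise orthogonal {b, g}" using bg by (auto simp: pairwise_def orthogonal_def inner_commute)
  then show ?thesis using pairwise_orthogonal_independent bg_roots by force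
qed

lemma dim_S: "dim S = 2"
  using dim_eq_card_independent[OF bg_independent] bg_roots by simp

lemma dim_2: "2 \<le> DIM('a)"
  using dim_subset_UNIV[of S] dim_S by simp

lemma pos_S: "pos \<inter> S = {b, g}"
  using plane_roots b g pos_not_neg pos_subset by blast

lemma flatD:
  assumes "W \<in> F"
  shows "subspace W" "S \<subseteq> W" "dim W = 3" "root_system_in W (\<Phi> \<inter> W)" "b \<in> W" "g \<in> W"
    "a \<in> W \<Longrightarrow> - a \<in> W"
proof -
  obtain c where c: "c \<in> pos" "c \<notin> S" "W = span (insert c S)"
    using assms by (auto simp: flats_over_def)
  have Weq: "W = span {c, b, g}" by (simp add: c(3) span_insert_span)
  show "subspace W" by (simp add: c(3))
  show SW: "S \<subseteq> W" unfolding Weq by (intro span_mono) auto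
  have "c \<noteq> b" "c \<noteq> g" using c(2) by (auto simp: span_base)
  moreover have "independent {c, b, g}" by (rule independent_insertI[OF c(2) bg_independent])
  ultimately show "dim W = 3" using bg_roots by (simp add: Weq dim_eq_card_independent)
  show "root_system_in W (\<Phi> \<inter> W)"
    unfolding Weq by (rule rs_section[OF rs]) (use c bg_roots pos_subset in auto)
  show "b \<in> W" "g \<in> W" by (simp_all add: Weq span_base)
  show "- a \<in> W" if "a \<in> W" using that by (simp add: Weq span_neg)
qed

lemma sum_flat_pos:
  assumes W: "W \<in> F"
  shows "(\<Sum>a\<in>pos \<inter> W. f a) = f b + f g + (\<Sum>a\<in>pos \<inter> W - S. f a :: real)"
proof -
  have "pos \<inter> W - S = pos \<inter> W - {b, g}" using pos_S by blast
  moreover have "{b, g} \<subseteq> pos \<inter> W" using b g flatD[OF W] by auto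
  ultimately show ?thesis
    using pos_finite bg_roots sum.subset_diff[of "{b, g}" "pos \<inter> W" f] by simp
qed

text \<open>With m further positive roots the flat has m + 2 of them, and the mean squared cosine
  1/3 gives (m + 2) / 3 = 1 + k, where \<open>b\<close> contributes 1 and \<open>g\<close>
  contributes 0.\<close>

lemma irreducible_flat:
  assumes W: "W \<in> F" and irrW: "\<not> reducible (\<Phi> \<inter> W)"
  shows "real (card (pos \<inter> W - S)) - 1 = 3 * kflat b W"
proof -
  note f = flatD[OF W]
  have "irreducible_roots (\<Phi> \<inter> W)" using irrW f bg_roots by (auto simp: irreducible_roots_def)
  moreover have "sgn b \<in> W" using f by (simp add: sgn_div_norm subspace_scale)
  ultimately have "(\<Sum>a\<in>\<Phi> \<inter> W. cos2 b a) = real (card (\<Phi> \<inter> W)) / 3"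
    using sum_inner_sgn_irreducible[OF f(4)] f(3) sgn_inner_self[OF bg_roots(3)] by (simp add: cos2_def)
  then have "3 * (\<Sum>a\<in>pos \<inter> W. cos2 b a) = real (card (pos \<inter> W))"
    using sum_section[OF f(7), where f = "cos2 b"] card_section[OF f(7)] by simp
  moreover have "real (card (pos \<inter> W)) = 2 + real (card (pos \<inter> W - S))"
    using sum_flat_pos[OF W, of "\<lambda>_. 1"] by simp
  moreover have "(\<Sum>a\<in>pos \<inter> W. cos2 b a) = 1 + kflat b W"
    using sum_flat_pos[OF W, of "cos2 b"] cos2_self cos2_orthogonal[OF bg] bg_roots
    by (simp add: kflat_def)
  ultimately show ?thesis by simp
qed

text \<open>\<open>d\<close> spans the isolated summand of type A1, and the rank 2 part containing
  \<open>c\<close> may still be reducible.\<close>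

definition split_flat :: "'a \<Rightarrow> 'a \<Rightarrow> 'a set \<Rightarrow> 'a set \<Rightarrow> bool" where
  "split_flat c d \<Lambda> W \<longleftrightarrow> \<Phi> \<inter> W = {d, - d} \<union> \<Lambda> \<and> c \<in> \<Lambda> \<and> d \<notin> \<Lambda> \<and> - d \<notin> \<Lambda> \<and> (\<forall>a\<in>\<Lambda>. d \<bullet> a = 0) \<and>
     root_system_in (span \<Lambda>) \<Lambda> \<and> dim (span \<Lambda>) = 2"

text \<open>Compare the rank 1 summand with \<open>b\<close> and \<open>g\<close>. If it contains
  neither, both lie in the rank 2 part, whose span is then \<open>S\<close>, and only the summand
  itself is left outside \<open>S\<close>.\<close>

lemma reducible_flat_cases:
  assumes W: "W \<in> F" and red: "reducible (\<Phi> \<inter> W)"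
  obtains (b) \<Lambda> where "split_flat b g \<Lambda> W" | (g) \<Lambda> where "split_flat g b \<Lambda> W"
    | (none) d where "pos \<inter> W - S = {d}" "d \<bullet> b = 0" "d \<bullet> g = 0"
proof -
  note f = flatD[OF W]
  obtain d \<Lambda> where d: "\<Phi> \<inter> W = {d, - d} \<union> \<Lambda>" "\<forall>a\<in>\<Lambda>. d \<bullet> a = 0" "root_system_in (span \<Lambda>) \<Lambda>"
    "dim (span \<Lambda>) + 1 = dim W" "d \<notin> \<Lambda>" "- d \<notin> \<Lambda>" "d \<noteq> 0"
    by (rule reducible_rank_1_part[OF f(4) red]) (use f(3) in \<open>simp, blast\<close>)
  have mem: "b \<in> {d, - d} \<union> \<Lambda>" "g \<in> {d, - d} \<union> \<Lambda>" using d(1) f bg_roots by blast+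
  consider "g \<in> {d, - d}" | "b \<in> {d, - d}" | "b \<in> \<Lambda>" "g \<in> \<Lambda>" using mem by blast
  then show thesis
  proof cases
    case 1
    then have "b \<in> \<Lambda>" using mem bg_roots by auto
    moreover have "{g, - g} = {d, - d}" using 1 by auto
    ultimately have "split_flat b g \<Lambda> W"
      using d f(3) 1 unfolding split_flat_def by auto
    then show thesis by (rule that(1))
  next
    case 2
    then have "g \<in> \<Lambda>" using mem bg_roots by auto
    moreover have "{b, - b} = {d, - d}" using 2 by auto
    ultimately have "split_flat g b \<Lambda> W"
      using d f(3) 2 unfolding split_flat_def by auto
    then show thesis by (rule that(2))
  next
    case 3
    have "span \<Lambda> = S"
    proof (rule sym, rule subspace_dim_equal)
      show "S \<subseteq> span \<Lambda>" using 3 by (intro span_mono) auto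
      show "dim (span \<Lambda>) \<le> dim S" using d(4) f(3) dim_S by simp
    qed auto
    then have \<Lambda>S: "\<Lambda> \<subseteq> S" using span_superset by metis
    have db: "d \<bullet> b = 0" "d \<bullet> g = 0" using d(2) 3 by auto
    have dS: "d \<notin> S"
    proof
      assume "d \<in> S"
      then have "orthogonal d d"
        by (rule orthogonal_to_span) (use db in \<open>auto simp: orthogonal_def\<close>)
      then show False using d(7) by (simp add: orthogonal_self)
    qed
    then have mdS: "- d \<notin> S" using span_neg[of "- d"] by auto
    have pW: "pos \<inter> W = pos \<inter> ({d, - d} \<union> \<Lambda>)" using d(1) pos_subset by blast
    have "d \<in> \<Phi>" using d(1) by blast
    then consider "d \<in> pos" "- d \<notin> pos" | "- d \<in> pos" "d \<notin> pos"
      using pos_or_neg pos_not_neg by fastforce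
    then show thesis
    proof cases
      case 1
      then have "pos \<inter> W - S = {d}" using \<Lambda>S dS unfolding pW by auto
      then show thesis using that(3) db by blast
    next
      case 2
      then have "pos \<inter> W - S = {- d}" using \<Lambda>S mdS unfolding pW by auto
      then show thesis using that(3)[of "- d"] db by simp
    qed
  qed
qed

text \<open>All of \<open>\<Lambda>\<close> is orthogonal to \<open>g\<close>, so the sum for
  \<open>g\<close> vanishes. The positive roots of \<open>\<Lambda>\<close> are \<open>b\<close> and
  the m further ones, and the rank 2 mean gives (m + 1) / 2 = 1 + k.\<close>

lemma split_flat_pos:
  assumes W: "W \<in> F" and s: "split_flat b g \<Lambda> W"
  shows "pos \<inter> W - S = pos \<inter> \<Lambda> - {b}" "kflat g W = 0"
    "real (card (pos \<inter> W - S)) - 1 = 2 * kflat b W"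
proof -
  note sd = s[unfolded split_flat_def]
  have rs\<Lambda>: "root_system_in (span \<Lambda>) \<Lambda>" and dim: "dim (span \<Lambda>) = 2" and b\<Lambda>: "b \<in> \<Lambda>"
    and orth: "\<And>a. a \<in> \<Lambda> \<Longrightarrow> g \<bullet> a = 0" using sd by auto
  have \<Lambda>: "\<Lambda> \<subseteq> \<Phi>" "\<Phi> \<inter> W = {g, - g} \<union> \<Lambda>" using sd by blast+
  have neg: "- b \<notin> pos" "- g \<notin> pos" using pos_not_neg b g by auto
  have bS: "b \<in> S" and gS: "g \<in> S" by (simp_all add: span_base)
  have PL: "a = b" if "a \<in> pos" "a \<in> \<Lambda>" "a \<in> S" for a
  proof -
    have "a \<in> \<Phi> \<inter> S" using that \<Lambda>(1) by blast
    then have "a \<in> {b, - b, g, - g}" unfolding plane_roots .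
    then show "a = b" using that neg sd by auto
  qed
  have pW: "pos \<inter> W = pos \<inter> ({g, - g} \<union> \<Lambda>)" using \<Lambda>(2) pos_subset by blast
  show e: "pos \<inter> W - S = pos \<inter> \<Lambda> - {b}"
    unfolding pW using PL neg bS gS by auto
  show "kflat g W = 0"
    unfolding kflat_def e by (rule sum.neutral) (use orth cos2_orthogonal in auto)
  have "(\<Sum>a\<in>\<Lambda>. cos2 b a) = real (card \<Lambda>) / 2"
    using sum_inner_sgn_rank_2[OF rs\<Lambda> dim b\<Lambda>] by (simp add: cos2_def)
  moreover have "\<Phi> \<inter> \<Lambda> = \<Lambda>" using \<Lambda> by blast
  ultimately have "2 * (\<Sum>a\<in>pos \<inter> \<Lambda>. cos2 b a) = real (card (pos \<inter> \<Lambda>))"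
    using sum_section[of \<Lambda> "cos2 b"] card_section[of \<Lambda>] rs_minus[OF rs\<Lambda>] by simp
  moreover have "(\<Sum>a\<in>pos \<inter> \<Lambda>. cos2 b a) = 1 + kflat b W"
    using sum.remove[of "pos \<inter> \<Lambda>" b "cos2 b"] b b\<Lambda> pos_finite cos2_self bg_roots
    by (simp add: kflat_def e)
  moreover have "real (card (pos \<inter> \<Lambda>)) = 1 + real (card (pos \<inter> W - S))"
  proof -
    have "card (pos \<inter> \<Lambda>) = Suc (card (pos \<inter> \<Lambda> - {b}))"
      by (rule card.remove) (use b b\<Lambda> pos_finite in auto)
    then show ?thesis unfolding e by simp
  qed
  ultimately show "real (card (pos \<inter> W - S)) - 1 = 2 * kflat b W" by simp
qed

text \<open>At least one of the two sums is 0 in every case, so the symmetric expression covers both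
  ways of splitting. If neither \<open>b\<close> nor \<open>g\<close> is isolated, there is one
  further positive root and both sums are 0.\<close>

lemma reducible_flat:
  assumes W: "W \<in> F" and red: "reducible (\<Phi> \<inter> W)"
  shows "real (card (pos \<inter> W - S)) - 1 = 2 * (kflat b W + kflat g W)"
proof -
  interpret sw: orthogonal_pair \<Phi> \<Delta> g b by (rule swapped)
  have S': "span {g, b} = S" by (simp add: insert_commute)
  show ?thesis
    using W red
  proof (cases rule: reducible_flat_cases)
    case (b \<Lambda>)
    then show ?thesis using split_flat_pos[OF W b] by simp
  next
    case (g \<Lambda>)
    then show ?thesis
      using sw.split_flat_pos[of W \<Lambda>] W
      by (simp add: S' sw.split_flat_def split_flat_def sw.kflat_def kflat_def)
  next
    case (none d)
    then show ?thesis by (simp add: kflat_def cos2_orthogonal inner_commute)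
  qed
qed

definition ksum :: "'a \<Rightarrow> real" where
  "ksum c = (\<Sum>W | W \<in> F \<and> reducible (\<Phi> \<inter> W). kflat c W)"

lemma F_finite: "finite F"
  unfolding flats_over_def using pos_finite by simp

text \<open>The value for a reducible flat is written as \<open>3 * kflat b W\<close> plus the
  correction \<open>2 * kflat g W - kflat b W\<close>. The main term then runs over all flats and
  sums to three times h/2 - 1, the 1 being the share of \<open>b\<close> itself.\<close>

lemma flat_count:
  "real (card pos) - real (card F) = 3 * real (coxeter_number \<Phi>) / 2 - 1 + 2 * ksum g - ksum b"
proof -
  have "(\<Sum>W\<in>F. real (card (pos \<inter> W - S)) - 1) =
      (\<Sum>W\<in>F. 3 * kflat b W + (if reducible (\<Phi> \<inter> W) then 2 * kflat g W - kflat b W else 0))"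
    using irreducible_flat reducible_flat by (intro sum.cong) auto
  also have "\<dots> = 3 * (\<Sum>W\<in>F. kflat b W) + (\<Sum>W | W \<in> F \<and> reducible (\<Phi> \<inter> W). 2 * kflat g W - kflat b W)"
    using F_finite by (simp add: sum.distrib sum_distrib_left sum.If_cases Int_def)
  also have "\<dots> = 3 * (\<Sum>W\<in>F. kflat b W) + 2 * ksum g - ksum b"
    by (simp add: ksum_def sum_subtractf sum_distrib_left)
  also have "(\<Sum>W\<in>F. real (card (pos \<inter> W - S)) - 1) = (\<Sum>W\<in>F. \<Sum>a\<in>pos \<inter> W - S. 1) - real (card F)"
    by (simp add: sum_subtractf)
  also have "(\<Sum>W\<in>F. \<Sum>a\<in>pos \<inter> W - S. 1) = (\<Sum>a\<in>pos - S. 1 :: real)"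
    by (rule sum_flats_over[symmetric]) (simp_all add: pos_finite)
  also have "(\<Sum>W\<in>F. kflat b W) = (\<Sum>a\<in>pos - S. cos2 b a)"
    unfolding kflat_def by (rule sum_flats_over[symmetric]) (simp_all add: pos_finite)
  finally have *: "(\<Sum>a\<in>pos - S. 1) - real (card F) = 3 * (\<Sum>a\<in>pos - S. cos2 b a) + 2 * ksum g - ksum b" .
  have PS: "(\<Sum>a\<in>pos. h a) = h b + h g + (\<Sum>a\<in>pos - S. h a)" for h :: "'a \<Rightarrow> real"
  proof -
    have "pos - S = pos - {b, g}" using pos_S by blast
    then show ?thesis
      using sum.subset_diff[of "{b, g}" pos h] pos_finite b g bg_roots by simp
  qed
  show ?thesis
    using * PS[of "\<lambda>_. 1"] PS[of "cos2 b"] sum_cos2_pos[OF irr dim_2 bg_roots(1)]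
      cos2_self[OF bg_roots(3)] cos2_orthogonal[OF bg] by simp
qed

section \<open>The correspondence between \<open>M_set\<close> and reducible flats\<close>

text \<open>Being irreducible, \<open>\<Lambda>\<close> lies in the rank 2 summand of the flat, and
  \<open>irreducible_rank_2_subsystem_full\<close> makes it all of that summand. The other summand
  must be the line of \<open>g\<close>. The last claim recovers \<open>\<Lambda>\<close> from
  \<open>W\<close> and yields the injectivity used in \<open>K_number_ksum\<close>.\<close>

lemma M_set_flat:
  assumes L: "\<Lambda> \<in> M_set \<Phi> g b"
  defines "W \<equiv> span ({g} \<union> \<Lambda>)"
  shows "W \<in> F" "reducible (\<Phi> \<inter> W)" "split_flat b g \<Lambda> W" "\<Lambda> = {a\<in>\<Phi> \<inter> W. a \<bullet> g = 0}"
proof -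
  have perp: "a \<bullet> g = 0" if "a \<in> \<Lambda>" for a using L that by (auto simp: M_set_def root_perp_def)
  have sub: "subsystem \<Lambda> \<Phi>" and irr\<Lambda>: "irreducible_roots \<Lambda>" and rank: "root_rank \<Lambda> = 2"
    and b\<Lambda>: "b \<in> \<Lambda>" and redW: "reducible (\<Phi> \<inter> W)" and rankW: "root_rank (\<Phi> \<inter> W) = 3"
    using L by (auto simp: M_set_def W_def)
  have \<Lambda>: "\<Lambda> \<subseteq> \<Phi>" "root_system_in (span \<Lambda>) \<Lambda>" using sub by (auto simp: subsystem_def)
  have W\<Phi>: "span (\<Phi> \<inter> W) = W"
    unfolding W_def by (rule rs_section_eq[OF rs]) (use \<Lambda> bg_roots in auto)
  then have dimW: "dim W = 3" using rankW by (simp add: root_rank_def dim_span)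
  then have dim3: "3 \<le> dim (UNIV :: 'a set)" using dim_subset_UNIV[of W] by simp
  have full: "\<Phi> \<inter> span \<Lambda> = \<Lambda>"
    by (rule irreducible_rank_2_subsystem_full[OF rs cr irr dim3 sub irr\<Lambda> rank])
  have dim\<Lambda>: "dim (span \<Lambda>) = 2" using rank by (simp add: root_rank_def)
  show red: "reducible (\<Phi> \<inter> W)" by (rule redW)
  have SW: "S \<subseteq> W" unfolding W_def using b\<Lambda> by (intro span_mono) auto
  \<comment> \<open>A member of \<open>F\<close> is generated over \<open>S\<close> by a positive
    root. Rank 2 supplies a root of \<open>\<Lambda>\<close> off the line of \<open>b\<close>, and
    \<open>plane_roots\<close> keeps it outside \<open>S\<close>.\<close>
  obtain a where a: "a \<in> pos" "a \<in> \<Lambda>" "a \<notin> S"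
  proof -
    have "\<not> \<Lambda> \<subseteq> span {b}"
    proof
      assume "\<Lambda> \<subseteq> span {b}"
      then have "dim \<Lambda> \<le> card {b}" by (intro dim_le_card) auto
      then show False using dim\<Lambda> by (simp add: dim_span)
    qed
    then obtain a0 where a0: "a0 \<in> \<Lambda>" "a0 \<notin> span {b}" by blast
    have "a0 \<noteq> b" "a0 \<noteq> - b" using a0 span_base[of b "{b}"] span_neg[OF span_base[of b "{b}"]] by auto
    moreover have "a0 \<noteq> g" "a0 \<noteq> - g" using perp[OF a0(1)] bg_roots by auto
    ultimately have "a0 \<notin> S" using plane_roots a0 \<Lambda> by blast
    moreover from this have "- a0 \<notin> S" using span_neg[of "- a0" "{b, g}"] by auto
    moreover have "- a0 \<in> \<Lambda>" using rs_minus[OF \<Lambda>(2) a0(1)] .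
    ultimately show thesis using that pos_or_neg[of a0] a0 \<Lambda> by blast
  qed
  have "span (insert a S) = W"
  proof (rule subspace_dim_equal)
    show "span (insert a S) \<subseteq> W"
      unfolding W_def by (rule span_minimal) (use a SW in \<open>auto simp: W_def span_base\<close>)
    have "a \<noteq> b" "a \<noteq> g" using a(3) by (auto simp: span_base)
    moreover have "independent {a, b, g}" by (rule independent_insertI[OF a(3) bg_independent])
    ultimately have "dim (span {a, b, g}) = 3" using bg_roots by (simp add: dim_eq_card_independent)
    moreover have "span {a, b, g} \<subseteq> span (insert a S)"
      by (intro span_mono) (auto simp: span_base)
    ultimately show "dim W \<le> dim (span (insert a S))" using dimW dim_subset by metis
  qed (simp_all add: W_def)
  then show WF: "W \<in> F" using a by (auto simp: flats_over_def)
  note f = flatD[OF WF]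
  obtain d \<Psi> where d: "\<Phi> \<inter> W = {d, - d} \<union> \<Psi>" "\<forall>a\<in>\<Psi>. d \<bullet> a = 0" "root_system_in (span \<Psi>) \<Psi>"
    "dim (span \<Psi>) + 1 = dim W" "d \<notin> \<Psi>" "- d \<notin> \<Psi>" "d \<noteq> 0"
    by (rule reducible_rank_1_part[OF f(4) red]) (use f(3) in \<open>simp, blast\<close>)
  have \<Lambda>W: "\<Lambda> \<subseteq> \<Phi> \<inter> W" using \<Lambda> by (auto simp: W_def span_base)
  have "\<Lambda> = (\<Lambda> \<inter> {d, - d}) \<union> (\<Lambda> \<inter> \<Psi>)" using \<Lambda>W d(1) by blast
  then have "\<Lambda> \<inter> {d, - d} = {} \<or> \<Lambda> \<inter> \<Psi> = {}"
    by (rule irreducible_roots_part[OF irr\<Lambda>]) (use d(2) in auto)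
  moreover have "\<Lambda> \<inter> \<Psi> \<noteq> {}"
  proof
    assume "\<Lambda> \<inter> \<Psi> = {}"
    then have "\<Lambda> \<subseteq> span {d}"
      using \<Lambda>W d(1) span_base[of d "{d}"] span_neg[OF span_base[of d "{d}"]] by auto
    then have "dim \<Lambda> \<le> card {d}" by (intro dim_le_card) auto
    then show False using dim\<Lambda> by (simp add: dim_span)
  qed
  ultimately have \<Lambda>\<Psi>: "\<Lambda> \<subseteq> \<Psi>" using \<Lambda>W d(1) by blast
  have "span \<Lambda> = span \<Psi>"
    by (rule subspace_dim_equal) (use \<Lambda>\<Psi> d(4) dimW dim\<Lambda> in \<open>auto intro: span_mono[THEN subsetD]\<close>)
  then have eq: "\<Psi> = \<Lambda>" using full \<Lambda>\<Psi> d(1) span_superset[of \<Psi>] by blast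
  have "g \<notin> \<Lambda>" using perp[of g] bg_roots by auto
  moreover have "g \<in> {d, - d} \<union> \<Lambda>" using d(1) eq f bg_roots by blast
  ultimately have "{g, - g} = {d, - d}" "g = d \<or> g = - d" by auto
  then show s: "split_flat b g \<Lambda> W"
    using d eq b\<Lambda> dim\<Lambda> unfolding split_flat_def by auto
  show "\<Lambda> = {a\<in>\<Phi> \<inter> W. a \<bullet> g = 0}"
    using s perp bg_roots unfolding split_flat_def by auto
qed

text \<open>A nonzero sum provides a root \<open>a\<close> outside \<open>S\<close> that is not
  orthogonal to \<open>b\<close>. This excludes every case except an isolated \<open>g\<close>, and
  it prevents \<open>\<Lambda>\<close> from splitting into two perpendicular lines.\<close>

lemma flat_M_set:
  assumes W: "W \<in> F" and red: "reducible (\<Phi> \<inter> W)" and k: "kflat b W \<noteq> 0"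
  shows "\<exists>\<Lambda>\<in>M_set \<Phi> g b. W = span ({g} \<union> \<Lambda>)"
proof -
  note f = flatD[OF W]
  obtain a where a: "a \<in> pos \<inter> W - S" "b \<bullet> a \<noteq> 0"
    using k cos2_orthogonal[of b] unfolding kflat_def by (meson sum.not_neutral_contains_not_neutral)
  obtain \<Lambda> where "split_flat b g \<Lambda> W"
    using W red
  proof (cases rule: reducible_flat_cases)
    case (b \<Lambda>)
    then show thesis by (rule that)
  next
    case (g \<Lambda>)
    have "a \<in> \<Phi> \<inter> W" "a \<noteq> b" "a \<noteq> - b"
      using a pos_subset span_base[of b "{b, g}"] span_neg[OF span_base[of b "{b, g}"]] by auto
    then show thesis using g a by (auto simp: split_flat_def)
  next
    case (none d)
    then show thesis using a by (auto simp: inner_commute)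
  qed
  note s = this[unfolded split_flat_def]
  have \<Lambda>: "\<Lambda> \<subseteq> \<Phi>" "\<Phi> \<inter> W = {g, - g} \<union> \<Lambda>" using s by blast+
  have sub: "subsystem \<Lambda> \<Phi>" using s \<Lambda> by (simp add: subsystem_def)
  have Weq: "span ({g} \<union> \<Lambda>) = W"
  proof -
    have "span ({g} \<union> \<Lambda>) = span (\<Phi> \<inter> W)"
      by (rule span_eq[THEN iffD2]) (auto simp: \<Lambda>(2) span_base span_neg)
    then show ?thesis using rs_span[OF f(4)] by simp
  qed
  have a\<Lambda>: "a \<in> \<Lambda>"
  proof -
    have "a \<noteq> g" "a \<noteq> - g"
      using a span_base[of g "{b, g}"] span_neg[OF span_base[of g "{b, g}"]] by auto
    then show ?thesis using a \<Lambda>(2) pos_subset by blast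
  qed
  have "\<not> reducible \<Lambda>"
  proof
    assume red\<Lambda>: "reducible \<Lambda>"
    have rs\<Lambda>: "root_system_in (span \<Lambda>) \<Lambda>" and dim: "dim (span \<Lambda>) = 2" using s by auto
    obtain e \<Psi> where e: "\<Lambda> = {e, - e} \<union> \<Psi>" "\<forall>x\<in>\<Psi>. e \<bullet> x = 0" "root_system_in (span \<Psi>) \<Psi>"
      "dim (span \<Psi>) + 1 = dim (span \<Lambda>)"
      by (rule reducible_rank_1_part[OF rs\<Lambda> red\<Lambda>]) (use dim in \<open>simp, blast\<close>)
    have ab: "a \<noteq> b" "a \<noteq> - b"
      using a span_base[of b "{b, g}"] span_neg[OF span_base[of b "{b, g}"]] by auto
    have "\<Psi> = {x, - x}" if "x \<in> \<Psi>" for x using rs_dim_1[OF e(3) that] e(4) dim by simp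
    moreover have "b \<in> {e, - e} \<union> \<Psi>" "a \<in> {e, - e} \<union> \<Psi>" using s a\<Lambda> e(1) by auto
    ultimately show False using e(2) a(2) ab by (auto simp: inner_commute)
  qed
  then have "irreducible_roots \<Lambda>" using s by (auto simp: irreducible_roots_def)
  moreover have "\<Lambda> \<subseteq> root_perp \<Phi> g" using s \<Lambda> by (auto simp: root_perp_def inner_commute)
  moreover have "subsystem (\<Phi> \<inter> W) \<Phi>" using f(4) rs_span[OF f(4)] by (simp add: subsystem_def)
  moreover have "root_rank (\<Phi> \<inter> W) = 3" using rs_span[OF f(4)] f(3) by (simp add: root_rank_def)
  ultimately have "\<Lambda> \<in> M_set \<Phi> g b"
    using s sub red by (simp add: M_set_def Weq[simplified] root_rank_def)
  then show ?thesis using Weq by blast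
qed

text \<open>Reducible flats that do not come from \<open>M_set\<close> contribute 0 by
  \<open>flat_M_set\<close>, so the sum over \<open>M_set\<close> extends to all reducible
  flats.\<close>

lemma K_number_ksum: "K_number \<Phi> pos g b = ksum b"
proof -
  define \<sigma> where "\<sigma> = (\<lambda>\<Lambda>. span ({g} \<union> \<Lambda>))"
  have inj: "inj_on \<sigma> (M_set \<Phi> g b)"
  proof (rule inj_onI)
    fix \<Lambda> \<Lambda>' assume "\<Lambda> \<in> M_set \<Phi> g b" "\<Lambda>' \<in> M_set \<Phi> g b" "\<sigma> \<Lambda> = \<sigma> \<Lambda>'"
    then show "\<Lambda> = \<Lambda>'" using M_set_flat(4)[of \<Lambda>] M_set_flat(4)[of \<Lambda>'] by (simp add: \<sigma>_def)
  qed
  have "K_number \<Phi> pos g b = (\<Sum>\<Lambda>\<in>M_set \<Phi> g b. kflat b (\<sigma> \<Lambda>))"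
    unfolding K_number_def
  proof (rule sum.cong)
    fix \<Lambda> assume L: "\<Lambda> \<in> M_set \<Phi> g b"
    have "pos \<inter> \<sigma> \<Lambda> - S = pos \<inter> \<Lambda> - {b}"
      unfolding \<sigma>_def by (rule split_flat_pos(1)[OF M_set_flat(1,3)[OF L]])
    then show "(\<Sum>\<delta>\<in>pos \<inter> \<Lambda> - {b}. (sgn b \<bullet> sgn \<delta>)\<^sup>2) = kflat b (\<sigma> \<Lambda>)"
      by (simp add: kflat_def cos2_def)
  qed simp
  also have "\<dots> = (\<Sum>W\<in>\<sigma> ` M_set \<Phi> g b. kflat b W)"
    using inj by (simp add: sum.reindex)
  also have "\<dots> = ksum b"
    unfolding ksum_def
  proof (rule sum.mono_neutral_left)
    show "\<sigma> ` M_set \<Phi> g b \<subseteq> {W \<in> F. reducible (\<Phi> \<inter> W)}"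
      using M_set_flat(1,2) by (auto simp: \<sigma>_def)
    show "\<forall>W\<in>{W \<in> F. reducible (\<Phi> \<inter> W)} - \<sigma> ` M_set \<Phi> g b. kflat b W = 0"
      using flat_M_set unfolding \<sigma>_def by blast
  qed (use F_finite in simp)
  finally show ?thesis .
qed

lemma restriction_difference:
  "real (card (restriction (weyl_arrangement pos) (root_hyperplane b)))
      - real (card (restriction (weyl_arrangement pos) (root_hyperplane b \<inter> root_hyperplane g)))
    = real (coxeter_number \<Phi>) / 2 + K_number \<Phi> pos g b"
proof -
  interpret sw: orthogonal_pair \<Phi> \<Delta> g b by (rule swapped)
  have S': "span {g, b} = S" by (simp add: insert_commute)
  have hb: "root_hyperplane b = (span {b})\<^sup>\<bottom>"
    unfolding orthogonal_comp_span orthogonal_comp_insert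
    by (simp add: orthogonal_comp_def)
  have hS: "root_hyperplane b \<inter> root_hyperplane g = S\<^sup>\<bottom>"
    unfolding orthogonal_comp_span orthogonal_comp_insert
    by (simp add: orthogonal_comp_def)
  have k: "sw.ksum c = ksum c" for c
    by (simp add: sw.ksum_def ksum_def sw.kflat_def kflat_def S')
  have "ksum b = ksum g" using flat_count sw.flat_count by (simp add: S' k)
  then show ?thesis
    using flat_count card_restriction_hyperplane[OF irr dim_2 b]
    by (simp add: hS) (simp add: hb card_restriction K_number_ksum)
qed

end

theorem proposition3p13:
  fixes \<Phi> P :: "(real ^ 'n) set" and \<beta> :: "nat \<Rightarrow> real ^ 'n" and X :: "(real ^ 'n) set"
    and A :: "(real ^ 'n) set set" and i :: nat
  assumes "root_system_in UNIV \<Phi>" and "crystallographic \<Phi>" and "irreducible_roots \<Phi>"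
    and "positive_system \<Phi> P"
    and "A = weyl_arrangement P"
    and "\<beta> 1 \<in> P" and "\<beta> 2 \<in> P"
    and "X = root_hyperplane (\<beta> 1) \<inter> root_hyperplane (\<beta> 2)"
    and "flat_of_type_A1_sq \<Phi> X"
    and "\<Phi> \<inter> span {\<beta> 1, \<beta> 2} = {\<beta> 1, - \<beta> 1, \<beta> 2, - \<beta> 2}"
    and "i \<in> {1, 2}"
  shows "real (card (restriction A (root_hyperplane (\<beta> i)))) - real (card (restriction A X)) =
           real (coxeter_number \<Phi>) / 2 + K_number \<Phi> P (\<beta> (3 - i)) (\<beta> i)"
proof -
  obtain \<Delta> where \<Delta>: "root_base \<Phi> \<Delta>"
    and P: "P = {\<beta>\<in>\<Phi>. \<exists>k :: real ^ 'n \<Rightarrow> nat. \<beta> = (\<Sum>\<alpha>\<in>\<Delta>. real (k \<alpha>) *\<^sub>R \<alpha>)}"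
    using assms(4) unfolding positive_system_def by blast
  interpret based_root_system \<Phi> \<Delta> by unfold_locales (use assms(1,2) \<Delta> in auto)
  have Ppos: "P = pos" unfolding P using pos_iff by blast
  have "X = (span {\<beta> 1, \<beta> 2})\<^sup>\<bottom>"
    unfolding orthogonal_comp_span orthogonal_comp_insert assms(8)
    by (simp add: orthogonal_comp_def)
  then have "X\<^sup>\<bottom> = span {\<beta> 1, \<beta> 2}" by (simp add: orthogonal_comp_self)
  then have "type_A1_A1 {\<beta> 1, - \<beta> 1, \<beta> 2, - \<beta> 2}"
    using assms(9,10) by (simp add: flat_of_type_A1_sq_def)
  then obtain c d where c: "c \<noteq> 0" "d \<noteq> 0" "{\<beta> 1, - \<beta> 1, \<beta> 2, - \<beta> 2} = {c, - c, d, - d}"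
    and cd: "c \<bullet> d = 0"
    unfolding type_A1_A1_def type_A1_def by (auto simp: inner_commute)
  \<comment> \<open>The type only provides some orthogonal pair \<open>c\<close>, \<open>d\<close>
    with the same four signed vectors. As \<open>c\<close> and \<open>d\<close> lie on different
    lines, \<open>\<beta> 1\<close> and \<open>\<beta> 2\<close> agree with them up to order and
    sign.\<close>
  have orth: "\<beta> 1 \<bullet> \<beta> 2 = 0"
  proof -
    have ne: "c \<noteq> d" "c \<noteq> - d" "d \<noteq> - c" using c(1,2) cd by auto
    have mem: "\<beta> 1 \<in> {c, - c, d, - d}" "c \<in> {\<beta> 1, - \<beta> 1, \<beta> 2, - \<beta> 2}" "d \<in> {\<beta> 1, - \<beta> 1, \<beta> 2, - \<beta> 2}"
      using c(3) by blast+
    have dc: "d \<bullet> c = 0" using cd by (simp add: inner_commute)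
    consider "\<beta> 1 = c \<or> \<beta> 1 = - c" | "\<beta> 1 = d \<or> \<beta> 1 = - d" using mem(1) by blast
    then show ?thesis
    proof cases
      case 1
      then have "d \<noteq> \<beta> 1" "d \<noteq> - \<beta> 1" using ne by auto
      then have "\<beta> 2 = d \<or> \<beta> 2 = - d" using mem(3) by auto
      then show ?thesis using 1 cd by auto
    next
      case 2
      then have "c \<noteq> \<beta> 1" "c \<noteq> - \<beta> 1" using ne by auto
      then have "\<beta> 2 = c \<or> \<beta> 2 = - c" using mem(2) by auto
      then show ?thesis using 2 dc by auto
    qed
  qed
  interpret op: orthogonal_pair \<Phi> \<Delta> "\<beta> 1" "\<beta> 2"
    by unfold_locales (use assms(3,6,7,10) orth Ppos in auto)
  interpret sw: orthogonal_pair \<Phi> \<Delta> "\<beta> 2" "\<beta> 1" by (rule op.swapped)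
  consider "i = 1" | "i = 2" using assms(11) by blast
  then show ?thesis
  proof cases
    case 1
    then show ?thesis using op.restriction_difference by (simp add: assms(5,8) Ppos)
  next
    case 2
    then show ?thesis using sw.restriction_difference by (simp add: assms(5,8) Ppos Int_commute)
  qed
qed

end
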